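(* Let $k\geq 2$ be an integer and let $\alpha\in[\frac{k-1}{k},1]$ be rational. Let $\ell$ be the smallest positive integer such that $\frac{\ell}{2k-1}$ and $\frac{\alpha\ell}{2k-1}$ are integers. There exist integers $s_0,q_0$ such that for every integer $s\geq s_0$ and every prime power $q\geq q_0$ there exists a bipartite graph $G$ with parts $M,N$, $|M|=q^{\alpha\ell}$, $|N|=q^{\ell}$, such that $G$ is $\Theta_{s,2k-1}$-free and \[e(G)\geq \frac12 |M|^{\frac{k}{2k-1}}|N|^{\frac{k}{2k-1}}.\]
   Context: The theta graph $\Theta_{s,k}$ is the graph consisting of $s$ paths of length $k$ with the same two endpoints that are otherwise pairwise vertex-disjoint. *)

theory Defs
  imports Complex_Main "HOL-Number_Theory.Prime_Powers"
begin

type_synonym 'a ugraph = "'a set \<times> 'a set set"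

abbreviation verts :: "'a ugraph \<Rightarrow> 'a set" where
  "verts G \<equiv> fst G"

abbreviation edges :: "'a ugraph \<Rightarrow> 'a set set" where
  "edges G \<equiv> snd G"

definition finite_simple_graph :: "'a ugraph \<Rightarrow> bool" where
  "finite_simple_graph G \<longleftrightarrow>
     finite (verts G) \<and> (\<forall>e\<in>edges G. e \<subseteq> verts G \<and> card e = 2)"

definition bipartite_with_parts :: "'a ugraph \<Rightarrow> 'a set \<Rightarrow> 'a set \<Rightarrow> bool" where
  "bipartite_with_parts G M N \<longleftrightarrow>
     finite_simple_graph G \<and> verts G = M \<union> N \<and> M \<inter> N = {} \<and>
     (\<forall>e\<in>edges G. \<exists>x\<in>M. \<exists>y\<in>N. e = {x, y})"

text \<open>Containment is as a not necessarily induced subgraph.\<close>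

definition contains_copy :: "'a ugraph \<Rightarrow> 'b ugraph \<Rightarrow> bool" where
  "contains_copy G H \<longleftrightarrow>
     (\<exists>f. inj_on f (verts H) \<and> f ` verts H \<subseteq> verts G \<and> (\<forall>e\<in>edges H. f ` e \<in> edges G))"

definition free_of :: "'a ugraph \<Rightarrow> 'b ugraph \<Rightarrow> bool" where
  "free_of G H \<longleftrightarrow> \<not> contains_copy G H"

text \<open>
  The \<open>j\<close>-th vertex (\<open>0 \<le> j \<le> k\<close>) of the \<open>i\<close>-th path. The two endpoints, \<open>j = 0\<close> and \<open>j = k\<close>,
  do not depend on \<open>i\<close>.
\<close>

definition theta_vertex :: "nat \<Rightarrow> nat \<Rightarrow> nat \<Rightarrow> nat \<times> nat" where
  "theta_vertex k i j = (if j = 0 \<or> j = k then (0, j) else (i, j))"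

definition theta_graph :: "nat \<Rightarrow> nat \<Rightarrow> (nat \<times> nat) ugraph" where
  "theta_graph s k =
     ({theta_vertex k i j | i j. i < s \<and> j \<le> k},
      {{theta_vertex k i j, theta_vertex k i (Suc j)} | i j. i < s \<and> j < k})"

lemma finite_simple_graph_theta_graph: "finite_simple_graph (theta_graph s k)"
proof -
  have "{theta_vertex k i j | i j. i < s \<and> j \<le> k}
      = (\<lambda>(i, j). theta_vertex k i j) ` ({..<s} \<times> {..k})"
    by auto
  then have "finite {theta_vertex k i j | i j. i < s \<and> j \<le> k}"
    by simp
  moreover have "e \<subseteq> {theta_vertex k i j | i j. i < s \<and> j \<le> k} \<and> card e = 2"
    if "e \<in> {{theta_vertex k i j, theta_vertex k i (Suc j)} | i j. i < s \<and> j < k}" for e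
  proof -
    from that obtain i j where e: "e = {theta_vertex k i j, theta_vertex k i (Suc j)}"
      and ij: "i < s" "j < k" by blast
    have "j \<le> k" "Suc j \<le> k" using ij by simp_all
    then have "e \<subseteq> {theta_vertex k i j | i j. i < s \<and> j \<le> k}"
      using e ij(1) by blast
    moreover have "theta_vertex k i j \<noteq> theta_vertex k i (Suc j)"
      by (simp add: theta_vertex_def)
    ultimately show ?thesis using e by simp
  qed
  ultimately show ?thesis
    unfolding finite_simple_graph_def theta_graph_def fst_conv snd_conv by blast
qed

end

theory Submission
  imports Defs "HOL-Library.FuncSet" "HOL-Algebra.Algebraic_Closure" "HOL-Number_Theory.Residues"
begin

text \<open>
  Write \<open>g = l / (2k - 1)\<close>, \<open>h = \<alpha> l / (2k - 1)\<close>, \<open>t = (k - 1) (g + h)\<close>, \<open>r = k h - (k - 1) g\<close> and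
  \<open>r' = k g - (k - 1) h\<close>, and let \<open>K\<close> be the field with \<open>q\<close> elements. The vertices in \<open>M\<close> are the
  pairs \<open>(a, u)\<close> with \<open>a \<in> K\<^sup>r\<close>, \<open>u \<in> K\<^sup>t\<close>, those in \<open>N\<close> the pairs \<open>(b, v)\<close> with \<open>b \<in> K\<^bsup>r'\<^esup>\<close>,
  \<open>v \<in> K\<^sup>t\<close>, and they are adjacent if \<open>u\<^sub>j + v\<^sub>j = f\<^sub>j (a, b, u\<^sub>0, \<dots>, u\<^bsub>j-1\<^esub>, v\<^sub>0, \<dots>, v\<^bsub>j-1\<^esub>)\<close> for
  all \<open>j < t\<close>. Each level is an abelian cover of the previous one, and there are exactly
  \<open>q\<^bsup>r+r'+t\<^esup> = |M|\<^bsup>k/(2k-1)\<^esup> |N|\<^bsup>k/(2k-1)\<^esup>\<close> edges. A walk of length \<open>2k - 1\<close> between two given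
  vertices is described by \<open>(k - 1) (r + r') = t\<close> free label coordinates, and closing up is one
  polynomial equation per level. It remains to choose polynomials \<open>f\<^sub>j\<close> of bounded degree for which
  boundedly many nonbacktracking walks close up.

  No algebraic geometry is needed. The dimension of a finite set \<open>A\<close> of walks is read off from the
  growth in \<open>d\<close> of the number of restrictions to \<open>A\<close> of polynomials of degree at most \<open>d\<close>. Every set
  is a union of boundedly many pieces on which two nonzero polynomials of bounded degree have a
  nonzero product. On such a piece an equation that does not hold identically lowers the growth
  exponent by one, and a piece with exponent \<open>0\<close> has bounded size. The pieces that occur at level
  \<open>j\<close> depend only on the earlier \<open>f\<^sub>i\<close> and are polynomially many in \<open>q\<close>, so by counting some \<open>f\<^sub>j\<close>
  gives an equation that is nontrivial on all pieces where the edges of the walk do not cancel.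

  Cancellation needs vertices of the walk that coincide at lower levels. A level at which everything
  cancels separates such vertices, and each coincidence costs at least one of the \<open>t\<close> free
  coordinates. Hence there are still at least as many equations that do not cancel as remaining
  dimensions.
\<close>


section \<open>Finite fields and polynomial functions\<close>

text \<open>A field inside a ring of arbitrary characteristic; its unit \<open>e\<close> is in general not the \<open>1\<close> of the ring.\<close>

locale finite_subfield =
  fixes K :: "'a::comm_ring_1 set" and e :: 'a
  assumes finite_K: "finite K"
    and unit_mem: "e \<in> K" and unit_nonzero: "e \<noteq> 0"
    and add_mem: "x \<in> K \<Longrightarrow> y \<in> K \<Longrightarrow> x + y \<in> K"
    and mult_mem: "x \<in> K \<Longrightarrow> y \<in> K \<Longrightarrow> x * y \<in> K"
    and uminus_mem: "x \<in> K \<Longrightarrow> - x \<in> K"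
    and unit_mult: "x \<in> K \<Longrightarrow> e * x = x"
    and inverse_ex: "x \<in> K \<Longrightarrow> x \<noteq> 0 \<Longrightarrow> \<exists>y\<in>K. x * y = e"
begin

abbreviation q :: nat where "q \<equiv> card K"

lemma zero_mem: "0 \<in> K"
  using add_mem[OF unit_mem uminus_mem[OF unit_mem]] by simp

lemma diff_mem: "x \<in> K \<Longrightarrow> y \<in> K \<Longrightarrow> x - y \<in> K"
  using add_mem[of x "- y"] uminus_mem[of y] by simp

lemma sum_mem: "(\<And>i. i \<in> I \<Longrightarrow> f i \<in> K) \<Longrightarrow> sum f I \<in> K"
  by (induction I rule: infinite_finite_induct) (auto simp: zero_mem add_mem)

lemma sign_mem: "x \<in> K \<Longrightarrow> (-1) ^ m * x \<in> K"
  by (induction m) (auto simp: uminus_mem)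

lemma sign_unit_nonzero: "(-1) ^ m * e \<noteq> 0"
  using unit_nonzero by (cases "even m") auto

lemma mult_eq_zeroD:
  assumes "x \<in> K" "y \<in> K" "x * y = 0"
  shows "x = 0 \<or> y = 0"
proof (rule ccontr)
  assume nonzero: "\<not> (x = 0 \<or> y = 0)"
  then obtain x' where x': "x' \<in> K" "x * x' = e" using inverse_ex assms(1) by blast
  have "y = e * y" using unit_mult assms(2) by simp
  also have "\<dots> = x' * (x * y)" using x' by (metis mult.assoc mult.commute)
  finally show False using assms(3) nonzero by simp
qed

lemma mult_right_cancel_mem:
  "c \<in> K \<Longrightarrow> x \<in> K \<Longrightarrow> y \<in> K \<Longrightarrow> c \<noteq> 0 \<Longrightarrow> x * c = y * c \<Longrightarrow> x = y"
  using mult_eq_zeroD[of "x - y" c] diff_mem by (auto simp: left_diff_distrib)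

lemma two_le_card: "2 \<le> q"
proof -
  have "card {0, e} \<le> q" by (rule card_mono) (auto simp: finite_K zero_mem unit_mem)
  moreover have "card {0, e} = 2" using unit_nonzero by (metis card_2_iff)
  ultimately show ?thesis by simp
qed

inductive polyfun :: "('x \<Rightarrow> 'a) set \<Rightarrow> nat \<Rightarrow> ('x \<Rightarrow> 'a) \<Rightarrow> bool" for \<Gamma> where
  polyfun_const: "c \<in> K \<Longrightarrow> polyfun \<Gamma> d (\<lambda>_. c)"
| polyfun_gen: "g \<in> \<Gamma> \<Longrightarrow> 1 \<le> d \<Longrightarrow> polyfun \<Gamma> d g"
| polyfun_add: "polyfun \<Gamma> d f \<Longrightarrow> polyfun \<Gamma> d g \<Longrightarrow> polyfun \<Gamma> d (\<lambda>x. f x + g x)"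
| polyfun_uminus: "polyfun \<Gamma> d f \<Longrightarrow> polyfun \<Gamma> d (\<lambda>x. - f x)"
| polyfun_mult: "polyfun \<Gamma> d f \<Longrightarrow> polyfun \<Gamma> d' g \<Longrightarrow> d + d' \<le> d'' \<Longrightarrow> polyfun \<Gamma> d'' (\<lambda>x. f x * g x)"

lemma polyfun_mono: "polyfun \<Gamma> d f \<Longrightarrow> d \<le> d' \<Longrightarrow> polyfun \<Gamma> d' f"
proof (induction arbitrary: d' rule: polyfun.induct)
  case (polyfun_mult d f d1 g d2)
  then show ?case using polyfun.polyfun_mult[of \<Gamma> d f d1 g d'] by simp
qed (auto intro: polyfun.intros)

lemma polyfun_diff: "polyfun \<Gamma> d f \<Longrightarrow> polyfun \<Gamma> d g \<Longrightarrow> polyfun \<Gamma> d (\<lambda>x. f x - g x)"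
  using polyfun_add[of \<Gamma> d f "\<lambda>x. - g x"] polyfun_uminus[of \<Gamma> d g] by simp

lemma polyfun_scale: "c \<in> K \<Longrightarrow> polyfun \<Gamma> d f \<Longrightarrow> polyfun \<Gamma> d (\<lambda>x. c * f x)"
  using polyfun_mult[OF polyfun_const[of c \<Gamma> 0]] by simp

lemma polyfun_sign: "polyfun \<Gamma> d f \<Longrightarrow> polyfun \<Gamma> d (\<lambda>x. (-1) ^ m * f x)"
  by (induction m) (auto dest: polyfun_uminus)

lemma polyfun_sum: "finite I \<Longrightarrow> (\<And>i. i \<in> I \<Longrightarrow> polyfun \<Gamma> d (f i)) \<Longrightarrow> polyfun \<Gamma> d (\<lambda>x. \<Sum>i\<in>I. f i x)"
  by (induction I rule: finite_induct) (auto intro: polyfun_const polyfun_add zero_mem)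

lemma polyfun_comp:
  assumes "polyfun \<Delta> d f" and "\<And>g. g \<in> \<Delta> \<Longrightarrow> polyfun \<Gamma> m (\<lambda>x. g (h x))"
  shows "polyfun \<Gamma> (d * m) (\<lambda>x. f (h x))"
  using assms
proof (induction rule: polyfun.induct)
  case (polyfun_gen g d)
  then show ?case using polyfun_mono[of \<Gamma> m "\<lambda>x. g (h x)" "d * m"] by simp
next
  case (polyfun_mult d f d' g d'')
  have "d * m + d' * m \<le> d'' * m" using polyfun_mult.hyps(3) by (metis add_mult_distrib mult_le_mono1)
  then show ?case using polyfun_mult by (auto intro: polyfun.polyfun_mult)
qed (auto intro: polyfun.intros)

lemma polyfun_change_generators:
  assumes "polyfun \<Gamma> d f" and "\<And>g. g \<in> \<Gamma> \<Longrightarrow> \<exists>g'. polyfun \<Delta> 1 g' \<and> (\<forall>x\<in>A. g x = g' x)"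
  shows "\<exists>f'. polyfun \<Delta> d f' \<and> (\<forall>x\<in>A. f x = f' x)"
  using assms(1)
proof (induction rule: polyfun.induct)
  case (polyfun_const c d)
  then show ?case by (intro exI[of _ "\<lambda>_. c"]) (auto intro: polyfun.polyfun_const)
next
  case (polyfun_gen g d)
  then show ?case using assms(2) polyfun_mono by blast
next
  case (polyfun_add d f g)
  then obtain f' g' where "polyfun \<Delta> d f'" "\<forall>x\<in>A. f x = f' x" "polyfun \<Delta> d g'" "\<forall>x\<in>A. g x = g' x"
    by blast
  then show ?case by (intro exI[of _ "\<lambda>x. f' x + g' x"]) (auto intro: polyfun.polyfun_add)
next
  case (polyfun_uminus d f)
  then obtain f' where "polyfun \<Delta> d f'" "\<forall>x\<in>A. f x = f' x" by blast
  then show ?case by (intro exI[of _ "\<lambda>x. - f' x"]) (auto intro: polyfun.polyfun_uminus)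
next
  case (polyfun_mult d f d' g d'')
  then obtain f' g' where "polyfun \<Delta> d f'" "\<forall>x\<in>A. f x = f' x" "polyfun \<Delta> d' g'" "\<forall>x\<in>A. g x = g' x"
    by blast
  then show ?case
    using polyfun_mult.hyps(3)
    by (intro exI[of _ "\<lambda>x. f' x * g' x"]) (auto intro: polyfun.polyfun_mult)
qed

definition exponents :: "('x \<Rightarrow> 'a) set \<Rightarrow> nat \<Rightarrow> (('x \<Rightarrow> 'a) \<Rightarrow> nat) set" where
  "exponents \<Delta> d = \<Delta> \<rightarrow>\<^sub>E {..d}"

definition monomial :: "('x \<Rightarrow> 'a) set \<Rightarrow> (('x \<Rightarrow> 'a) \<Rightarrow> nat) \<Rightarrow> 'x \<Rightarrow> 'a" where
  "monomial \<Delta> m x = (\<Prod>h\<in>\<Delta>. h x ^ m h)"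

definition monomial_sum_on :: "'x set \<Rightarrow> ('x \<Rightarrow> 'a) set \<Rightarrow> nat \<Rightarrow> ('x \<Rightarrow> 'a) \<Rightarrow> bool" where
  "monomial_sum_on A \<Delta> d f \<longleftrightarrow>
    (\<exists>c\<in>exponents \<Delta> d \<rightarrow> K. \<forall>x\<in>A. f x = (\<Sum>m\<in>exponents \<Delta> d. c m * monomial \<Delta> m x))"

lemma finite_exponents: "finite \<Delta> \<Longrightarrow> finite (exponents \<Delta> d)"
  by (simp add: exponents_def finite_PiE)

lemma card_exponents: "finite \<Delta> \<Longrightarrow> card (exponents \<Delta> d) = (d + 1) ^ card \<Delta>"
  by (simp add: exponents_def card_PiE)

lemma monomial_zero: "monomial \<Delta> (restrict (\<lambda>_. 0) \<Delta>) x = 1"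
  by (simp add: monomial_def)

lemma monomial_single:
  assumes "finite \<Delta>" "h \<in> \<Delta>"
  shows "monomial \<Delta> (restrict (\<lambda>h'. if h' = h then 1 else 0) \<Delta>) x = h x"
proof -
  have "monomial \<Delta> (restrict (\<lambda>h'. if h' = h then 1 else 0) \<Delta>) x = (\<Prod>h'\<in>\<Delta>. if h' = h then h x else 1)"
    unfolding monomial_def by (intro prod.cong) auto
  then show ?thesis using assms by simp
qed

lemma monomial_add: "monomial \<Delta> (restrict (\<lambda>h. m h + m' h) \<Delta>) x = monomial \<Delta> m x * monomial \<Delta> m' x"
  unfolding monomial_def prod.distrib[symmetric] by (intro prod.cong) (auto simp: power_add)

lemma monomial_sum_on_term:
  assumes "finite \<Delta>" "m \<in> exponents \<Delta> d" "c \<in> K" "\<And>x. x \<in> A \<Longrightarrow> f x = c * monomial \<Delta> m x"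
  shows "monomial_sum_on A \<Delta> d f"
  unfolding monomial_sum_on_def
proof (intro bexI ballI)
  fix x assume "x \<in> A"
  have "(\<Sum>m'\<in>exponents \<Delta> d. (if m' = m then c else 0) * monomial \<Delta> m' x)
      = (\<Sum>m'\<in>exponents \<Delta> d. if m' = m then c * monomial \<Delta> m x else 0)"
    by (intro sum.cong) auto
  also have "\<dots> = f x" using assms \<open>x \<in> A\<close> finite_exponents[OF assms(1)] by simp
  finally show "f x = (\<Sum>m'\<in>exponents \<Delta> d. (if m' = m then c else 0) * monomial \<Delta> m' x)" ..
qed (use assms(3) zero_mem in auto)

lemma monomial_sum_on_const: "finite \<Delta> \<Longrightarrow> c \<in> K \<Longrightarrow> monomial_sum_on A \<Delta> d (\<lambda>_. c)"
  by (rule monomial_sum_on_term[of _ "restrict (\<lambda>_. 0) \<Delta>"]) (auto simp: exponents_def monomial_zero)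

lemma monomial_sum_on_add:
  assumes "monomial_sum_on A \<Delta> d f" "monomial_sum_on A \<Delta> d g"
  shows "monomial_sum_on A \<Delta> d (\<lambda>x. f x + g x)"
proof -
  from assms obtain c c' where "c \<in> exponents \<Delta> d \<rightarrow> K" "c' \<in> exponents \<Delta> d \<rightarrow> K"
    and "\<forall>x\<in>A. f x = (\<Sum>m\<in>exponents \<Delta> d. c m * monomial \<Delta> m x)"
    and "\<forall>x\<in>A. g x = (\<Sum>m\<in>exponents \<Delta> d. c' m * monomial \<Delta> m x)"
    unfolding monomial_sum_on_def by blast
  then show ?thesis unfolding monomial_sum_on_def
    by (intro bexI[of _ "\<lambda>m. c m + c' m"]) (auto simp: sum.distrib distrib_right Pi_iff intro!: add_mem)
qed

lemma monomial_sum_on_uminus: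
  assumes "monomial_sum_on A \<Delta> d f"
  shows "monomial_sum_on A \<Delta> d (\<lambda>x. - f x)"
proof -
  from assms obtain c where "c \<in> exponents \<Delta> d \<rightarrow> K" "\<forall>x\<in>A. f x = (\<Sum>m\<in>exponents \<Delta> d. c m * monomial \<Delta> m x)"
    unfolding monomial_sum_on_def by blast
  then show ?thesis unfolding monomial_sum_on_def
    by (intro bexI[of _ "\<lambda>m. - c m"]) (auto simp: sum_negf Pi_iff intro!: uminus_mem)
qed

lemma monomial_sum_on_sum:
  assumes "finite \<Delta>" "finite I" "\<And>i. i \<in> I \<Longrightarrow> monomial_sum_on A \<Delta> d (f i)"
  shows "monomial_sum_on A \<Delta> d (\<lambda>x. \<Sum>i\<in>I. f i x)"
  using assms(2,3)
  by (induction I rule: finite_induct)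
    (auto intro: monomial_sum_on_add monomial_sum_on_const[OF assms(1) zero_mem])

lemma monomial_sum_on_mult:
  assumes "finite \<Delta>" "monomial_sum_on A \<Delta> d f" "monomial_sum_on A \<Delta> d' g" "d + d' \<le> d''"
  shows "monomial_sum_on A \<Delta> d'' (\<lambda>x. f x * g x)"
proof -
  from assms(2,3) obtain c c' where c: "c \<in> exponents \<Delta> d \<rightarrow> K" "c' \<in> exponents \<Delta> d' \<rightarrow> K"
    and f: "\<forall>x\<in>A. f x = (\<Sum>m\<in>exponents \<Delta> d. c m * monomial \<Delta> m x)"
    and g: "\<forall>x\<in>A. g x = (\<Sum>m\<in>exponents \<Delta> d'. c' m * monomial \<Delta> m x)"
    unfolding monomial_sum_on_def by blast
  let ?product = "\<lambda>x. \<Sum>m\<in>exponents \<Delta> d. \<Sum>m'\<in>exponents \<Delta> d'.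
    (c m * c' m') * monomial \<Delta> (restrict (\<lambda>h. m h + m' h) \<Delta>) x"
  have "monomial_sum_on A \<Delta> d'' ?product"
  proof (intro monomial_sum_on_sum finite_exponents assms(1))
    fix m m' assume m: "m \<in> exponents \<Delta> d" "m' \<in> exponents \<Delta> d'"
    have "m h + m' h \<le> d''" if "h \<in> \<Delta>" for h
    proof -
      have "m h \<le> d" "m' h \<le> d'" using m that by (auto simp: exponents_def PiE_iff)
      then show ?thesis using assms(4) by simp
    qed
    then show "monomial_sum_on A \<Delta> d'' (\<lambda>x. (c m * c' m') * monomial \<Delta> (restrict (\<lambda>h. m h + m' h) \<Delta>) x)"
      using m c
      by (intro monomial_sum_on_term[OF assms(1) _ _ refl]) (auto simp: exponents_def intro!: mult_mem)
  qed
  moreover have "?product x = f x * g x" if "x \<in> A" for x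
    using f g that by (simp add: sum_product monomial_add) (intro sum.cong refl, simp add: mult_ac)
  ultimately show ?thesis unfolding monomial_sum_on_def by auto
qed

lemma polyfun_monomial_sum_on:
  assumes "polyfun \<Delta> d f" "finite \<Delta>" and mem: "\<And>h x. h \<in> \<Delta> \<Longrightarrow> x \<in> A \<Longrightarrow> h x \<in> K"
  shows "monomial_sum_on A \<Delta> d f"
  using assms(1)
proof (induction rule: polyfun.induct)
  case (polyfun_gen h d)
  let ?m = "restrict (\<lambda>h'. if h' = h then 1 else 0) \<Delta>"
  have "?m \<in> exponents \<Delta> d" using polyfun_gen by (auto simp: exponents_def)
  moreover have "h x = e * monomial \<Delta> ?m x" if "x \<in> A" for x
    using monomial_single[OF assms(2) polyfun_gen(1)] unit_mult mem[OF polyfun_gen(1) that] by simp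
  ultimately show ?case by (rule monomial_sum_on_term[OF assms(2) _ unit_mem])
qed (auto intro: monomial_sum_on_const monomial_sum_on_add monomial_sum_on_uminus
      monomial_sum_on_mult assms(2))

end

section \<open>Hilbert functions of finite point sets\<close>

lemma card_image_mult_le:
  assumes "finite A" "\<And>y. y \<in> f ` A \<Longrightarrow> m \<le> card {x \<in> A. f x = y}"
  shows "card (f ` A) * m \<le> card A"
proof -
  have "card (f ` A) * m = (\<Sum>y\<in>f ` A. m)" by simp
  also have "\<dots> \<le> (\<Sum>y\<in>f ` A. card {x \<in> A. f x = y})" using assms(2) by (rule sum_mono)
  also have "\<dots> = card A" using sum.image_gen[OF assms(1), of "\<lambda>_. 1::nat" f] by simp
  finally show ?thesis .
qed

text \<open>Points of the affine space \<open>K\<^sup>\<Gamma>\<close>, given by their coordinate functions.\<close>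

locale coordinate_space = finite_subfield K e for K :: "'a::comm_ring_1 set" and e +
  fixes \<Omega> :: "'x set" and \<Gamma> :: "('x \<Rightarrow> 'a) set"
  assumes finite_coords: "finite \<Gamma>"
    and coord_mem: "g \<in> \<Gamma> \<Longrightarrow> x \<in> \<Omega> \<Longrightarrow> g x \<in> K"
    and coords_separate: "x \<in> \<Omega> \<Longrightarrow> y \<in> \<Omega> \<Longrightarrow> x \<noteq> y \<Longrightarrow> \<exists>g\<in>\<Gamma>. g x \<noteq> g y"
begin

lemma finite_space: "finite \<Omega>" and card_space_le: "card \<Omega> \<le> q ^ card \<Gamma>"
proof -
  let ?coords = "\<lambda>x. restrict (\<lambda>g. g x) \<Gamma>"
  have inj: "inj_on ?coords \<Omega>"
  proof (rule inj_onI, rule ccontr)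
    fix x y assume xy: "x \<in> \<Omega>" "y \<in> \<Omega>" "?coords x = ?coords y" "x \<noteq> y"
    obtain g where "g \<in> \<Gamma>" "g x \<noteq> g y" using coords_separate[OF xy(1,2,4)] by blast
    then show False using fun_cong[OF xy(3), of g] by simp
  qed
  have coords_sub: "?coords ` \<Omega> \<subseteq> \<Gamma> \<rightarrow>\<^sub>E K" using coord_mem by auto
  have finite_coord_space: "finite (\<Gamma> \<rightarrow>\<^sub>E K)" using finite_coords finite_K by (simp add: finite_PiE)
  show "finite \<Omega>" using inj finite_subset[OF coords_sub finite_coord_space] by (rule finite_imageD[rotated])
  show "card \<Omega> \<le> q ^ card \<Gamma>"
    using card_inj_on_le[OF inj coords_sub finite_coord_space] finite_coords by (simp add: card_PiE)
qed

lemma finite_subset_space: "A \<subseteq> \<Omega> \<Longrightarrow> finite A"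
  using finite_space finite_subset by blast

lemma polyfun_mem: "polyfun \<Gamma> d f \<Longrightarrow> x \<in> \<Omega> \<Longrightarrow> f x \<in> K"
  by (induction rule: polyfun.induct) (auto intro: add_mem mult_mem uminus_mem coord_mem)

definition polys_on :: "'x set \<Rightarrow> nat \<Rightarrow> ('x \<Rightarrow> 'a) set" where
  "polys_on A d = (\<lambda>f. restrict f A) ` {f. polyfun \<Gamma> d f}"

text \<open>\<open>polys_on A d\<close> is a vector space over \<open>K\<close>, so \<open>hilb A d\<close> is \<open>q\<close> to the power of the Hilbert function of \<open>A\<close>.\<close>

abbreviation hilb :: "'x set \<Rightarrow> nat \<Rightarrow> nat" where
  "hilb A d \<equiv> card (polys_on A d)"

lemma polys_onI: "polyfun \<Gamma> d f \<Longrightarrow> (\<And>x. x \<in> A \<Longrightarrow> \<phi> x = f x) \<Longrightarrow> \<phi> \<in> extensional A \<Longrightarrow> \<phi> \<in> polys_on A d"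
  unfolding polys_on_def by (intro image_eqI[of _ _ f]) (auto simp: fun_eq_iff extensional_def)

lemma polys_onE:
  assumes "\<phi> \<in> polys_on A d"
  obtains f where "polyfun \<Gamma> d f" "\<phi> = restrict f A"
  using assms by (auto simp: polys_on_def)

lemma polys_on_subset_PiE: "A \<subseteq> \<Omega> \<Longrightarrow> polys_on A d \<subseteq> A \<rightarrow>\<^sub>E K"
  by (auto simp: polys_on_def polyfun_mem subset_iff)

lemma finite_polys_on: "A \<subseteq> \<Omega> \<Longrightarrow> finite (polys_on A d)"
  using polys_on_subset_PiE[of A d] finite_subset_space[of A]
  by (meson finite_K finite_PiE finite_subset)

lemma polys_on_add:
  assumes "\<phi> \<in> polys_on A d" "\<psi> \<in> polys_on A d"
  shows "restrict (\<lambda>x. \<phi> x + \<psi> x) A \<in> polys_on A d"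
proof -
  obtain f g where "polyfun \<Gamma> d f" "\<phi> = restrict f A" "polyfun \<Gamma> d g" "\<psi> = restrict g A"
    using assms by (auto elim!: polys_onE)
  then show ?thesis by (intro polys_onI[of d "\<lambda>x. f x + g x"]) (auto intro: polyfun_add)
qed

lemma polys_on_scale:
  assumes "c \<in> K" "\<phi> \<in> polys_on A d"
  shows "restrict (\<lambda>x. c * \<phi> x) A \<in> polys_on A d"
proof -
  obtain f where "polyfun \<Gamma> d f" "\<phi> = restrict f A" using assms(2) by (auto elim!: polys_onE)
  then show ?thesis
    using assms(1) by (intro polys_onI[of d "\<lambda>x. c * f x"]) (auto intro: polyfun_scale)
qed

lemma hilb_mono_degree: "A \<subseteq> \<Omega> \<Longrightarrow> d \<le> d' \<Longrightarrow> hilb A d \<le> hilb A d'"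
  by (rule card_mono[OF finite_polys_on]) (auto simp: polys_on_def intro: polyfun_mono)

lemma polys_on_restrict: "A \<subseteq> B \<Longrightarrow> polys_on A d = (\<lambda>\<phi>. restrict \<phi> A) ` polys_on B d"
  by (simp add: polys_on_def image_image restrict_restrict inf.absorb2)

lemma hilb_mono: "A \<subseteq> B \<Longrightarrow> B \<subseteq> \<Omega> \<Longrightarrow> hilb A d \<le> hilb B d"
  using polys_on_restrict[of A B d] finite_polys_on[of B d] by (simp add: card_image_le)

lemma hilb_pos: "A \<subseteq> \<Omega> \<Longrightarrow> 0 < hilb A d"
  using finite_polys_on[of A d] polyfun_const[OF unit_mem, of \<Gamma> d]
  by (auto simp: card_gt_0_iff polys_on_def)

text \<open>Every fibre of the restriction map from \<open>A\<close> to \<open>B\<close> contains a translate of \<open>T\<close>.\<close>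

lemma hilb_mult_card_le:
  assumes "B \<subseteq> A" "A \<subseteq> \<Omega>" "T \<subseteq> polys_on A d" and vanish: "\<And>\<tau> x. \<tau> \<in> T \<Longrightarrow> x \<in> B \<Longrightarrow> \<tau> x = 0"
  shows "hilb B d * card T \<le> hilb A d"
  unfolding polys_on_restrict[OF assms(1)]
proof (rule card_image_mult_le[OF finite_polys_on[OF assms(2)]])
  fix \<psi> assume "\<psi> \<in> (\<lambda>\<phi>. restrict \<phi> B) ` polys_on A d"
  then obtain \<phi> where \<phi>: "\<phi> \<in> polys_on A d" "\<psi> = restrict \<phi> B" by blast
  let ?shift = "\<lambda>\<tau>. restrict (\<lambda>x. \<phi> x + \<tau> x) A"
  have "inj_on ?shift T"
  proof (rule inj_onI)
    fix \<tau> \<tau>' assume \<tau>: "\<tau> \<in> T" "\<tau>' \<in> T" "?shift \<tau> = ?shift \<tau>'"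
    have "\<tau> \<in> A \<rightarrow>\<^sub>E K" "\<tau>' \<in> A \<rightarrow>\<^sub>E K" using \<tau>(1,2) assms(3) polys_on_subset_PiE[OF assms(2)] by blast+
    then show "\<tau> = \<tau>'"
    proof (rule PiE_ext)
      fix x assume "x \<in> A"
      then show "\<tau> x = \<tau>' x" using fun_cong[OF \<tau>(3), of x] by simp
    qed
  qed
  moreover have "?shift ` T \<subseteq> {\<phi>' \<in> polys_on A d. restrict \<phi>' B = \<psi>}"
  proof clarify
    fix \<tau> assume "\<tau> \<in> T"
    then show "?shift \<tau> \<in> polys_on A d \<and> restrict (?shift \<tau>) B = \<psi>"
      using polys_on_add[OF \<phi>(1)] assms(1,3) vanish by (auto simp: \<phi>(2) fun_eq_iff restrict_def)
  qed
  ultimately show "card T \<le> card {\<phi>' \<in> polys_on A d. restrict \<phi>' B = \<psi>}"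
    using finite_polys_on[OF assms(2)] by (intro card_inj_on_le) auto
qed

lemma hilb_zero_set:
  assumes "A \<subseteq> \<Omega>" "polyfun \<Gamma> d g" "x \<in> A" "g x \<noteq> 0"
  shows "hilb {y \<in> A. g y = 0} d * q \<le> hilb A d"
proof -
  let ?multiple = "\<lambda>c. restrict (\<lambda>y. c * g y) A"
  have "inj_on ?multiple K"
  proof (rule inj_onI)
    fix c c' assume c: "c \<in> K" "c' \<in> K" "?multiple c = ?multiple c'"
    have "g x \<in> K" using polyfun_mem[OF assms(2)] assms by blast
    moreover have "c * g x = c' * g x" using fun_cong[OF c(3), of x] assms(3) by simp
    ultimately show "c = c'" using mult_right_cancel_mem[of "g x" c c'] c assms(4) by simp
  qed
  moreover have "hilb {y \<in> A. g y = 0} d * card (?multiple ` K) \<le> hilb A d"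
    using assms(1,2) by (intro hilb_mult_card_le) (auto intro!: polys_onI[OF polyfun_scale])
  ultimately show ?thesis by (simp add: card_image)
qed

lemma exists_interpolant:
  assumes "finite B" "B \<subseteq> \<Omega>" "x \<in> \<Omega>" "x \<notin> B"
  shows "\<exists>f. polyfun \<Gamma> (card B) f \<and> f x = e \<and> (\<forall>y\<in>B. f y = 0)"
  using assms
proof (induction B rule: finite_induct)
  case empty
  then show ?case using polyfun_const[OF unit_mem] by auto
next
  case (insert y B)
  then obtain f where f: "polyfun \<Gamma> (card B) f" "f x = e" "\<forall>y\<in>B. f y = 0" by auto
  obtain g where g: "g \<in> \<Gamma>" "g x \<noteq> g y" using coords_separate[of x y] insert by auto
  have mem: "g x \<in> K" "g y \<in> K" using coord_mem g insert by auto
  obtain c where c: "c \<in> K" "(g x - g y) * c = e"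
    using inverse_ex[of "g x - g y"] g mem diff_mem by auto
  have "polyfun \<Gamma> 1 (\<lambda>z. c * (g z - g y))"
    using g mem c by (intro polyfun_scale polyfun_diff polyfun_gen polyfun_const) auto
  then have "polyfun \<Gamma> (card (insert y B)) (\<lambda>z. f z * (c * (g z - g y)))"
    using insert.hyps by (intro polyfun_mult[OF f(1)]) auto
  then show ?case
    using f c unit_mult[OF unit_mem]
    by (intro exI[of _ "\<lambda>z. f z * (c * (g z - g y))"]) (auto simp: mult.commute)
qed

lemma PiE_subset_polys_on:
  assumes "B \<subseteq> \<Omega>"
  shows "B \<rightarrow>\<^sub>E K \<subseteq> polys_on B (card B)"
proof
  fix \<phi> assume \<phi>: "\<phi> \<in> B \<rightarrow>\<^sub>E K"
  have fin: "finite B" using assms by (rule finite_subset_space)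
  have "\<exists>f. polyfun \<Gamma> (card B) f \<and> f x = e \<and> (\<forall>y\<in>B - {x}. f y = 0)" if "x \<in> B" for x
  proof -
    have "\<exists>f. polyfun \<Gamma> (card (B - {x})) f \<and> f x = e \<and> (\<forall>y\<in>B - {x}. f y = 0)"
      using that assms fin by (intro exists_interpolant) auto
    then show ?thesis using polyfun_mono card_Diff1_le[of B x] by blast
  qed
  then obtain f where f: "\<And>x. x \<in> B \<Longrightarrow> polyfun \<Gamma> (card B) (f x) \<and> f x x = e \<and> (\<forall>y\<in>B - {x}. f x y = 0)"
    by metis
  show "\<phi> \<in> polys_on B (card B)"
  proof (rule polys_onI)
    show "polyfun \<Gamma> (card B) (\<lambda>z. \<Sum>x\<in>B. \<phi> x * f x z)"
      using f \<phi> fin by (intro polyfun_sum polyfun_scale) auto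
    show "\<phi> z = (\<Sum>x\<in>B. \<phi> x * f x z)" if "z \<in> B" for z
    proof -
      have "(\<Sum>x\<in>B. \<phi> x * f x z) = (\<Sum>x\<in>B. if x = z then \<phi> z * e else 0)"
        using f that by (intro sum.cong) auto
      also have "\<dots> = \<phi> z"
        using that fin unit_mult[of "\<phi> z"] PiE_mem[OF \<phi> that] by (simp add: mult.commute)
      finally show ?thesis ..
    qed
    show "\<phi> \<in> extensional B" using \<phi> by (simp add: PiE_def)
  qed
qed

lemma power_le_hilb:
  assumes "A \<subseteq> \<Omega>" "n \<le> card A"
  shows "q ^ n \<le> hilb A n"
proof -
  obtain B where B: "B \<subseteq> A" "card B = n" "finite B"
    using obtain_subset_with_card_n[OF assms(2)] by blast
  have "B \<subseteq> \<Omega>" using B(1) assms(1) by auto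
  then have "card (B \<rightarrow>\<^sub>E K) \<le> hilb B n"
    using PiE_subset_polys_on[of B] B(2) by (intro card_mono finite_polys_on) auto
  also have "\<dots> \<le> hilb A n" using B(1) assms(1) by (rule hilb_mono)
  finally show ?thesis using B by (simp add: card_PiE)
qed

lemma hilb_le:
  assumes "A \<subseteq> \<Omega>" "\<Delta> \<subseteq> \<Gamma>"
    and gens: "\<And>g. g \<in> \<Gamma> \<Longrightarrow> (\<exists>c\<in>K. \<forall>x\<in>A. g x = c) \<or> (\<exists>h\<in>\<Delta>. \<forall>x\<in>A. g x = h x)"
  shows "hilb A d \<le> q ^ ((d + 1) ^ card \<Delta>)"
proof -
  have fin: "finite \<Delta>" using assms(2) finite_coords finite_subset by blast
  let ?sum = "\<lambda>c. restrict (\<lambda>x. \<Sum>m\<in>exponents \<Delta> d. c m * monomial \<Delta> m x) A"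
  have gens': "\<exists>g'. polyfun \<Delta> 1 g' \<and> (\<forall>x\<in>A. g x = g' x)" if "g \<in> \<Gamma>" for g
    using gens[OF that]
  proof (elim disjE bexE)
    fix c assume "c \<in> K" "\<forall>x\<in>A. g x = c"
    then show ?thesis by (intro exI[of _ "\<lambda>_. c"]) (auto intro: polyfun_const)
  next
    fix h assume "h \<in> \<Delta>" "\<forall>x\<in>A. g x = h x"
    then show ?thesis by (intro exI[of _ h] conjI polyfun_gen) auto
  qed
  have "polys_on A d \<subseteq> ?sum ` (exponents \<Delta> d \<rightarrow>\<^sub>E K)"
  proof
    fix \<phi> assume "\<phi> \<in> polys_on A d"
    then obtain f where f: "polyfun \<Gamma> d f" "\<phi> = restrict f A" by (rule polys_onE)
    obtain f' where f': "polyfun \<Delta> d f'" "\<forall>x\<in>A. f x = f' x"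
      using polyfun_change_generators[OF f(1) gens'] by blast
    have "monomial_sum_on A \<Delta> d f'"
      using coord_mem assms by (intro polyfun_monomial_sum_on[OF f'(1) fin]) auto
    then obtain c where c: "c \<in> exponents \<Delta> d \<rightarrow> K" "\<forall>x\<in>A. f' x = (\<Sum>m\<in>exponents \<Delta> d. c m * monomial \<Delta> m x)"
      unfolding monomial_sum_on_def by blast
    then have "\<phi> = ?sum (restrict c (exponents \<Delta> d))" using f(2) f'(2) by (auto simp: fun_eq_iff)
    moreover have "restrict c (exponents \<Delta> d) \<in> exponents \<Delta> d \<rightarrow>\<^sub>E K" using c(1) by auto
    ultimately show "\<phi> \<in> ?sum ` (exponents \<Delta> d \<rightarrow>\<^sub>E K)" by (rule image_eqI)
  qed
  moreover have "finite (exponents \<Delta> d \<rightarrow>\<^sub>E K)"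
    using finite_exponents[OF fin] finite_K by (simp add: finite_PiE)
  ultimately have "hilb A d \<le> card (exponents \<Delta> d \<rightarrow>\<^sub>E K)"
    by (meson card_image_le card_mono finite_imageI le_trans)
  also have "\<dots> = q ^ ((d + 1) ^ card \<Delta>)"
    using fin by (simp add: card_PiE finite_exponents card_exponents)
  finally show ?thesis .
qed

end

section \<open>Irreducible sets and codimension\<close>

context coordinate_space begin

definition irreducible_upto :: "nat \<Rightarrow> 'x set \<Rightarrow> bool" where
  "irreducible_upto D A \<longleftrightarrow> A \<noteq> {} \<and> (\<forall>f g. polyfun \<Gamma> D f \<longrightarrow> polyfun \<Gamma> D g \<longrightarrow>
    (\<forall>x\<in>A. f x * g x = 0) \<longrightarrow> (\<forall>x\<in>A. f x = 0) \<or> (\<forall>x\<in>A. g x = 0))"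

lemma irreducible_uptoD:
  assumes "irreducible_upto D A" "polyfun \<Gamma> D f" "polyfun \<Gamma> D g" "\<And>x. x \<in> A \<Longrightarrow> f x * g x = 0"
    "\<exists>x\<in>A. f x \<noteq> 0"
  shows "x \<in> A \<Longrightarrow> g x = 0"
  using assms unfolding irreducible_upto_def by blast

lemma hilb_eq_1_imp_empty:
  assumes "A \<subseteq> \<Omega>" "hilb A d \<le> 1"
  shows "A = {}"
proof (rule ccontr)
  assume "A \<noteq> {}"
  then obtain x where "x \<in> A" by blast
  then have "hilb {} d * q \<le> hilb A d"
    using hilb_zero_set[OF assms(1) polyfun_const[OF unit_mem, of _ d]] unit_nonzero by simp
  moreover have "1 * 2 \<le> hilb {} d * q"
    using two_le_card hilb_pos[of "{}" d] by (intro mult_le_mono) (auto simp: Suc_le_eq)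
  ultimately show False using assms(2) by simp
qed

lemma reducible_split:
  assumes "A \<subseteq> \<Omega>" "A \<noteq> {}" "\<not> irreducible_upto D A"
  obtains B C where "A = B \<union> C" "hilb B D * q \<le> hilb A D" "hilb C D * q \<le> hilb A D"
proof -
  obtain f g where f: "polyfun \<Gamma> D f" "\<exists>x\<in>A. f x \<noteq> 0" and g: "polyfun \<Gamma> D g" "\<exists>x\<in>A. g x \<noteq> 0"
    and fg: "\<forall>x\<in>A. f x * g x = 0" using assms(2,3) unfolding irreducible_upto_def by blast
  have "f x = 0 \<or> g x = 0" if "x \<in> A" for x
    using mult_eq_zeroD[OF polyfun_mem[OF f(1)] polyfun_mem[OF g(1)], of x x] that fg assms(1)
    by blast
  then have "A = {x \<in> A. f x = 0} \<union> {x \<in> A. g x = 0}" by blast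
  then show thesis
    using that hilb_zero_set[OF assms(1) f(1)] hilb_zero_set[OF assms(1) g(1)] f(2) g(2) by blast
qed

lemma irreducible_cover:
  assumes "A \<subseteq> \<Omega>" "hilb A D \<le> q ^ H"
  shows "\<exists>\<C>. finite \<C> \<and> card \<C> \<le> 2 ^ H \<and> \<Union>\<C> = A \<and> (\<forall>B\<in>\<C>. irreducible_upto D B)"
  using assms
proof (induction H arbitrary: A)
  case 0
  then have "A = {}" using hilb_eq_1_imp_empty by simp
  then show ?case by (intro exI[of _ "{}"]) auto
next
  case (Suc H)
  consider (trivial) "A = {} \<or> irreducible_upto D A" | (reducible) "A \<noteq> {}" "\<not> irreducible_upto D A"
    by blast
  then show ?case
  proof cases
    case reducible
    then obtain B C where A: "A = B \<union> C" and hilb: "hilb B D * q \<le> hilb A D" "hilb C D * q \<le> hilb A D"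
      using reducible_split[OF Suc.prems(1)] by blast
    have "\<exists>\<C>. finite \<C> \<and> card \<C> \<le> 2 ^ H \<and> \<Union>\<C> = Z \<and> (\<forall>B\<in>\<C>. irreducible_upto D B)"
      if "hilb Z D * q \<le> hilb A D" "Z \<subseteq> A" for Z
    proof (rule Suc.IH)
      have "hilb Z D * q \<le> q ^ H * q"
        using le_trans[OF that(1) Suc.prems(2)] by (simp add: mult.commute)
      then show "hilb Z D \<le> q ^ H" using two_le_card by simp
    qed (use that Suc.prems in auto)
    from this[OF hilb(1)] this[OF hilb(2)] obtain \<B> \<C>
      where B: "finite \<B>" "card \<B> \<le> 2 ^ H" "\<Union>\<B> = B" "\<forall>B\<in>\<B>. irreducible_upto D B"
        and C: "finite \<C>" "card \<C> \<le> 2 ^ H" "\<Union>\<C> = C" "\<forall>B\<in>\<C>. irreducible_upto D B"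
      using A by blast
    have "card (\<B> \<union> \<C>) \<le> 2 ^ Suc H" using card_Un_le[of \<B> \<C>] B(2) C(2) by simp
    then show ?thesis using A B C by (intro exI[of _ "\<B> \<union> \<C>"]) auto
  next
    case trivial
    then show ?thesis by (intro exI[of _ "if A = {} then {} else {A}"]) auto
  qed
qed

lemma irreducible_avoids_values:
  assumes "irreducible_upto D A" "polyfun \<Gamma> d g" "\<exists>x\<in>A. \<exists>y\<in>A. g x \<noteq> g y"
    and "finite C" "C \<subseteq> K" "card C * d \<le> D"
  shows "\<exists>x\<in>A. g x \<notin> C"
proof -
  have "\<exists>P. polyfun \<Gamma> (card C * d) P \<and> (\<exists>x\<in>A. P x \<noteq> 0) \<and> (\<forall>x\<in>A. g x \<in> C \<longrightarrow> P x = 0)"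
    using assms(4,5,6)
  proof (induction C rule: finite_induct)
    case empty
    have "\<exists>x\<in>A. e \<noteq> 0" using assms(1) unit_nonzero by (auto simp: irreducible_upto_def)
    then show ?case by (intro exI[of _ "\<lambda>_. e"]) (auto intro: polyfun_const unit_mem)
  next
    case (insert c C)
    then obtain P where P: "polyfun \<Gamma> (card C * d) P" "\<exists>x\<in>A. P x \<noteq> 0" "\<forall>x\<in>A. g x \<in> C \<longrightarrow> P x = 0"
      by auto
    have g: "polyfun \<Gamma> d (\<lambda>x. g x - c)"
      using polyfun_diff[OF assms(2) polyfun_const] insert.prems by simp
    have "\<exists>x\<in>A. g x - c \<noteq> 0" using assms(3) by (metis eq_iff_diff_eq_0)
    moreover have "d \<le> D" "card C * d \<le> D" using insert by auto
    ultimately have "\<exists>x\<in>A. P x * (g x - c) \<noteq> 0"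
      using irreducible_uptoD[OF assms(1) polyfun_mono[OF P(1)] polyfun_mono[OF g] _ P(2)] by blast
    moreover have "polyfun \<Gamma> (card (insert c C) * d) (\<lambda>x. P x * (g x - c))"
      using insert.hyps by (intro polyfun_mult[OF P(1) g]) simp
    ultimately show ?case using P(3) by (intro exI[of _ "\<lambda>x. P x * (g x - c)"]) auto
  qed
  then show ?thesis by blast
qed

text \<open>Multiplication by \<open>g\<close> is injective on functions on \<open>A\<close>, and its image vanishes where \<open>g\<close> does.\<close>

lemma hilb_cut:
  assumes A: "irreducible_upto D A" "A \<subseteq> \<Omega>" and g: "polyfun \<Gamma> \<delta> g" "\<exists>x\<in>A. g x \<noteq> 0" and m: "\<delta> \<le> m" "m \<le> D"
  shows "hilb {x \<in> A. g x = 0} m * hilb A (m - \<delta>) \<le> hilb A m"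
proof -
  let ?multiple = "\<lambda>\<phi>. restrict (\<lambda>x. g x * \<phi> x) A"
  have "inj_on ?multiple (polys_on A (m - \<delta>))"
  proof (rule inj_onI)
    fix \<phi> \<psi> assume \<phi>\<psi>: "\<phi> \<in> polys_on A (m - \<delta>)" "\<psi> \<in> polys_on A (m - \<delta>)" "?multiple \<phi> = ?multiple \<psi>"
    then obtain f h where f: "polyfun \<Gamma> (m - \<delta>) f" "\<phi> = restrict f A"
      and h: "polyfun \<Gamma> (m - \<delta>) h" "\<psi> = restrict h A"
      by (auto elim!: polys_onE)
    have "g x * (f x - h x) = 0" if "x \<in> A" for x
      using fun_cong[OF \<phi>\<psi>(3), of x] that f h by (simp add: right_diff_distrib)
    moreover have "polyfun \<Gamma> D g" "polyfun \<Gamma> D (\<lambda>x. f x - h x)"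
      using m polyfun_mono[OF g(1)] polyfun_mono[OF polyfun_diff[OF f(1) h(1)]] by auto
    ultimately have "\<forall>x\<in>A. f x - h x = 0" using irreducible_uptoD[OF A(1) _ _ _ g(2)] by blast
    then show "\<phi> = \<psi>" using f h by (auto simp: fun_eq_iff)
  qed
  moreover have "hilb {x \<in> A. g x = 0} m * card (?multiple ` polys_on A (m - \<delta>)) \<le> hilb A m"
  proof (rule hilb_mult_card_le)
    show "?multiple ` polys_on A (m - \<delta>) \<subseteq> polys_on A m"
    proof clarify
      fix \<phi> assume "\<phi> \<in> polys_on A (m - \<delta>)"
      then obtain f where "polyfun \<Gamma> (m - \<delta>) f" "\<phi> = restrict f A" by (rule polys_onE)
      then show "?multiple \<phi> \<in> polys_on A m"
        using m by (intro polys_onI[OF polyfun_mult[OF g(1)]]) auto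
    qed
  qed (use A(2) in auto)
  ultimately show ?thesis by (simp add: card_image)
qed

lemma hilb_cut_power:
  assumes A: "irreducible_upto D A" "A \<subseteq> \<Omega>" and g: "polyfun \<Gamma> \<delta> g" "\<exists>x\<in>A. g x \<noteq> 0" and "d \<le> D" "n * \<delta> \<le> d"
  shows "hilb {x \<in> A. g x = 0} (d - n * \<delta>) ^ n * hilb A (d - n * \<delta>) \<le> hilb A d"
  using assms(6)
proof (induction n)
  case (Suc n)
  let ?B = "{x \<in> A. g x = 0}" and ?d = "d - n * \<delta>" and ?d' = "d - Suc n * \<delta>"
  have B: "?B \<subseteq> \<Omega>" using A(2) by blast
  have d': "?d' = ?d - \<delta>" "\<delta> \<le> ?d" "?d \<le> D" using Suc.prems assms(5) by auto
  have "hilb ?B ?d' ^ Suc n * hilb A ?d' = hilb ?B ?d' ^ n * (hilb ?B ?d' * hilb A ?d')" by simp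
  also have "\<dots> \<le> hilb ?B ?d ^ n * (hilb ?B ?d * hilb A (?d - \<delta>))"
    unfolding d'(1) by (intro mult_le_mono power_mono hilb_mono_degree B A(2)) auto
  also have "\<dots> \<le> hilb ?B ?d ^ n * hilb A ?d" using d' by (intro mult_le_mono hilb_cut[OF A g]) auto
  also have "\<dots> \<le> hilb A d" using Suc by simp
  finally show ?case .
qed simp

text \<open>
  If \<open>hilb A d\<close> and \<open>hilb B d\<close> are about \<open>q\<close> to the powers \<open>d\<^sup>a\<close> and \<open>d\<^sup>b\<close>, the inequality with \<open>d\<close>
  of order \<open>n\<close> says that \<open>b + i \<le> a\<close>.
\<close>

definition codim_ge :: "nat \<Rightarrow> nat \<Rightarrow> nat \<Rightarrow> nat \<Rightarrow> 'x set \<Rightarrow> 'x set \<Rightarrow> bool" where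
  "codim_ge D \<delta> n i A B \<longleftrightarrow> (\<forall>d. i * n * \<delta> \<le> d \<longrightarrow> d \<le> D \<longrightarrow> hilb B (d - i * n * \<delta>) ^ (n ^ i) \<le> hilb A d)"

lemma codim_ge_refl: "codim_ge D \<delta> n 0 A A"
  by (simp add: codim_ge_def)

lemma codim_ge_subset:
  assumes "codim_ge D \<delta> n i A B" "B' \<subseteq> B" "B \<subseteq> \<Omega>"
  shows "codim_ge D \<delta> n i A B'"
  using assms unfolding codim_ge_def by (meson hilb_mono le_trans power_mono zero_le)

lemma codim_ge_cut:
  assumes AB: "codim_ge D \<delta> n i A B" and B: "irreducible_upto D B" "B \<subseteq> \<Omega>"
    and g: "polyfun \<Gamma> \<delta> g" "\<exists>x\<in>B. g x \<noteq> 0"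
  shows "codim_ge D \<delta> n (Suc i) A {x \<in> B. g x = 0}"
  unfolding codim_ge_def
proof (intro allI impI)
  fix d assume d: "Suc i * n * \<delta> \<le> d" "d \<le> D"
  let ?C = "{x \<in> B. g x = 0}" and ?d = "d - i * n * \<delta>"
  have d': "d - Suc i * n * \<delta> = ?d - n * \<delta>" "n * \<delta> \<le> ?d" "?d \<le> D" "i * n * \<delta> \<le> d"
    using d by (auto simp: add_mult_distrib)
  have "hilb ?C (?d - n * \<delta>) ^ n * 1 \<le> hilb ?C (?d - n * \<delta>) ^ n * hilb B (?d - n * \<delta>)"
    using hilb_pos[OF B(2)] by (intro mult_le_mono2) (simp add: Suc_le_eq)
  also have "\<dots> \<le> hilb B ?d" using B g d'(3,2) by (rule hilb_cut_power)
  finally have "(hilb ?C (?d - n * \<delta>) ^ n) ^ (n ^ i) \<le> hilb B ?d ^ (n ^ i)" by (intro power_mono) auto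
  also have "\<dots> \<le> hilb A d" using AB d'(4) d(2) by (simp add: codim_ge_def)
  finally show "hilb ?C (d - Suc i * n * \<delta>) ^ (n ^ Suc i) \<le> hilb A d"
    unfolding d'(1) by (simp add: power_mult)
qed

lemma card_less_if_codim_ge_dim:
  assumes "codim_ge D \<delta> n N A B" "B \<subseteq> \<Omega>" "\<And>d. hilb A d \<le> q ^ ((d + 1) ^ N)"
    and n: "(N * \<delta> + 2) ^ N < n" and D: "n * (N * \<delta> + 1) \<le> D"
  shows "card B < n"
proof (rule ccontr)
  let ?d = "n * (N * \<delta> + 1)"
  assume "\<not> card B < n"
  then have "(q ^ n) ^ (n ^ N) \<le> hilb B n ^ (n ^ N)"
    using power_le_hilb[OF assms(2), of n] by (intro power_mono) auto
  also have "\<dots> \<le> hilb A ?d"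
    using assms(1) D unfolding codim_ge_def by (auto simp: algebra_simps dest: spec[of _ ?d])
  also have "\<dots> \<le> q ^ ((?d + 1) ^ N)" by (rule assms(3))
  finally have "q ^ (n * n ^ N) \<le> q ^ ((?d + 1) ^ N)" by (simp add: power_mult)
  then have "n * n ^ N \<le> (?d + 1) ^ N" using two_le_card by (simp add: power_increasing_iff)
  also have "\<dots> \<le> (n * (N * \<delta> + 2)) ^ N" using n by (intro power_mono) (auto simp: algebra_simps)
  also have "\<dots> = (N * \<delta> + 2) ^ N * n ^ N" by (simp only: power_mult_distrib mult.commute)
  finally have "n \<le> (N * \<delta> + 2) ^ N" using n by simp
  then show False using n by simp
qed

end

section \<open>Evaluation functionals on polynomials\<close>

context coordinate_space begin

lemma exists_separating_poly:
  fixes p :: "'i \<Rightarrow> 'y \<Rightarrow> 'x"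
  assumes I: "finite I" "j \<in> I" and s: "\<And>i x. i \<in> I \<Longrightarrow> x \<in> K \<Longrightarrow> s i * x \<in> K"
    and p: "\<And>i z. i \<in> I \<Longrightarrow> z \<in> insert y Y \<Longrightarrow> p i z \<in> \<Omega>"
    and new: "finite Y" "\<And>i z. i \<in> I \<Longrightarrow> z \<in> Y \<Longrightarrow> p j y \<noteq> p i z"
    and d: "card I * (card Y + 1) \<le> d"
  obtains \<phi> where "\<phi> \<in> polys_on \<Omega> d" "(\<Sum>i\<in>I. s i * \<phi> (p i y)) = (\<Sum>i\<in>{i \<in> I. p i y = p j y}. s i * e)"
    "\<And>z. z \<in> Y \<Longrightarrow> (\<Sum>i\<in>I. s i * \<phi> (p i z)) = 0"
proof -
  define F where "F = (\<lambda>(i, z). p i z) ` (I \<times> insert y Y) - {p j y}"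
  have finite_F: "finite F" and F_sub: "F \<subseteq> \<Omega>" using I new(1) p by (auto simp: F_def)
  have "card F \<le> card ((\<lambda>(i, z). p i z) ` (I \<times> insert y Y))"
    unfolding F_def using I(1) new(1) by (intro card_mono) auto
  also have "\<dots> \<le> card (I \<times> insert y Y)" using I(1) new(1) by (intro card_image_le) simp
  also have "\<dots> \<le> card I * (card Y + 1)"
    using new(1) by (simp add: card_cartesian_product card_insert_if del: mult_Suc_right)
  finally have card: "card F \<le> d" using d by (rule le_trans)
  obtain f where f: "polyfun \<Gamma> (card F) f" "f (p j y) = e" "\<forall>z\<in>F. f z = 0"
    using exists_interpolant[OF finite_F F_sub, of "p j y"] p[OF I(2)] by (auto simp: F_def)
  have val: "f (p i z) = (if p i z = p j y then e else 0)" if "i \<in> I" "z \<in> insert y Y" for i z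
    using f(2,3) that by (auto simp: F_def)
  let ?\<phi> = "restrict f \<Omega>"
  show thesis
  proof (rule that)
    show "?\<phi> \<in> polys_on \<Omega> d" using polyfun_mono[OF f(1) card] by (rule polys_onI) auto
    have "(\<Sum>i\<in>I. s i * ?\<phi> (p i y)) = (\<Sum>i\<in>I. if p i y = p j y then s i * e else 0)"
      using p val by (intro sum.cong) auto
    then show "(\<Sum>i\<in>I. s i * ?\<phi> (p i y)) = (\<Sum>i\<in>{i \<in> I. p i y = p j y}. s i * e)"
      using I(1) by (simp add: sum.inter_filter)
    show "(\<Sum>i\<in>I. s i * ?\<phi> (p i z)) = 0" if "z \<in> Y" for z
      using p val new(2) that by (intro sum.neutral) (metis insertCI mult_zero_right restrict_apply')
  qed
qed

lemma card_level_set_insert: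
  fixes p :: "'i \<Rightarrow> 'y \<Rightarrow> 'x" and I :: "'i set" and s :: "'i \<Rightarrow> 'a"
  defines "\<Lambda> \<phi> y \<equiv> \<Sum>i\<in>I. s i * \<phi> (p i y)"
  assumes s: "\<And>i x. i \<in> I \<Longrightarrow> x \<in> K \<Longrightarrow> s i * x \<in> K"
    and p: "\<And>i z. i \<in> I \<Longrightarrow> z \<in> insert y Y \<Longrightarrow> p i z \<in> \<Omega>"
    and \<psi>: "\<psi> \<in> polys_on \<Omega> d" "\<Lambda> \<psi> y \<noteq> 0" "\<And>z. z \<in> Y \<Longrightarrow> \<Lambda> \<psi> z = 0"
  shows "card {\<phi> \<in> polys_on \<Omega> d. \<forall>z\<in>insert y Y. \<Lambda> \<phi> z = w} * q \<le> card {\<phi> \<in> polys_on \<Omega> d. \<forall>z\<in>Y. \<Lambda> \<phi> z = w}"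
    (is "card ?new * q \<le> card ?old")
proof -
  define shift where "shift = (\<lambda>(\<phi>, c). restrict (\<lambda>x. \<phi> x + restrict (\<lambda>x. c * \<psi> x) \<Omega> x) \<Omega>)"
  have mem: "\<phi> x \<in> K" if "\<phi> \<in> polys_on \<Omega> d" "x \<in> \<Omega>" for \<phi> x
    using that polys_on_subset_PiE[OF order.refl] by (auto simp: PiE_iff)
  have \<Lambda>_shift: "\<Lambda> (shift (\<phi>, c)) z = \<Lambda> \<phi> z + c * \<Lambda> \<psi> z" if "z \<in> insert y Y" for \<phi> c z
  proof -
    have "\<Lambda> (shift (\<phi>, c)) z = (\<Sum>i\<in>I. s i * \<phi> (p i z) + c * (s i * \<psi> (p i z)))"
      unfolding \<Lambda>_def shift_def using p[OF _ that] by (intro sum.cong) (auto simp: algebra_simps)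
    then show ?thesis by (simp add: \<Lambda>_def sum.distrib sum_distrib_left)
  qed
  have "inj_on shift (?new \<times> K)"
  proof (rule inj_onI, clarify)
    fix \<phi> c \<phi>' c'
    assume \<phi>: "\<phi> \<in> polys_on \<Omega> d" "\<forall>z\<in>insert y Y. \<Lambda> \<phi> z = w"
      and \<phi>': "\<phi>' \<in> polys_on \<Omega> d" "\<forall>z\<in>insert y Y. \<Lambda> \<phi>' z = w"
      and c: "c \<in> K" "c' \<in> K" and shift_eq: "shift (\<phi>, c) = shift (\<phi>', c')"
    have "\<Lambda> \<psi> y \<in> K" unfolding \<Lambda>_def using p by (intro sum_mem s mem \<psi>(1)) auto
    moreover have "c * \<Lambda> \<psi> y = c' * \<Lambda> \<psi> y"
      using \<Lambda>_shift[of y \<phi> c] \<Lambda>_shift[of y \<phi>' c'] \<phi>(2) \<phi>'(2) shift_eq by simp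
    ultimately have "c = c'" using mult_right_cancel_mem[OF _ c \<psi>(2)] by simp
    moreover have "\<phi> = \<phi>'"
    proof (rule PiE_ext)
      show "\<phi> \<in> \<Omega> \<rightarrow>\<^sub>E K" "\<phi>' \<in> \<Omega> \<rightarrow>\<^sub>E K" using \<phi>(1) \<phi>'(1) polys_on_subset_PiE[OF order.refl] by blast+
      show "\<phi> x = \<phi>' x" if "x \<in> \<Omega>" for x
        using fun_cong[OF shift_eq, of x] that \<open>c = c'\<close> by (simp add: shift_def)
    qed
    ultimately show "\<phi> = \<phi>' \<and> c = c'" by simp
  qed
  moreover have "shift ` (?new \<times> K) \<subseteq> ?old"
  proof clarify
    fix \<phi> c assume \<phi>: "\<phi> \<in> polys_on \<Omega> d" "\<forall>z\<in>insert y Y. \<Lambda> \<phi> z = w" and c: "c \<in> K"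
    have "shift (\<phi>, c) \<in> polys_on \<Omega> d" unfolding shift_def
      using polys_on_add[OF \<phi>(1) polys_on_scale[OF c \<psi>(1)]] by simp
    then show "shift (\<phi>, c) \<in> polys_on \<Omega> d \<and> (\<forall>z\<in>Y. \<Lambda> (shift (\<phi>, c)) z = w)"
      using \<phi>(2) \<psi>(3) \<Lambda>_shift by simp
  qed
  moreover have "finite ?old" using finite_polys_on[OF order.refl] by simp
  ultimately have "card (?new \<times> K) \<le> card ?old" by (rule card_inj_on_le)
  then show ?thesis by (simp add: card_cartesian_product)
qed

lemma exists_cutting_point:
  fixes p :: "'i \<Rightarrow> 'y \<Rightarrow> 'x"
  assumes I: "finite I" "j \<in> I" and s: "\<And>i x. i \<in> I \<Longrightarrow> x \<in> K \<Longrightarrow> s i * x \<in> K"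
    and p: "\<And>i y. i \<in> I \<Longrightarrow> y \<in> A \<Longrightarrow> p i y \<in> \<Omega>"
    and coeff: "\<And>y. y \<in> A \<Longrightarrow> (\<Sum>i\<in>{i \<in> I. p i y = p j y}. s i * e) \<noteq> 0"
    and avoid: "\<And>F. F \<subseteq> \<Omega> \<Longrightarrow> card F \<le> card I * card Y \<Longrightarrow> \<exists>y\<in>A. p j y \<notin> F"
    and Y: "Y \<subseteq> A" "finite Y" and d: "card I * (card Y + 1) \<le> d"
  shows "\<exists>y\<in>A. card {\<phi> \<in> polys_on \<Omega> d. \<forall>z\<in>insert y Y. (\<Sum>i\<in>I. s i * \<phi> (p i z)) = w} * q
    \<le> card {\<phi> \<in> polys_on \<Omega> d. \<forall>z\<in>Y. (\<Sum>i\<in>I. s i * \<phi> (p i z)) = w}"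
proof -
  define F where "F = (\<lambda>(i, y). p i y) ` (I \<times> Y)"
  have "card F \<le> card I * card Y"
    unfolding F_def using card_image_le[of "I \<times> Y"] I(1) Y(2) by (simp add: card_cartesian_product)
  moreover have "F \<subseteq> \<Omega>" using p Y(1) by (auto simp: F_def)
  ultimately obtain y where y: "y \<in> A" "p j y \<notin> F" using avoid[of F] by auto
  have mem: "p i z \<in> \<Omega>" if "i \<in> I" "z \<in> insert y Y" for i z using p that y(1) Y(1) by auto
  have new: "p j y \<noteq> p i z" if "i \<in> I" "z \<in> Y" for i z
    using y(2) that unfolding F_def by (metis (no_types, lifting) SigmaI case_prod_conv image_eqI)
  from exists_separating_poly[of I j s y Y p d, OF I s mem Y(2) new d]
  obtain \<psi> where \<psi>: "\<psi> \<in> polys_on \<Omega> d" "\<And>z. z \<in> Y \<Longrightarrow> (\<Sum>i\<in>I. s i * \<psi> (p i z)) = 0"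
    and "(\<Sum>i\<in>I. s i * \<psi> (p i y)) = (\<Sum>i\<in>{i \<in> I. p i y = p j y}. s i * e)" by blast
  then have "(\<Sum>i\<in>I. s i * \<psi> (p i y)) \<noteq> 0" using coeff[OF y(1)] by simp
  from card_level_set_insert[of I s y Y p \<psi> d w, OF s mem \<psi>(1) this \<psi>(2)] y(1) show ?thesis by blast
qed

lemma card_level_set:
  fixes p :: "'i \<Rightarrow> 'y \<Rightarrow> 'x"
  assumes I: "finite I" "j \<in> I" and s: "\<And>i x. i \<in> I \<Longrightarrow> x \<in> K \<Longrightarrow> s i * x \<in> K"
    and p: "\<And>i y. i \<in> I \<Longrightarrow> y \<in> A \<Longrightarrow> p i y \<in> \<Omega>"
    and coeff: "\<And>y. y \<in> A \<Longrightarrow> (\<Sum>i\<in>{i \<in> I. p i y = p j y}. s i * e) \<noteq> 0"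
    and avoid: "\<And>F. F \<subseteq> \<Omega> \<Longrightarrow> card F \<le> card I * n \<Longrightarrow> \<exists>y\<in>A. p j y \<notin> F"
    and d: "card I * n \<le> d"
  shows "card {\<phi> \<in> polys_on \<Omega> d. \<forall>y\<in>A. (\<Sum>i\<in>I. s i * \<phi> (p i y)) = w} * q ^ n \<le> hilb \<Omega> d"
proof -
  define level where "level Y = {\<phi> \<in> polys_on \<Omega> d. \<forall>y\<in>Y. (\<Sum>i\<in>I. s i * \<phi> (p i y)) = w}" for Y
  have "\<exists>Y\<subseteq>A. finite Y \<and> card Y \<le> m \<and> card (level Y) * q ^ m \<le> hilb \<Omega> d" if "m \<le> n" for m
    using that
  proof (induction m)
    case 0
    show ?case by (intro exI[of _ "{}"]) (auto simp: level_def)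
  next
    case (Suc m)
    then obtain Y where Y: "Y \<subseteq> A" "finite Y" "card Y \<le> m" "card (level Y) * q ^ m \<le> hilb \<Omega> d" by auto
    have card_bounds: "card I * card Y \<le> card I * n" "card I * (card Y + 1) \<le> card I * n"
      using Y(3) Suc.prems by (intro mult_le_mono2; simp)+
    obtain y where y: "y \<in> A" "card (level (insert y Y)) * q \<le> card (level Y)"
      using exists_cutting_point[of I j s A p Y d w, OF I s p coeff avoid[OF _ le_trans[OF _ card_bounds(1)]]
        Y(1,2) le_trans[OF card_bounds(2) d]]
      unfolding level_def by blast
    have "card (level (insert y Y)) * q * q ^ m \<le> hilb \<Omega> d"
      using Y(4) y(2) mult_le_mono1 le_trans by blast
    moreover have "card (insert y Y) \<le> Suc m" using Y(2,3) by (simp add: card_insert_if)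
    ultimately show ?case using Y(1,2) y(1) by (intro exI[of _ "insert y Y"]) (auto simp: mult.assoc)
  qed
  then obtain Y where Y: "Y \<subseteq> A" "card (level Y) * q ^ n \<le> hilb \<Omega> d" by blast
  have "finite (level Y)" using finite_polys_on[OF order.refl] by (simp add: level_def)
  moreover have "level A \<subseteq> level Y" using Y(1) by (auto simp: level_def)
  ultimately have "card (level A) * q ^ n \<le> card (level Y) * q ^ n" by (intro mult_le_mono1 card_mono)
  then have "card (level A) * q ^ n \<le> hilb \<Omega> d" using Y(2) by (rule le_trans)
  then show ?thesis by (simp add: level_def)
qed

end

section \<open>A tower of abelian covers\<close>

type_synonym 'a coords = "nat \<Rightarrow> 'a"
type_synonym 'a edge = "'a coords \<times> 'a coords \<times> 'a coords \<times> 'a coords"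
type_synonym 'a walk = "(nat \<Rightarrow> 'a coords) \<times> 'a coords"

text \<open>
  A walk is given by the labels of all its vertices and the further coordinates of its first vertex.
  Vertices with even index lie in \<open>M\<close>, and the \<open>M\<close>-end of an edge is listed first. At level \<open>j\<close>,
  \<open>lift_coords f x j i\<close> holds the first \<open>j\<close> coordinates of the \<open>i\<close>-th vertex, padded by zeros.
\<close>

definition even_end :: "nat \<Rightarrow> nat" where
  "even_end m = (if even m then m else Suc m)"

definition odd_end :: "nat \<Rightarrow> nat" where
  "odd_end m = (if even m then Suc m else m)"

definition edge_of :: "(nat \<Rightarrow> 'a coords) \<Rightarrow> (nat \<Rightarrow> 'a coords) \<Rightarrow> nat \<Rightarrow> 'a edge" where
  "edge_of P W m = (P (even_end m), P (odd_end m), W (even_end m), W (odd_end m))"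

primrec coord_along :: "('e \<Rightarrow> 'a::ring_1) \<Rightarrow> (nat \<Rightarrow> 'e) \<Rightarrow> 'a \<Rightarrow> nat \<Rightarrow> 'a" where
  "coord_along g p c 0 = c"
| "coord_along g p c (Suc m) = g (p m) - coord_along g p c m"

primrec lift_coords :: "(nat \<Rightarrow> 'a::ring_1 edge \<Rightarrow> 'a) \<Rightarrow> 'a walk \<Rightarrow> nat \<Rightarrow> nat \<Rightarrow> 'a coords" where
  "lift_coords f x 0 = (\<lambda>i c. 0)"
| "lift_coords f x (Suc j) =
    (\<lambda>i. (lift_coords f x j i)(j := coord_along (f j) (edge_of (fst x) (lift_coords f x j)) (snd x j) i))"

definition vertex_at :: "(nat \<Rightarrow> 'a::ring_1 edge \<Rightarrow> 'a) \<Rightarrow> nat \<Rightarrow> nat \<Rightarrow> 'a walk \<Rightarrow> 'a coords \<times> 'a coords" where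
  "vertex_at f j i x = (fst x i, lift_coords f x j i)"

definition edge_at :: "(nat \<Rightarrow> 'a::ring_1 edge \<Rightarrow> 'a) \<Rightarrow> nat \<Rightarrow> 'a walk \<Rightarrow> nat \<Rightarrow> 'a edge" where
  "edge_at f j x m = edge_of (fst x) (lift_coords f x j) m"

definition segment_sum :: "(nat \<Rightarrow> 'a::ring_1 edge \<Rightarrow> 'a) \<Rightarrow> nat \<Rightarrow> nat \<Rightarrow> nat \<Rightarrow> 'a walk \<Rightarrow> 'a" where
  "segment_sum f j a b x = (\<Sum>m\<in>{a..<b}. (-1) ^ m * f j (edge_at f j x m))"

lemma coord_along_sum:
  assumes "a \<le> b"
  shows "(\<Sum>m\<in>{a..<b}. (-1) ^ m * g (p m))
    = (-1) ^ a * coord_along g p c a - (-1) ^ b * coord_along g p c b"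
  using assms by (induction b rule: dec_induct) (auto simp: algebra_simps)

lemma segment_sum_eq_ends:
  assumes "a \<le> b"
  shows "segment_sum f j a b x
    = (-1) ^ a * lift_coords f x (Suc j) a j - (-1) ^ b * lift_coords f x (Suc j) b j"
  unfolding segment_sum_def edge_at_def using coord_along_sum[OF assms] by simp

lemma lift_coords_eq_0: "j \<le> c \<Longrightarrow> lift_coords f x j i c = 0"
  by (induction j) auto

lemma lift_coords_truncate:
  "j \<le> j' \<Longrightarrow> lift_coords f x j i = (\<lambda>c. if c < j then lift_coords f x j' i c else 0)"
proof (induction j' rule: dec_induct)
  case base
  show ?case by (auto simp: lift_coords_eq_0 fun_eq_iff)
next
  case (step n)
  then show ?case by (auto simp: fun_eq_iff)
qed

lemma vertex_at_truncate:
  "j \<le> j' \<Longrightarrow> vertex_at f j i x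
    = (fst (vertex_at f j' i x), \<lambda>c. if c < j then snd (vertex_at f j' i x) c else 0)"
  using lift_coords_truncate[of j j' f x i] by (simp add: vertex_at_def cong: if_cong)

lemma vertex_at_eq_antimono:
  "vertex_at f j' i x = vertex_at f j' i' y \<Longrightarrow> j \<le> j' \<Longrightarrow> vertex_at f j i x = vertex_at f j i' y"
  by (simp add: vertex_at_truncate[of j j'] cong: if_cong)

lemma lift_coords_start: "lift_coords f x j 0 = (\<lambda>c. if c < j then snd x c else 0)"
  by (induction j) (auto simp: fun_eq_iff less_Suc_eq)

lemma edge_at_eq_iff:
  "edge_at f j x m = edge_at f j y m' \<longleftrightarrow>
    vertex_at f j (even_end m) x = vertex_at f j (even_end m') y \<and>
    vertex_at f j (odd_end m) x = vertex_at f j (odd_end m') y"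
  by (auto simp: edge_at_def edge_of_def vertex_at_def)

lemma lift_coords_cong: "(\<And>i. i < j \<Longrightarrow> f i = f' i) \<Longrightarrow> lift_coords f x j = lift_coords f' x j"
  by (induction j) auto

lemma edge_at_cong: "(\<And>i. i < j \<Longrightarrow> f i = f' i) \<Longrightarrow> edge_at f j = edge_at f' j"
  by (intro ext) (simp add: edge_at_def lift_coords_cong[of j f f'])

lemma segment_sum_cong: "(\<And>i. i \<le> j \<Longrightarrow> f i = f' i) \<Longrightarrow> segment_sum f j = segment_sum f' j"
  using edge_at_cong[of j f f'] by (intro ext) (simp add: segment_sum_def)

context finite_subfield begin

definition vecs :: "nat \<Rightarrow> 'a coords set" where
  "vecs n = {u. (\<forall>i<n. u i \<in> K) \<and> (\<forall>i\<ge>n. u i = 0)}"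

lemma bij_betw_vecs_PiE: "bij_betw (\<lambda>u. restrict u {..<n}) (vecs n) ({..<n} \<rightarrow>\<^sub>E K)"
proof (rule bij_betw_byWitness[where f' = "\<lambda>u i. if i < n then u i else 0"])
  show "\<forall>u\<in>vecs n. (\<lambda>i. if i < n then restrict u {..<n} i else 0) = u"
    by (auto simp: vecs_def fun_eq_iff)
  show "\<forall>u\<in>{..<n} \<rightarrow>\<^sub>E K. restrict (\<lambda>i. if i < n then u i else 0) {..<n} = u"
    by (auto simp: PiE_iff extensional_def fun_eq_iff)
  show "(\<lambda>u. restrict u {..<n}) ` vecs n \<subseteq> {..<n} \<rightarrow>\<^sub>E K"
    by (intro image_subsetI) (simp add: vecs_def PiE_iff)
  show "(\<lambda>u i. if i < n then u i else 0) ` ({..<n} \<rightarrow>\<^sub>E K) \<subseteq> vecs n"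
    by (intro image_subsetI) (simp add: vecs_def PiE_iff)
qed

lemma finite_vecs: "finite (vecs n)"
  using bij_betw_finite[OF bij_betw_vecs_PiE[of n]] by (simp add: finite_PiE finite_K)

lemma card_vecs: "card (vecs n) = q ^ n"
  using bij_betw_same_card[OF bij_betw_vecs_PiE[of n]] by (simp add: card_PiE)

definition component_coords :: "(('z \<Rightarrow> 'a coords) \<times> nat) set \<Rightarrow> ('z \<Rightarrow> 'a) set" where
  "component_coords \<P> = (\<Union>p\<in>\<P>. (\<lambda>c z. fst p z c) ` {..<snd p})"

lemma component_coordsI: "(\<pi>, n) \<in> \<P> \<Longrightarrow> c < n \<Longrightarrow> (\<lambda>z. \<pi> z c) \<in> component_coords \<P>"
  by (force simp: component_coords_def)

lemma component_coordsE:
  assumes "g \<in> component_coords \<P>"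
  obtains \<pi> n c where "(\<pi>, n) \<in> \<P>" "c < n" "g = (\<lambda>z. \<pi> z c)"
  using assms by (force simp: component_coords_def)

lemma coordinate_space_component_coords:
  assumes "finite \<P>" and mem: "\<And>\<pi> n z. (\<pi>, n) \<in> \<P> \<Longrightarrow> z \<in> Z \<Longrightarrow> \<pi> z \<in> vecs n"
    and inj: "\<And>z z'. z \<in> Z \<Longrightarrow> z' \<in> Z \<Longrightarrow> (\<And>\<pi> n. (\<pi>, n) \<in> \<P> \<Longrightarrow> \<pi> z = \<pi> z') \<Longrightarrow> z = z'"
  shows "coordinate_space K e Z (component_coords \<P>)"
proof unfold_locales
  show "finite (component_coords \<P>)" using assms(1) by (auto simp: component_coords_def)
  show "g z \<in> K" if "g \<in> component_coords \<P>" "z \<in> Z" for g z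
    using that mem unfolding vecs_def by (auto elim!: component_coordsE)
  fix z z' assume z: "z \<in> Z" "z' \<in> Z" "z \<noteq> z'"
  then obtain \<pi> n where \<pi>: "(\<pi>, n) \<in> \<P>" "\<pi> z \<noteq> \<pi> z'" using inj by blast
  then obtain c where c: "\<pi> z c \<noteq> \<pi> z' c" by blast
  then have "c < n"
    using mem[OF \<pi>(1) z(1)] mem[OF \<pi>(1) z(2)] by (auto simp: vecs_def) (metis linorder_not_le)
  then show "\<exists>g\<in>component_coords \<P>. g z \<noteq> g z'"
    using component_coordsI[OF \<pi>(1)] c by (intro bexI[of _ "\<lambda>z. \<pi> z c"]) auto
qed

lemma card_component_coords_le:
  assumes "finite \<P>"
  shows "card (component_coords \<P>) \<le> (\<Sum>p\<in>\<P>. snd p)"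
proof -
  have "card (component_coords \<P>) \<le> (\<Sum>p\<in>\<P>. card ((\<lambda>c z. fst p z c) ` {..<snd p}))"
    unfolding component_coords_def using assms by (rule card_UN_le)
  also have "\<dots> \<le> (\<Sum>p\<in>\<P>. snd p)"
    by (rule sum_mono) (metis card_image_le card_lessThan finite_lessThan)
  finally show ?thesis .
qed

end

locale tower = finite_subfield K e for K :: "'a::comm_ring_1 set" and e +
  fixes k r r' :: nat
  assumes two_le_k: "2 \<le> k"
begin

definition L :: nat where "L = 2 * k - 1"

definition t :: nat where "t = (k - 1) * (r + r')"

definition label_dim :: "nat \<Rightarrow> nat" where "label_dim i = (if even i then r else r')"

definition walk_space :: "'a walk set" where
  "walk_space = {x. (\<forall>i\<le>L. fst x i \<in> vecs (label_dim i)) \<and> (\<forall>i>L. fst x i = (\<lambda>_. 0)) \<and> snd x \<in> vecs t}"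

definition edge_space :: "'a edge set" where
  "edge_space = vecs r \<times> vecs r' \<times> vecs t \<times> vecs t"

definition walk_components :: "(('a walk \<Rightarrow> 'a coords) \<times> nat) set" where
  "walk_components = insert (snd, t) ((\<lambda>i. (\<lambda>x. fst x i, label_dim i)) ` {..L})"

definition edge_components :: "(('a edge \<Rightarrow> 'a coords) \<times> nat) set" where
  "edge_components =
    {(fst, r), (\<lambda>z. fst (snd z), r'), (\<lambda>z. fst (snd (snd z)), t), (\<lambda>z. snd (snd (snd z)), t)}"

abbreviation walk_coords :: "('a walk \<Rightarrow> 'a) set" where
  "walk_coords \<equiv> component_coords walk_components"

abbreviation edge_coords :: "('a edge \<Rightarrow> 'a) set" where
  "edge_coords \<equiv> component_coords edge_components"

definition walk_dim :: nat where "walk_dim = (\<Sum>i\<le>L. label_dim i) + t"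

lemma three_le_L: "3 \<le> L"
  using two_le_k by (simp add: L_def)

lemma label_coord_mem: "i \<le> L \<Longrightarrow> c < label_dim i \<Longrightarrow> (\<lambda>x. fst x i c) \<in> walk_coords"
  by (rule component_coordsI[of _ "label_dim i"]) (auto simp: walk_components_def)

lemma start_coord_mem: "c < t \<Longrightarrow> (\<lambda>x. snd x c) \<in> walk_coords"
  by (rule component_coordsI[of _ t]) (auto simp: walk_components_def)

lemma walk_coordsE:
  assumes "g \<in> walk_coords"
  obtains (label) i c where "i \<le> L" "c < label_dim i" "g = (\<lambda>x. fst x i c)"
    | (start) c where "c < t" "g = (\<lambda>x. snd x c)"
  using assms by (elim component_coordsE) (auto simp: walk_components_def)

lemma coordinate_space_walks: "coordinate_space K e walk_space walk_coords"
proof (rule coordinate_space_component_coords)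
  fix x y assume xy: "x \<in> walk_space" "y \<in> walk_space" "\<And>\<pi> n. (\<pi>, n) \<in> walk_components \<Longrightarrow> \<pi> x = \<pi> y"
  have "fst x i = fst y i" for i
    using xy(1,2) xy(3)[of "\<lambda>x. fst x i" "label_dim i"]
    by (cases "i \<le> L") (auto simp: walk_space_def walk_components_def)
  moreover have "snd x = snd y" using xy(3)[of snd t] by (simp add: walk_components_def)
  ultimately show "x = y" by (auto simp: prod_eq_iff)
qed (auto simp: walk_components_def walk_space_def)

lemma coordinate_space_edges: "coordinate_space K e edge_space edge_coords"
proof (rule coordinate_space_component_coords)
  fix z z' :: "'a edge" assume "\<And>\<pi> n. (\<pi>, n) \<in> edge_components \<Longrightarrow> \<pi> z = \<pi> z'"
  then show "z = z'" unfolding edge_components_def by (metis insertCI prod.expand)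
qed (auto simp: edge_components_def edge_space_def)

sublocale walk: coordinate_space K e walk_space walk_coords
  by (rule coordinate_space_walks)

sublocale edge: coordinate_space K e edge_space edge_coords
  by (rule coordinate_space_edges)

lemma card_walk_coords: "card walk_coords \<le> walk_dim"
proof -
  have fin: "finite walk_components" by (simp add: walk_components_def)
  let ?labels = "(\<lambda>i. (\<lambda>x :: 'a walk. fst x i, label_dim i)) ` {..L}"
  have "card walk_coords \<le> (\<Sum>p\<in>insert (snd, t) ?labels. snd p)"
    using card_component_coords_le[OF fin] by (simp add: walk_components_def)
  also have "\<dots> \<le> t + (\<Sum>p\<in>?labels. snd p)"
    by (simp add: sum.insert_if)
  also have "(\<Sum>p\<in>?labels. snd p) \<le> (\<Sum>i\<le>L. label_dim i)"
    using sum_image_le[of "{..L}" snd "\<lambda>i. (\<lambda>x :: 'a walk. fst x i, label_dim i)"] by simp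
  finally show ?thesis by (simp add: walk_dim_def)
qed

text \<open>
  \<open>num_evals\<close> independent values of a random polynomial of degree \<open>edge_degree\<close> are needed to beat
  the number of conditions, and \<open>closing_degree\<close> bounds the degree of the resulting equations on
  walks. A piece of dimension \<open>0\<close> has fewer than \<open>point_bound\<close> elements.
\<close>

definition num_evals :: nat where "num_evals = walk_dim + t + 2"

definition edge_degree :: nat where "edge_degree = L * num_evals"

definition closing_degree :: nat where "closing_degree = edge_degree ^ t"

definition point_bound :: nat where "point_bound = (t * closing_degree + 2) ^ t + 1"

definition irreducibility_degree :: nat where
  "irreducibility_degree = point_bound * (t * closing_degree + 1) + L * num_evals * closing_degree"

lemma one_le_edge_degree: "1 \<le> edge_degree"
  using three_le_L by (simp add: edge_degree_def num_evals_def Suc_le_eq)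

lemma edge_degree_power_le: "j \<le> t \<Longrightarrow> edge_degree ^ j \<le> closing_degree"
  unfolding closing_degree_def using one_le_edge_degree by (intro power_increasing) auto

lemma polyfun_edge_coord:
  assumes W: "\<And>i c. i \<le> L \<Longrightarrow> polyfun walk_coords d (\<lambda>x. W x i c)" and "1 \<le> d" "m < L" "g \<in> edge_coords"
  shows "polyfun walk_coords d (\<lambda>x. g (edge_of (fst x) (W x) m))"
proof -
  have P: "polyfun walk_coords d (\<lambda>x. fst x i c)" if "i \<le> L" "c < label_dim i" for i c
    using label_coord_mem[OF that] assms(2) by (rule polyfun_gen)
  show ?thesis
    using assms(3,4) P[of m] P[of "Suc m"] W[of m] W[of "Suc m"]
    by (cases "even m")
      (auto elim!: component_coordsE simp: edge_components_def edge_of_def even_end_def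
          odd_end_def label_dim_def)
qed

end

locale polynomial_tower = tower +
  fixes f :: "nat \<Rightarrow> 'a edge \<Rightarrow> 'a"
  assumes polyfun_f: "j < t \<Longrightarrow> polyfun edge_coords edge_degree (f j)"
begin

lemma polyfun_lift_coords:
  assumes "j \<le> t" "i \<le> L"
  shows "polyfun walk_coords (edge_degree ^ j) (\<lambda>x. lift_coords f x j i c)"
  using assms
proof (induction j arbitrary: i c)
  case 0
  then show ?case using polyfun_const[OF zero_mem] by simp
next
  case (Suc j)
  have one_le_power: "1 \<le> edge_degree ^ j" using one_le_edge_degree by simp
  have value_at: "polyfun walk_coords (edge_degree * edge_degree ^ j)
      (\<lambda>x. f j (edge_of (fst x) (lift_coords f x j) m))"
    if "m < L" for m
    by (rule polyfun_comp[OF polyfun_f]) (use Suc that one_le_power in \<open>auto intro!: polyfun_edge_coord\<close>)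
  have "polyfun walk_coords (edge_degree * edge_degree ^ j)
      (\<lambda>x. coord_along (f j) (edge_of (fst x) (lift_coords f x j)) (snd x j) i)" if "i \<le> L" for i
    using that
  proof (induction i)
    case 0
    then show ?case
      using Suc.prems one_le_power one_le_edge_degree by (auto intro!: polyfun_gen start_coord_mem)
  next
    case (Suc i)
    then show ?case using value_at[of i] by (auto intro: polyfun_diff)
  qed
  moreover have "polyfun walk_coords (edge_degree * edge_degree ^ j) (\<lambda>x. lift_coords f x j i c)"
    by (rule polyfun_mono[OF Suc.IH]) (use Suc.prems one_le_edge_degree in auto)
  ultimately show ?case using Suc.prems by (cases "c = j") auto
qed

lemma polyfun_edge_coord_at:
  assumes "j \<le> t" "m < L" "g \<in> edge_coords"
  shows "polyfun walk_coords (edge_degree ^ j) (\<lambda>x. g (edge_at f j x m))"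
  unfolding edge_at_def
  using assms one_le_edge_degree by (intro polyfun_edge_coord polyfun_lift_coords) auto

lemma polyfun_segment_sum:
  assumes "j < t" "b \<le> L"
  shows "polyfun walk_coords closing_degree (\<lambda>x. segment_sum f j a b x)"
proof -
  have degree_le: "edge_degree * edge_degree ^ j \<le> closing_degree"
    using edge_degree_power_le[of "Suc j"] assms(1) by simp
  have "polyfun walk_coords closing_degree (\<lambda>x. f j (edge_at f j x m))" if "m < L" for m
    by (rule polyfun_mono[OF polyfun_comp[OF polyfun_f] degree_le])
      (use assms that in \<open>auto intro: polyfun_edge_coord_at\<close>)
  then show ?thesis unfolding segment_sum_def using assms(2) by (intro polyfun_sum polyfun_sign) auto
qed

lemma lift_coords_mem:
  assumes "x \<in> walk_space" "j \<le> t" "i \<le> L"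
  shows "lift_coords f x j i \<in> vecs t"
  using walk.polyfun_mem[OF polyfun_lift_coords[OF assms(2,3)] assms(1)] assms(2)
  by (auto simp: vecs_def lift_coords_eq_0)

lemma edge_at_mem:
  assumes "x \<in> walk_space" "j \<le> t" "m < L"
  shows "edge_at f j x m \<in> edge_space"
proof -
  have label: "fst x i \<in> vecs (label_dim i)" if "i \<le> L" for i
    using assms(1) that by (simp add: walk_space_def)
  have lift: "lift_coords f x j i \<in> vecs t" if "i \<le> L" for i
    using lift_coords_mem[OF assms(1,2) that] .
  show ?thesis
    using label[of m] label[of "Suc m"] lift[of m] lift[of "Suc m"] assms(3)
    by (auto simp: edge_at_def edge_of_def even_end_def odd_end_def edge_space_def label_dim_def)
qed

end

section \<open>Generic polynomials\<close>

lemma card_UN_mult_le: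
  assumes "finite I" "\<And>i. i \<in> I \<Longrightarrow> card (B i) * m \<le> n"
  shows "card (\<Union>i\<in>I. B i) * m \<le> card I * n"
proof -
  have "card (\<Union>i\<in>I. B i) * m \<le> (\<Sum>i\<in>I. card (B i)) * m"
    using assms(1) by (intro mult_le_mono1 card_UN_le)
  also have "\<dots> = (\<Sum>i\<in>I. card (B i) * m)" by (simp add: sum_distrib_right)
  also have "\<dots> \<le> (\<Sum>i\<in>I. n)" using assms(2) by (rule sum_mono)
  finally show ?thesis by simp
qed

lemma exists_outside_UN:
  assumes "finite I" "card I < m" "finite R" "R \<noteq> {}"
    and "\<And>i. i \<in> I \<Longrightarrow> B i \<subseteq> R" "\<And>i. i \<in> I \<Longrightarrow> card (B i) * m \<le> card R"
  shows "\<exists>x\<in>R. \<forall>i\<in>I. x \<notin> B i"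
proof -
  have "card (\<Union>i\<in>I. B i) * m \<le> card I * card R" using assms(1,6) by (rule card_UN_mult_le)
  also have "\<dots> < m * card R"
    using assms(2-4) by (intro mult_strict_right_mono) (auto simp: card_gt_0_iff)
  finally have "card (\<Union>i\<in>I. B i) < card R" by (simp add: mult.commute)
  moreover have "(\<Union>i\<in>I. B i) \<subseteq> R" using assms(5) by blast
  ultimately have "(\<Union>i\<in>I. B i) \<subset> R" by auto
  then show ?thesis by blast
qed

context tower begin

definition cover_exponent :: nat where "cover_exponent = (irreducibility_degree + 1) ^ walk_dim"

definition irreducible_parts :: "'a walk set \<Rightarrow> 'a walk set set" where
  "irreducible_parts S = (SOME \<C>. finite \<C> \<and> card \<C> \<le> 2 ^ cover_exponent \<and> \<Union>\<C> = S \<and>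
    (\<forall>B\<in>\<C>. walk.irreducible_upto irreducibility_degree B))"

lemma irreducible_parts:
  assumes "S \<subseteq> walk_space"
  shows "finite (irreducible_parts S)" "card (irreducible_parts S) \<le> 2 ^ cover_exponent"
    "\<Union>(irreducible_parts S) = S" "B \<in> irreducible_parts S \<Longrightarrow> walk.irreducible_upto irreducibility_degree B"
proof -
  have "walk.hilb S irreducibility_degree \<le> q ^ ((irreducibility_degree + 1) ^ card walk_coords)"
    by (rule walk.hilb_le[OF assms order.refl]) auto
  also have "\<dots> \<le> q ^ cover_exponent"
    unfolding cover_exponent_def using card_walk_coords two_le_card by (intro power_increasing) auto
  finally have "\<exists>\<C>. finite \<C> \<and> card \<C> \<le> 2 ^ cover_exponent \<and> \<Union>\<C> = S \<and>
      (\<forall>B\<in>\<C>. walk.irreducible_upto irreducibility_degree B)"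
    by (rule walk.irreducible_cover[OF assms])
  from someI_ex[OF this]
  show "finite (irreducible_parts S)" "card (irreducible_parts S) \<le> 2 ^ cover_exponent"
    "\<Union>(irreducible_parts S) = S" "B \<in> irreducible_parts S \<Longrightarrow> walk.irreducible_upto irreducibility_degree B"
    unfolding irreducible_parts_def by blast+
qed

definition edge_coincidences :: "(nat \<Rightarrow> 'a edge \<Rightarrow> 'a) \<Rightarrow> nat \<Rightarrow> 'a walk \<Rightarrow> (nat \<times> nat) set" where
  "edge_coincidences f j x = {(m, m'). m < L \<and> m' < L \<and> edge_at f j x m = edge_at f j x m'}"

definition pieces :: "(nat \<Rightarrow> 'a edge \<Rightarrow> 'a) \<Rightarrow> nat \<Rightarrow> 'a walk set \<Rightarrow> 'a walk set set" where
  "pieces f j S = (\<Union>\<pi>\<in>Pow ({..<L} \<times> {..<L}). irreducible_parts {x \<in> S. edge_coincidences f j x = \<pi>})"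

definition max_pieces :: nat where "max_pieces = 2 ^ (L * L) * 2 ^ cover_exponent"

lemma piece:
  assumes "A \<in> pieces f j S" "S \<subseteq> walk_space"
  shows "A \<subseteq> S" "walk.irreducible_upto irreducibility_degree A"
    "x \<in> A \<Longrightarrow> y \<in> A \<Longrightarrow> edge_coincidences f j x = edge_coincidences f j y"
proof -
  obtain \<pi> where A: "A \<in> irreducible_parts {x \<in> S. edge_coincidences f j x = \<pi>}"
    using assms(1) by (auto simp: pieces_def)
  have class_sub: "{x \<in> S. edge_coincidences f j x = \<pi>} \<subseteq> walk_space" using assms(2) by auto
  have "A \<subseteq> {x \<in> S. edge_coincidences f j x = \<pi>}" using irreducible_parts(3)[OF class_sub] A by blast
  then show "A \<subseteq> S" "x \<in> A \<Longrightarrow> y \<in> A \<Longrightarrow> edge_coincidences f j x = edge_coincidences f j y" by blast+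
  show "walk.irreducible_upto irreducibility_degree A" using class_sub A by (rule irreducible_parts(4))
qed

lemma Union_pieces:
  assumes "S \<subseteq> walk_space"
  shows "\<Union>(pieces f j S) = S"
proof
  show "\<Union>(pieces f j S) \<subseteq> S" using piece(1)[OF _ assms] by blast
  show "S \<subseteq> \<Union>(pieces f j S)"
  proof
    fix x assume "x \<in> S"
    moreover have "{y \<in> S. edge_coincidences f j y = edge_coincidences f j x} \<subseteq> walk_space"
      using assms by auto
    ultimately obtain A
      where "A \<in> irreducible_parts {y \<in> S. edge_coincidences f j y = edge_coincidences f j x}" "x \<in> A"
      using irreducible_parts(3) by blast
    moreover have "edge_coincidences f j x \<in> Pow ({..<L} \<times> {..<L})"
      by (auto simp: edge_coincidences_def)
    ultimately show "x \<in> \<Union>(pieces f j S)" unfolding pieces_def by blast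
  qed
qed

lemma finite_pieces: "S \<subseteq> walk_space \<Longrightarrow> finite (pieces f j S)"
  unfolding pieces_def using irreducible_parts(1) by (auto simp: subset_iff)

lemma card_pieces_le:
  assumes "S \<subseteq> walk_space"
  shows "card (pieces f j S) \<le> max_pieces"
proof -
  have "card (pieces f j S) * 1 \<le> card (Pow ({..<L} \<times> {..<L})) * 2 ^ cover_exponent"
    unfolding pieces_def
  proof (rule card_UN_mult_le)
    show "card (irreducible_parts {x \<in> S. edge_coincidences f j x = \<pi>}) * 1 \<le> 2 ^ cover_exponent" for \<pi>
      using irreducible_parts(2)[of "{x \<in> S. edge_coincidences f j x = \<pi>}"] assms by auto
  qed simp
  then show ?thesis by (simp add: max_pieces_def card_Pow card_cartesian_product)
qed

lemma one_le_max_pieces: "1 \<le> max_pieces"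
  by (simp add: max_pieces_def Suc_le_eq)

definition initial_stratum :: "nat set \<Rightarrow> (nat \<Rightarrow> nat) \<Rightarrow> 'a walk \<Rightarrow> 'a walk set" where
  "initial_stratum I \<rho> x0 =
    {x \<in> walk_space. snd x = snd x0 \<and> (\<forall>i\<in>I. fst x i = fst x0 i) \<and> (\<forall>i\<le>L. fst x i = fst x (\<rho> i))}"

text \<open>All sets of walks that can remain after the first \<open>j\<close> levels, whatever the final set of walks is.\<close>

primrec strata :: "(nat \<Rightarrow> 'a edge \<Rightarrow> 'a) \<Rightarrow> nat \<Rightarrow> 'a walk set set" where
  "strata f 0 = (\<lambda>(I, \<rho>, x0). initial_stratum I \<rho> x0) ` (Pow {..L} \<times> ({..L} \<rightarrow>\<^sub>E {..L}) \<times> walk_space)"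
| "strata f (Suc j) = (\<Union>S\<in>strata f j. \<Union>A\<in>pieces f j S.
     insert A ((\<lambda>(a, b, w). {x \<in> A. segment_sum f j a b x = w}) ` ({..L} \<times> {..L} \<times> K)))"

definition initial_count :: nat where "initial_count = 2 ^ (L + 1) * (L + 1) ^ (L + 1)"

definition branch_count :: nat where "branch_count = max_pieces * ((L + 1) * (L + 1) + 1)"

lemma stratum_subset: "S \<in> strata f j \<Longrightarrow> S \<subseteq> walk_space"
proof (induction j arbitrary: S)
  case (Suc j)
  then obtain S' A where "S' \<in> strata f j" "A \<in> pieces f j S'" "S \<subseteq> A" by auto
  then show ?case using piece(1)[of A f j S'] Suc.IH[of S'] by blast
qed (auto simp: initial_stratum_def)

lemma piece_subset: "A \<in> pieces f j S \<Longrightarrow> S \<in> strata f j \<Longrightarrow> A \<subseteq> walk_space"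
  using piece(1)[of A f j S] stratum_subset by blast

lemma finite_strata: "finite (strata f j)"
proof (induction j)
  case 0
  show ?case by (simp add: walk.finite_space finite_PiE)
next
  case (Suc j)
  then show ?case using finite_pieces[OF stratum_subset] by (auto simp: finite_K)
qed

lemma card_strata_le: "card (strata f j) \<le> initial_count * branch_count ^ j * q ^ (walk_dim + j)"
proof (induction j)
  case 0
  let ?data = "Pow {..L} \<times> ({..L} \<rightarrow>\<^sub>E {..L}) \<times> walk_space"
  have "card (strata f 0) \<le> card ?data"
    unfolding strata.simps by (rule card_image_le) (simp add: walk.finite_space finite_PiE)
  also have "\<dots> = initial_count * card walk_space"
    by (simp add: card_cartesian_product card_Pow card_PiE initial_count_def)
  also have "card walk_space \<le> q ^ walk_dim"
    using walk.card_space_le power_increasing[OF card_walk_coords, of q] two_le_card by linarith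
  finally show ?case by simp
next
  case (Suc j)
  let ?T = "{..L} \<times> {..L} \<times> K"
  let ?cuts = "\<lambda>A. insert A ((\<lambda>(a, b, w). {x \<in> A. segment_sum f j a b x = w}) ` ?T)"
  have finT: "finite ?T" by (simp add: finite_K)
  have cuts: "card (?cuts A) * 1 \<le> ((L + 1) * (L + 1) + 1) * q" for A
  proof -
    have "card (?cuts A) \<le> Suc (card ((\<lambda>(a, b, w). {x \<in> A. segment_sum f j a b x = w}) ` ?T))"
      using finT by (simp add: card_insert_if)
    also have "\<dots> \<le> Suc (card ?T)" using card_image_le[OF finT] by simp
    also have "\<dots> = (L + 1) * (L + 1) * q + 1" by (simp add: card_cartesian_product algebra_simps)
    also have "\<dots> \<le> ((L + 1) * (L + 1) + 1) * q" using two_le_card by simp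
    finally show ?thesis by simp
  qed
  have pieces: "card (\<Union>A\<in>pieces f j S. ?cuts A) * 1 \<le> branch_count * q" if "S \<in> strata f j" for S
  proof -
    have "card (\<Union>A\<in>pieces f j S. ?cuts A) * 1 \<le> card (pieces f j S) * (((L + 1) * (L + 1) + 1) * q)"
      using finite_pieces[OF stratum_subset[OF that]] cuts by (rule card_UN_mult_le)
    also have "\<dots> \<le> max_pieces * (((L + 1) * (L + 1) + 1) * q)"
      using card_pieces_le[OF stratum_subset[OF that]] by (rule mult_le_mono1)
    finally show ?thesis unfolding branch_count_def by (simp only: mult.assoc)
  qed
  have "card (strata f (Suc j)) * 1 \<le> card (strata f j) * (branch_count * q)"
    unfolding strata.simps using finite_strata pieces by (rule card_UN_mult_le)
  also have "\<dots> \<le> (initial_count * branch_count ^ j * q ^ (walk_dim + j)) * (branch_count * q)"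
    using Suc by (rule mult_le_mono1)
  finally show ?case by (simp add: mult_ac)
qed

definition edge_coeff :: "(nat \<Rightarrow> 'a edge \<Rightarrow> 'a) \<Rightarrow> nat \<Rightarrow> nat \<Rightarrow> nat \<Rightarrow> nat \<Rightarrow> 'a walk \<Rightarrow> 'a" where
  "edge_coeff f j a b m x = (\<Sum>i\<in>{i \<in> {a..<b}. edge_at f j x i = edge_at f j x m}. (-1) ^ i * e)"

definition uncancelled :: "(nat \<Rightarrow> 'a edge \<Rightarrow> 'a) \<Rightarrow> nat \<Rightarrow> nat \<Rightarrow> nat \<Rightarrow> nat \<Rightarrow> 'a walk set \<Rightarrow> bool" where
  "uncancelled f j a b m A \<longleftrightarrow> a \<le> m \<and> m < b \<and> b \<le> L \<and> (\<forall>x\<in>A. edge_coeff f j a b m x \<noteq> 0) \<and>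
    (\<exists>x\<in>A. \<exists>y\<in>A. edge_at f j x m \<noteq> edge_at f j y m)"

definition generic :: "(nat \<Rightarrow> 'a edge \<Rightarrow> 'a) \<Rightarrow> nat \<Rightarrow> bool" where
  "generic f j \<longleftrightarrow> (\<forall>S\<in>strata f j. \<forall>A\<in>pieces f j S. \<forall>a b m. uncancelled f j a b m A \<longrightarrow>
     (\<forall>w\<in>K. \<exists>x\<in>A. segment_sum f j a b x \<noteq> w))"

lemma pieces_cong: "(\<And>i. i < j \<Longrightarrow> f i = f' i) \<Longrightarrow> pieces f j = pieces f' j"
  by (intro ext) (simp only: pieces_def edge_coincidences_def edge_at_cong[of j f f'])

lemma strata_cong: "(\<And>i. i < j \<Longrightarrow> f i = f' i) \<Longrightarrow> strata f j = strata f' j"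
proof (induction j)
  case (Suc j)
  then have "segment_sum f j = segment_sum f' j" "pieces f j = pieces f' j" "strata f j = strata f' j"
    using segment_sum_cong[of j f f'] pieces_cong[of j f f'] by auto
  then show ?case by simp
qed simp

lemma uncancelled_cong: "(\<And>i. i < j \<Longrightarrow> f i = f' i) \<Longrightarrow> uncancelled f j = uncancelled f' j"
  by (intro ext) (simp only: uncancelled_def edge_coeff_def edge_at_cong[of j f f'])

lemma generic_cong: "(\<And>i. i \<le> j \<Longrightarrow> f i = f' i) \<Longrightarrow> generic f j = generic f' j"
  using strata_cong[of j f f'] pieces_cong[of j f f'] uncancelled_cong[of j f f']
    segment_sum_cong[of j f f']
  by (simp add: generic_def)

definition min_field_size :: nat where
  "min_field_size = initial_count * branch_count ^ t * max_pieces * ((L + 1) * (L + 1)) + 1"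

lemma card_conditions_less:
  assumes "min_field_size \<le> q" "j \<le> t"
  shows "card ((\<Union>S\<in>strata f j. pieces f j S) \<times> {..L} \<times> {..L} \<times> K) < q ^ num_evals"
proof -
  have "card (\<Union>S\<in>strata f j. pieces f j S) * 1 \<le> card (strata f j) * max_pieces"
    by (rule card_UN_mult_le) (use finite_strata card_pieces_le[OF stratum_subset] in auto)
  also have "\<dots> \<le> (initial_count * branch_count ^ j * q ^ (walk_dim + j)) * max_pieces"
    using card_strata_le by (rule mult_le_mono1)
  also have "\<dots> \<le> (initial_count * branch_count ^ t * q ^ (walk_dim + t)) * max_pieces"
    using assms(2) two_le_card one_le_max_pieces
    by (intro mult_le_mono1 mult_le_mono mult_le_mono2 power_increasing) (auto simp: branch_count_def)
  finally have "card (\<Union>S\<in>strata f j. pieces f j S)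
      \<le> initial_count * branch_count ^ t * q ^ (walk_dim + t) * max_pieces"
    by simp
  then have "card (\<Union>S\<in>strata f j. pieces f j S) * ((L + 1) * (L + 1)) * q
      \<le> (initial_count * branch_count ^ t * q ^ (walk_dim + t) * max_pieces) * ((L + 1) * (L + 1)) * q"
    by (intro mult_le_mono1)
  also have "\<dots> = (initial_count * branch_count ^ t * max_pieces * ((L + 1) * (L + 1)))
      * q ^ (walk_dim + t + 1)"
    by (simp add: algebra_simps)
  also have "\<dots> < q * q ^ (walk_dim + t + 1)"
    using assms(1) two_le_card by (intro mult_strict_right_mono) (auto simp: min_field_size_def)
  also have "\<dots> = q ^ num_evals" by (simp add: num_evals_def)
  finally show ?thesis by (simp add: card_cartesian_product algebra_simps)
qed

end

context polynomial_tower begin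

lemma uncancelled_edge_avoids:
  assumes S: "S \<in> strata f j" and A: "A \<in> pieces f j S" and j: "j < t" and unc: "uncancelled f j a b m A"
    and F: "F \<subseteq> edge_space" "card F \<le> L * num_evals"
  shows "\<exists>x\<in>A. edge_at f j x m \<notin> F"
proof -
  have irr: "walk.irreducible_upto irreducibility_degree A"
    using piece(2)[OF A stratum_subset[OF S]] .
  have m: "m < L" using unc by (simp add: uncancelled_def)
  obtain x y where xy: "x \<in> A" "y \<in> A" "edge_at f j x m \<noteq> edge_at f j y m"
    using unc by (auto simp: uncancelled_def)
  have "edge_at f j z m \<in> edge_space" if "z \<in> A" for z
    using edge_at_mem[of z j m] that piece_subset[OF A S] j m by auto
  then obtain g where g: "g \<in> edge_coords" "g (edge_at f j x m) \<noteq> g (edge_at f j y m)"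
    using edge.coords_separate xy by blast
  have finite_F: "finite F" using F(1) by (rule edge.finite_subset_space)
  have "card (g ` F) * closing_degree \<le> L * num_evals * closing_degree"
    using card_image_le[OF finite_F, of g] F(2) by (intro mult_le_mono1) simp
  also have "\<dots> \<le> irreducibility_degree" by (simp add: irreducibility_degree_def)
  finally have "card (g ` F) * closing_degree \<le> irreducibility_degree" .
  moreover have "polyfun walk_coords closing_degree (\<lambda>x. g (edge_at f j x m))"
    using polyfun_mono[OF polyfun_edge_coord_at[OF _ m g(1)] edge_degree_power_le] j by simp
  moreover have "g ` F \<subseteq> K" using F(1) g(1) edge.coord_mem by auto
  ultimately have "\<exists>x\<in>A. g (edge_at f j x m) \<notin> g ` F"
    using xy(1,2) g(2) finite_F by (intro walk.irreducible_avoids_values[OF irr]) auto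
  then show ?thesis by blast
qed

lemma card_bad_polys_le:
  assumes S: "S \<in> strata f j" and A: "A \<in> pieces f j S" and j: "j < t" and unc: "uncancelled f j a b m A"
  shows "card {\<phi> \<in> edge.polys_on edge_space edge_degree.
      \<forall>x\<in>A. (\<Sum>i\<in>{a..<b}. (-1) ^ i * \<phi> (edge_at f j x i)) = w}
    * q ^ num_evals \<le> edge.hilb edge_space edge_degree"
proof (rule edge.card_level_set)
  have ab: "a \<le> m" "m < b" "b \<le> L" using unc by (auto simp: uncancelled_def)
  then have card: "card {a..<b} * num_evals \<le> L * num_evals" by (intro mult_le_mono1) simp
  then show "card {a..<b} * num_evals \<le> edge_degree" by (simp add: edge_degree_def)
  show "m \<in> {a..<b}" using ab by simp
  show "(-1) ^ i * x \<in> K" if "x \<in> K" for i x using that by (rule sign_mem)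
  show "(\<Sum>i\<in>{i \<in> {a..<b}. edge_at f j x i = edge_at f j x m}. (-1) ^ i * e) \<noteq> 0" if "x \<in> A" for x
    using unc that by (auto simp: uncancelled_def edge_coeff_def)
  show "edge_at f j x i \<in> edge_space" if "i \<in> {a..<b}" "x \<in> A" for i x
    using edge_at_mem[of x j i] piece_subset[OF A S] that j ab by auto
  show "\<exists>x\<in>A. edge_at f j x m \<notin> F" if "F \<subseteq> edge_space" "card F \<le> card {a..<b} * num_evals" for F
    using uncancelled_edge_avoids[OF assms that(1)] le_trans[OF that(2) card] .
qed simp

lemma exists_poly_avoiding_constants:
  assumes "min_field_size \<le> q" "j < t"
  shows "\<exists>g. polyfun edge_coords edge_degree g \<and> (\<forall>S\<in>strata f j. \<forall>A\<in>pieces f j S. \<forall>a b m.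
    uncancelled f j a b m A \<longrightarrow> (\<forall>w\<in>K. \<exists>x\<in>A. (\<Sum>i\<in>{a..<b}. (-1) ^ i * g (edge_at f j x i)) \<noteq> w))"
proof -
  define bad where "bad = (\<lambda>(A, a, b, w). {\<phi> \<in> edge.polys_on edge_space edge_degree.
    (\<exists>m. uncancelled f j a b m A) \<and> (\<forall>x\<in>A. (\<Sum>i\<in>{a..<b}. (-1) ^ i * \<phi> (edge_at f j x i)) = w)})"
  let ?conditions = "(\<Union>S\<in>strata f j. pieces f j S) \<times> {..L} \<times> {..L} \<times> K"
  have "\<exists>\<phi>\<in>edge.polys_on edge_space edge_degree. \<forall>c\<in>?conditions. \<phi> \<notin> bad c"
  proof (rule exists_outside_UN)
    show "card ?conditions < q ^ num_evals" using card_conditions_less assms by simp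
    show "finite ?conditions" using finite_strata finite_pieces[OF stratum_subset] finite_K by auto
    show "finite (edge.polys_on edge_space edge_degree)" by (rule edge.finite_polys_on) simp
    show "edge.polys_on edge_space edge_degree \<noteq> {}"
      using edge.hilb_pos[OF order.refl, of edge_degree] by auto
    fix c assume c: "c \<in> ?conditions"
    show "bad c \<subseteq> edge.polys_on edge_space edge_degree" by (auto simp: bad_def split: prod.splits)
    obtain A a b w where [simp]: "c = (A, a, b, w)" by (cases c)
    show "card (bad c) * q ^ num_evals \<le> edge.hilb edge_space edge_degree"
    proof (cases "\<exists>m. uncancelled f j a b m A")
      case True
      then show ?thesis using c card_bad_polys_le[OF _ _ assms(2)] by (auto simp: bad_def)
    qed (simp add: bad_def)
  qed
  then obtain \<phi> g where \<phi>: "\<forall>c\<in>?conditions. \<phi> \<notin> bad c" "\<phi> \<in> edge.polys_on edge_space edge_degree"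
    and g: "polyfun edge_coords edge_degree g" "\<phi> = restrict g edge_space" by (metis edge.polys_onE)
  have "\<exists>x\<in>A. (\<Sum>i\<in>{a..<b}. (-1) ^ i * g (edge_at f j x i)) \<noteq> w"
    if S: "S \<in> strata f j" and A: "A \<in> pieces f j S" and unc: "uncancelled f j a b m A" and "w \<in> K"
      for S A a b m w
  proof -
    have ab: "a \<le> L" "b \<le> L" using unc by (auto simp: uncancelled_def)
    then have "(A, a, b, w) \<in> ?conditions" using S A \<open>w \<in> K\<close> by auto
    then obtain x where x: "x \<in> A" "(\<Sum>i\<in>{a..<b}. (-1) ^ i * \<phi> (edge_at f j x i)) \<noteq> w"
      using \<phi> unc unfolding bad_def by blast
    have "x \<in> walk_space" using piece_subset[OF A S] x(1) by blast
    then have "(\<Sum>i\<in>{a..<b}. (-1) ^ i * g (edge_at f j x i))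
        = (\<Sum>i\<in>{a..<b}. (-1) ^ i * \<phi> (edge_at f j x i))"
      using edge_at_mem[of x j] assms(2) ab by (intro sum.cong) (auto simp: g(2))
    then show ?thesis using x by metis
  qed
  then show ?thesis using g(1) by blast
qed

lemma exists_generic_step:
  assumes "min_field_size \<le> q" "j < t"
  shows "\<exists>g. polyfun edge_coords edge_degree g \<and> generic (f(j := g)) j"
proof -
  obtain g where g: "polyfun edge_coords edge_degree g"
    and avoid: "\<forall>S\<in>strata f j. \<forall>A\<in>pieces f j S. \<forall>a b m. uncancelled f j a b m A \<longrightarrow>
      (\<forall>w\<in>K. \<exists>x\<in>A. (\<Sum>i\<in>{a..<b}. (-1) ^ i * g (edge_at f j x i)) \<noteq> w)"
    using exists_poly_avoiding_constants[OF assms] by blast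
  let ?f = "f(j := g)"
  have same_levels: "strata ?f j = strata f j" "pieces ?f j = pieces f j" "edge_at ?f j = edge_at f j"
    "uncancelled ?f j = uncancelled f j"
    by (intro strata_cong pieces_cong edge_at_cong uncancelled_cong; simp)+
  have "generic ?f j" unfolding generic_def segment_sum_def same_levels fun_upd_same by (rule avoid)
  then show ?thesis using g by blast
qed

end

locale generic_tower = polynomial_tower +
  assumes generic_f: "j < t \<Longrightarrow> generic f j"

context tower begin

lemma exists_generic_tower:
  assumes "min_field_size \<le> q"
  shows "\<exists>f. generic_tower K e k r r' f"
proof -
  have "\<exists>f. polynomial_tower K e k r r' f \<and> (\<forall>j<n. generic f j)" if "n \<le> t" for n
    using that
  proof (induction n)
    case 0
    have "polynomial_tower K e k r r' (\<lambda>_ _. 0)"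
      by unfold_locales (auto intro: polyfun_const zero_mem)
    then show ?case by auto
  next
    case (Suc n)
    then obtain f where f: "polynomial_tower K e k r r' f" "\<forall>j<n. generic f j" by auto
    then interpret polynomial_tower K e k r r' f by simp
    obtain g where g: "polyfun edge_coords edge_degree g" "generic (f(n := g)) n"
      using exists_generic_step assms Suc.prems by (auto simp: Suc_le_eq)
    have "generic (f(n := g)) j" if "j < n" for j
      using f(2) that generic_cong[of j "f(n := g)" f] by auto
    then have "\<forall>j<Suc n. generic (f(n := g)) j" using g(2) by (simp only: less_Suc_eq) blast
    moreover have "polynomial_tower K e k r r' (f(n := g))"
      by unfold_locales (use polyfun_f g(1) in auto)
    ultimately show ?case by blast
  qed
  then obtain f where f: "polynomial_tower K e k r r' f" "\<forall>j<t. generic f j" by blast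
  then interpret polynomial_tower K e k r r' f by simp
  have "generic_tower K e k r r' f" by unfold_locales (use f(2) in simp)
  then show ?thesis by blast
qed

end

section \<open>Coincidence patterns\<close>

text \<open>
  \<open>const j i\<close> and \<open>same j i i'\<close> stand for: at level \<open>j\<close> the \<open>i\<close>-th vertex is the same for all walks
  of a family, and every walk of the family has the same vertex at the indices \<open>i\<close> and \<open>i'\<close>.
\<close>

locale coincidence_pattern =
  fixes L t :: nat and const :: "nat \<Rightarrow> nat \<Rightarrow> bool" and same :: "nat \<Rightarrow> nat \<Rightarrow> nat \<Rightarrow> bool"
  assumes const_start: "const j 0" and const_end: "j \<le> t \<Longrightarrow> const j L"
    and const_antimono: "const (Suc j) i \<Longrightarrow> const j i"
    and same_antimono: "same (Suc j) i i' \<Longrightarrow> same j i i'"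
    and equivp_same: "equivp (same j)"
    and const_cong: "same j i i' \<Longrightarrow> const j i \<longleftrightarrow> const j i'"
    and same_parity: "same j i i' \<Longrightarrow> even i \<longleftrightarrow> even i'"
    and not_same_add_2: "i + 2 \<le> L \<Longrightarrow> \<not> same j i (i + 2)"
begin

lemmas same_refl = equivp_reflp[OF equivp_same]
  and same_sym = equivp_symp[OF equivp_same]
  and same_trans = equivp_transp[OF equivp_same]

definition same_edge :: "nat \<Rightarrow> nat \<Rightarrow> nat \<Rightarrow> bool" where
  "same_edge j m m' \<longleftrightarrow> same j (even_end m) (even_end m') \<and> same j (odd_end m) (odd_end m')"

lemma same_edge_refl: "same_edge j m m"
  by (simp add: same_edge_def same_refl)

lemma same_edge_sym: "same_edge j m m' \<Longrightarrow> same_edge j m' m"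
  unfolding same_edge_def using same_sym by blast

lemma same_edge_trans: "same_edge j m m' \<Longrightarrow> same_edge j m' m'' \<Longrightarrow> same_edge j m m''"
  unfolding same_edge_def using same_trans by blast

definition closed_at :: "nat \<Rightarrow> nat \<Rightarrow> nat \<Rightarrow> bool" where
  "closed_at j a b \<longleftrightarrow> const j a \<and> const j b \<or> same j a b"

definition single_edge :: "nat \<Rightarrow> nat \<Rightarrow> nat \<Rightarrow> nat \<Rightarrow> bool" where
  "single_edge j a b m \<longleftrightarrow> a \<le> m \<and> m < b \<and> b \<le> L \<and> closed_at (Suc j) a b \<and>
     \<not> (const j m \<and> const j (Suc m)) \<and> {i \<in> {a..<b}. same_edge j i m} = {m}"

definition void :: "nat \<Rightarrow> bool" where
  "void j \<longleftrightarrow> (\<nexists>a b m. single_edge j a b m)"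

definition representative :: "nat \<Rightarrow> nat \<Rightarrow> nat" where
  "representative j i = (LEAST i'. same j i' i)"

definition reps :: "nat \<Rightarrow> nat set" where
  "reps j = {i \<in> {..L}. \<not> const j i \<and> representative j i = i}"

lemma same_representative: "same j (representative j i) i"
  unfolding representative_def by (rule LeastI[of _ i]) (rule same_refl)

lemma representative_least: "same j i' i \<Longrightarrow> representative j i \<le> i'"
  unfolding representative_def by (rule Least_le)

lemma representative_le: "representative j i \<le> i"
  using same_refl by (rule representative_least)

lemma representative_cong:
  assumes "same j i i'"
  shows "representative j i = representative j i'"
proof -
  have "same j m i \<longleftrightarrow> same j m i'" for m using same_trans same_sym assms by blast
  then show ?thesis by (simp add: representative_def)
qed

lemma finite_reps: "finite (reps j)"
  by (simp add: reps_def)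

lemma representative_in_reps:
  assumes "i \<le> L" "\<not> const j i"
  shows "representative j i \<in> reps j"
  using assms representative_le[of j i] const_cong[OF same_representative]
    representative_cong[OF same_representative] by (simp add: reps_def)

lemma reps_mono: "j \<le> j' \<Longrightarrow> reps j \<subseteq> reps j'"
proof (induction j' rule: dec_induct)
  case (step j')
  have "reps j' \<subseteq> reps (Suc j')"
  proof
    fix i assume i: "i \<in> reps j'"
    have "representative j' i \<le> representative (Suc j') i"
      using representative_least same_antimono same_representative by blast
    then have "representative (Suc j') i = i"
      using i representative_le[of "Suc j'" i] by (simp add: reps_def)
    then show "i \<in> reps (Suc j')" using i const_antimono by (auto simp: reps_def)
  qed
  then show ?case using step.IH by blast
qed simp

lemma reps_subset_interior: "reps 0 \<subseteq> {1..<L}"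
proof
  fix i assume "i \<in> reps 0"
  then have i: "i \<le> L" "\<not> const 0 i" by (auto simp: reps_def)
  then have "i \<noteq> 0" "i \<noteq> L" using const_start const_end[OF le0] by metis+
  then show "i \<in> {1..<L}" using i by simp
qed

text \<open>If the constraint of the whole walk is void, every nonconstant edge is traversed at least twice.\<close>

lemma void_card_reps_le:
  assumes "j < t" "void j"
  shows "2 * card (reps j) \<le> L"
proof -
  define traversals where "traversals i = {m \<in> {0..<L}. same_edge j m (i - 1)}" for i
  have bounds: "0 < i" "i \<le> L" if "i \<in> reps j" for i
    using that const_start[of j] by (auto simp: reps_def intro: gr0I)
  have twice: "2 \<le> card (traversals i)" if i: "i \<in> reps j" for i
  proof (rule ccontr)
    assume "\<not> 2 \<le> card (traversals i)"
    moreover have "i - 1 \<in> traversals i"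
      using bounds[OF i] same_edge_refl by (auto simp: traversals_def)
    ultimately have "traversals i = {i - 1}"
      using card_le_Suc0_iff_eq[of "traversals i"] by (auto simp: traversals_def)
    moreover have "closed_at (Suc j) 0 L"
      using const_start const_end assms(1) by (simp add: closed_at_def)
    ultimately have "single_edge j 0 L (i - 1)"
      using i bounds[OF i] by (auto simp: single_edge_def traversals_def reps_def)
    then show False using assms(2) by (auto simp: void_def)
  qed
  have disjoint: "traversals i \<inter> traversals i' = {}" if "i \<in> reps j" "i' \<in> reps j" "i < i'" for i i'
  proof (rule ccontr)
    assume "traversals i \<inter> traversals i' \<noteq> {}"
    then have "same_edge j (i - 1) (i' - 1)"
      unfolding traversals_def using same_edge_sym same_edge_trans by blast
    then have "same j i i' \<or> same j (i - 1) i'"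
      using bounds[OF that(1)] bounds[OF that(2)]
      by (auto simp: same_edge_def even_end_def odd_end_def split: if_splits)
    then have "representative j i' \<le> i" using representative_least by (meson diff_le_self le_trans)
    then show False using that(2,3) by (simp add: reps_def)
  qed
  have "2 * card (reps j) = (\<Sum>i\<in>reps j. 2)" by simp
  also have "\<dots> \<le> (\<Sum>i\<in>reps j. card (traversals i))" using twice by (rule sum_mono)
  also have "\<dots> = card (\<Union>i\<in>reps j. traversals i)"
  proof (rule card_UN_disjoint[symmetric])
    show "\<forall>i\<in>reps j. \<forall>i'\<in>reps j. i \<noteq> i' \<longrightarrow> traversals i \<inter> traversals i' = {}"
      using disjoint by (metis Int_commute linorder_neqE_nat)
  qed (auto simp: finite_reps traversals_def)
  also have "\<dots> \<le> card {0..<L}" by (rule card_mono) (auto simp: traversals_def)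
  finally show ?thesis by simp
qed

lemma const_Suc_if_reps_eq:
  assumes "reps j = reps (Suc j)" "const j i" "i \<le> L"
  shows "const (Suc j) i"
proof (rule ccontr)
  assume "\<not> const (Suc j) i"
  then have "representative (Suc j) i \<in> reps j" using representative_in_reps assms(1,3) by simp
  then show False
    using const_cong[OF same_antimono[OF same_representative]] assms(2) by (auto simp: reps_def)
qed

lemma same_Suc_if_reps_eq:
  assumes "reps j = reps (Suc j)" "same j a b" "\<not> const j a" "a \<le> L" "b \<le> L"
  shows "same (Suc j) a b"
proof -
  have representative_eq: "representative (Suc j) i = representative j i" if "i \<le> L" "\<not> const j i" for i
  proof -
    have "representative (Suc j) i \<in> reps j"
      using that representative_in_reps const_antimono assms(1) by blast
    then have "representative j (representative (Suc j) i) = representative (Suc j) i"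
      by (simp add: reps_def)
    then show ?thesis using representative_cong[OF same_antimono[OF same_representative]] by metis
  qed
  have "representative (Suc j) a = representative (Suc j) b"
    using representative_eq[of a] representative_eq[of b]
      representative_cong[OF assms(2)] const_cong[OF assms(2)] assms(3-5)
    by simp
  then show ?thesis using same_trans same_sym same_representative by metis
qed

definition segment :: "nat \<Rightarrow> nat \<Rightarrow> nat \<Rightarrow> bool" where
  "segment j a b \<longleftrightarrow> a + 2 \<le> b \<and> b \<le> L \<and> (\<forall>m. a < m \<longrightarrow> m < b \<longrightarrow> \<not> const j m) \<and> closed_at j a b"

lemma exists_segment:
  assumes "j \<le> t" "reps j \<noteq> {}"
  shows "\<exists>a b. segment j a b"
proof -
  obtain i where i: "i \<le> L" "\<not> const j i" using assms(2) by (auto simp: reps_def)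
  then have "i \<noteq> 0" "i \<noteq> L" using const_start const_end assms(1) by metis+
  then have ends: "0 < i \<and> const j 0" "i < L \<and> const j L"
    using i const_start const_end[OF assms(1)] by auto
  define a where "a = (GREATEST m. m < i \<and> const j m)"
  define b where "b = (LEAST m. i < m \<and> const j m)"
  have a: "a < i" "const j a"
    using GreatestI_nat[of "\<lambda>m. m < i \<and> const j m" 0 i] ends by (auto simp: a_def)
  have a_max: "m \<le> a" if "m < i" "const j m" for m
    unfolding a_def using that by (intro Greatest_le_nat[of _ m i]) auto
  have b: "i < b" "const j b" using LeastI[of "\<lambda>m. i < m \<and> const j m" L] ends by (auto simp: b_def)
  have b_min: "b \<le> m" if "i < m" "const j m" for m unfolding b_def using that by (intro Least_le) simp
  have "b \<le> L" using b_min ends(2) by blast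
  moreover have "\<not> const j m" if "a < m" "m < b" for m
    using that a_max[of m] b_min[of m] i(2) by (metis linorder_neqE_nat linorder_not_le)
  ultimately have "segment j a b" using a b by (simp add: segment_def closed_at_def)
  then show ?thesis by blast
qed

lemma shortest_segment_traverses_once:
  assumes ab: "segment j a b" and min: "\<And>c d. segment j c d \<Longrightarrow> b - a \<le> d - c" and m: "a < m" "m < b"
  shows "\<not> same_edge j m a"
proof
  assume edge_eq: "same_edge j m a"
  have bounds: "a + 2 \<le> b" "b \<le> L" and nonconst: "\<And>i. a < i \<Longrightarrow> i < b \<Longrightarrow> \<not> const j i"
    using ab by (auto simp: segment_def)
  have no_shorter: "\<not> same j c d" if "a \<le> c" "c + 2 \<le> d" "d \<le> b" "d - c < b - a" for c d
  proof
    assume "same j c d"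
    then have "segment j c d" using that bounds nonconst by (auto simp: segment_def closed_at_def)
    then show False using min that(4) by (meson linorder_not_le)
  qed
  consider (parallel) "even m = even a" "same j a m"
    | (reverse) "same j (Suc a) m" "same j a (Suc m)" "even m \<noteq> even a"
    using same_edge_sym[OF edge_eq] by (auto simp: same_edge_def even_end_def odd_end_def split: if_splits)
  then show False
  proof cases
    case parallel
    have "m \<noteq> Suc a" using parallel(1) by auto
    moreover have "m - a < b - a" using m by linarith
    ultimately show False using no_shorter[of a m] parallel(2) m by auto
  next
    case reverse
    have "b = Suc m"
    proof (rule ccontr)
      assume "b \<noteq> Suc m"
      then have "Suc m - a < b - a" using m by linarith
      then show False using no_shorter[of a "Suc m"] reverse(2) m by simp
    qed
    moreover have "m \<noteq> Suc a" using reverse(2) not_same_add_2[of a j] bounds m by auto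
    moreover have "m \<noteq> Suc (Suc a)" using reverse(3) by auto
    moreover have "m - Suc a < b - a" using m by linarith
    ultimately show False using no_shorter[of "Suc a" m] reverse(1) m by auto
  qed
qed

text \<open>
  A shortest segment traverses its first edge only once, and if no coincidence is lost it closes up
  one level higher.
\<close>

lemma void_reps_grow:
  assumes "j < t" "void j" "reps j \<noteq> {}"
  shows "reps j \<subset> reps (Suc j)"
proof -
  have "reps j \<noteq> reps (Suc j)"
  proof
    assume reps_eq: "reps j = reps (Suc j)"
    obtain a0 b0 where "segment j a0 b0" using exists_segment assms by (meson less_imp_le)
    then obtain a b where ab: "segment j a b" and min: "\<And>c d. segment j c d \<Longrightarrow> b - a \<le> d - c"
      using ex_has_least_nat[of "\<lambda>(a, b). segment j a b" "(a0, b0)" "\<lambda>(a, b). b - a"] by auto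
    have bounds: "a + 2 \<le> b" "b \<le> L" "\<not> const j (Suc a)" and closed: "closed_at j a b"
      using ab by (auto simp: segment_def)
    have "{i \<in> {a..<b}. same_edge j i a} = {a}"
    proof
      show "{i \<in> {a..<b}. same_edge j i a} \<subseteq> {a}"
      proof
        fix i assume "i \<in> {i \<in> {a..<b}. same_edge j i a}"
        then show "i \<in> {a}"
          using shortest_segment_traverses_once[OF ab min, of i] by (cases "a = i") auto
      qed
      show "{a} \<subseteq> {i \<in> {a..<b}. same_edge j i a}" using bounds same_edge_refl by simp
    qed
    moreover have "closed_at (Suc j) a b"
      using closed const_Suc_if_reps_eq[OF reps_eq] same_Suc_if_reps_eq[OF reps_eq] const_cong bounds
      unfolding closed_at_def by (metis add_leD1 le_trans)
    ultimately have "single_edge j a b a" using bounds by (auto simp: single_edge_def)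
    then show False using assms(2) by (auto simp: void_def)
  qed
  then show ?thesis using reps_mono[of j "Suc j"] by auto
qed

lemma card_void_add_card_reps_le:
  assumes "reps 0 \<noteq> {}" "{j \<in> {..<t}. void j} \<noteq> {}"
  shows "card {j \<in> {..<t}. void j} + card (reps 0) \<le> L div 2 + 1"
proof -
  let ?Z = "{j \<in> {..<t}. void j}"
  have "card (reps i) < card (reps j)" if "i \<in> ?Z" "i < j" for i j
  proof -
    have "reps i \<noteq> {}" using reps_mono[of 0 i] assms(1) by auto
    then have "reps i \<subset> reps j" using void_reps_grow that reps_mono[of "Suc i" j] by auto
    then show ?thesis using finite_reps by (rule psubset_card_mono[rotated])
  qed
  then have inj: "inj_on (\<lambda>j. card (reps j)) ?Z"
    by (intro inj_onI) (metis linorder_neqE_nat less_irrefl)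
  have range: "card (reps j) \<in> {card (reps 0)..L div 2}" if "j \<in> ?Z" for j
    using void_card_reps_le[of j] card_mono[OF finite_reps reps_mono[of 0 j]] that by auto
  then have "card ?Z \<le> card {card (reps 0)..L div 2}" using inj by (intro card_inj_on_le) auto
  moreover have "card (reps 0) \<le> L div 2" using range assms(2) by force
  ultimately show ?thesis by simp
qed

end

section \<open>Uniform families of walks\<close>

definition const_on :: "('a \<Rightarrow> 'b) \<Rightarrow> 'a set \<Rightarrow> bool" where
  "const_on g A \<longleftrightarrow> (\<forall>x\<in>A. \<forall>y\<in>A. g x = g y)"

lemma const_onD: "const_on g A \<Longrightarrow> x \<in> A \<Longrightarrow> y \<in> A \<Longrightarrow> g x = g y"
  unfolding const_on_def by blast

lemma const_on_subset: "const_on g A \<Longrightarrow> B \<subseteq> A \<Longrightarrow> const_on g B"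
  by (auto simp: const_on_def)

locale uniform_walks = generic_tower +
  fixes S :: "'a walk set"
  assumes walks: "S \<subseteq> walk_space" and two_le_card_S: "2 \<le> card S"
    and const_start_coords: "const_on snd S"
    and const_start_label: "const_on (\<lambda>x. fst x 0) S"
    and const_end_vertex: "const_on (vertex_at f t L) S"
    and nonbacktracking: "x \<in> S \<Longrightarrow> i + 2 \<le> L \<Longrightarrow> fst x i \<noteq> fst x (i + 2)"
    and const_or_inj: "j \<le> t \<Longrightarrow> i \<le> L \<Longrightarrow> const_on (vertex_at f j i) S \<or> inj_on (vertex_at f j i) S"
    and const_coincidence: "j \<le> t \<Longrightarrow> i \<le> L \<Longrightarrow> i' \<le> L \<Longrightarrow>
        const_on (\<lambda>x. vertex_at f j i x = vertex_at f j i' x) S"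
begin

lemma finite_S: "finite S"
  using walks by (rule walk.finite_subset_space)

lemma obtain_two_walks:
  obtains x y where "x \<in> S" "y \<in> S" "x \<noteq> y"
  using two_le_card_S card_le_Suc0_iff_eq[OF finite_S] by (metis not_less_eq_eq numeral_2_eq_2)

definition const_at :: "nat \<Rightarrow> nat \<Rightarrow> bool" where
  "const_at j i \<longleftrightarrow> const_on (vertex_at f j i) S"

definition same_vertex :: "nat \<Rightarrow> nat \<Rightarrow> nat \<Rightarrow> bool" where
  "same_vertex j i i' \<longleftrightarrow> even i = even i' \<and> (\<forall>x\<in>S. vertex_at f j i x = vertex_at f j i' x)"

sublocale coincidence_pattern L t const_at same_vertex
proof
  show "const_at j 0" for j
    unfolding const_at_def const_on_def
  proof (intro ballI)
    fix x y assume "x \<in> S" "y \<in> S"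
    then have "snd x = snd y" "fst x 0 = fst y 0"
      using const_onD[OF const_start_coords] const_onD[OF const_start_label] by blast+
    then show "vertex_at f j 0 x = vertex_at f j 0 y" by (simp only: vertex_at_def lift_coords_start)
  qed
  show "const_at j L" if "j \<le> t" for j
    using vertex_at_eq_antimono[of f t L _ L _ j] that const_onD[OF const_end_vertex]
    unfolding const_at_def const_on_def by blast
  show "const_at j i" if "const_at (Suc j) i" for j i
    using vertex_at_eq_antimono[of f "Suc j" i _ i _ j] that
    unfolding const_at_def const_on_def by (metis le_SucI order_refl)
  show "same_vertex j i i'" if "same_vertex (Suc j) i i'" for j i i'
  proof -
    have "vertex_at f j i x = vertex_at f j i' x" if "x \<in> S" for x
      using vertex_at_eq_antimono[of f "Suc j" i x i' x j] that \<open>same_vertex (Suc j) i i'\<close>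
      unfolding same_vertex_def by simp
    then show ?thesis using that by (simp add: same_vertex_def)
  qed
  show "equivp (same_vertex j)" for j
    by (intro equivpI reflpI sympI transpI) (auto simp: same_vertex_def)
  show "const_at j i \<longleftrightarrow> const_at j i'" if "same_vertex j i i'" for j i i'
    using that by (auto simp: same_vertex_def const_at_def const_on_def)
  show "even i \<longleftrightarrow> even i'" if "same_vertex j i i'" for j i i'
    using that by (simp add: same_vertex_def)
  show "\<not> same_vertex j i (i + 2)" if "i + 2 \<le> L" for j i
  proof
    assume "same_vertex j i (i + 2)"
    moreover obtain x where "x \<in> S" using obtain_two_walks by blast
    ultimately show False
      using nonbacktracking[OF _ that, of x] by (simp add: same_vertex_def vertex_at_def)
  qed
qed

lemma same_edge_iff:
  assumes "j \<le> t" "m < L" "m' < L" "x \<in> S"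
  shows "same_edge j m m' \<longleftrightarrow> edge_at f j x m = edge_at f j x m'"
proof -
  have "same_vertex j i i' \<longleftrightarrow> vertex_at f j i x = vertex_at f j i' x"
    if "i \<le> L" "i' \<le> L" "even i = even i'" for i i'
    using const_coincidence[OF assms(1) that(1,2)] assms(4) that(3)
    unfolding same_vertex_def const_on_def by blast
  then show ?thesis
    using assms(2,3) by (simp add: same_edge_def edge_at_eq_iff even_end_def odd_end_def Suc_le_eq)
qed

lemma edge_at_neq:
  assumes "j \<le> t" "m < L" "\<not> (const_at j m \<and> const_at j (Suc m))" "x \<in> S" "y \<in> S" "x \<noteq> y"
  shows "edge_at f j x m \<noteq> edge_at f j y m"
proof -
  have "vertex_at f j i x \<noteq> vertex_at f j i y" if "\<not> const_at j i" "i \<le> L" for i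
    using const_or_inj[OF assms(1) that(2)] that(1) assms(4-6)
    by (auto simp: const_at_def dest: inj_onD)
  then show ?thesis using assms(2,3) by (auto simp: edge_at_eq_iff even_end_def odd_end_def)
qed

lemma segment_sum_const:
  assumes "a \<le> b" "closed_at (Suc j) a b"
  shows "const_on (segment_sum f j a b) S"
  unfolding const_on_def
proof (intro ballI)
  fix x y assume xy: "x \<in> S" "y \<in> S"
  show "segment_sum f j a b x = segment_sum f j a b y"
    using assms(2) unfolding closed_at_def
  proof
    assume "const_at (Suc j) a \<and> const_at (Suc j) b"
    then have "lift_coords f x (Suc j) i = lift_coords f y (Suc j) i" if "i \<in> {a, b}" for i
      using const_onD[of "vertex_at f (Suc j) i" S x y] xy that
      by (auto simp: const_at_def vertex_at_def)
    then show ?thesis unfolding segment_sum_eq_ends[OF assms(1)] by simp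
  next
    assume same: "same_vertex (Suc j) a b"
    then have "lift_coords f z (Suc j) a = lift_coords f z (Suc j) b" if "z \<in> S" for z
      using that by (auto simp: same_vertex_def vertex_at_def)
    moreover have "(-1::'a) ^ a = (-1) ^ b" using same by (auto simp: same_vertex_def uminus_power_if)
    ultimately show ?thesis using xy
      unfolding segment_sum_eq_ends[OF assms(1)] by (simp del: lift_coords.simps)
  qed
qed

lemma reps_0_nonempty: "reps 0 \<noteq> {}"
proof -
  obtain x y where xy: "x \<in> S" "y \<in> S" "x \<noteq> y" by (rule obtain_two_walks)
  have "fst x \<noteq> fst y"
    using const_onD[OF const_start_coords xy(1,2)] xy(3) by (auto simp: prod_eq_iff)
  then obtain i where i: "fst x i \<noteq> fst y i" by blast
  have "x \<in> walk_space" "y \<in> walk_space" using xy walks by auto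
  then have "i \<le> L" using i by (cases "i \<le> L") (auto simp: walk_space_def)
  moreover have "\<not> const_at 0 i" using i xy by (auto simp: const_at_def const_on_def vertex_at_def)
  ultimately show ?thesis using representative_in_reps by blast
qed

lemma label_dim_pos: "1 \<le> label_dim i"
proof -
  obtain x where x: "x \<in> S" using obtain_two_walks by blast
  have "label_dim i \<noteq> 0" if "i + 2 \<le> L" for i
  proof
    assume "label_dim i = 0"
    moreover have "x \<in> walk_space" using x walks by blast
    ultimately have "fst x i \<in> vecs 0" "fst x (i + 2) \<in> vecs 0"
      using that
      by (auto simp: walk_space_def label_dim_def split: if_splits dest: spec[of _ i] spec[of _ "i + 2"])
    then show False using nonbacktracking[OF x that] by (auto simp: vecs_def fun_eq_iff)
  qed
  from this[of 0] this[of 1] show ?thesis using three_le_L by (auto simp: label_dim_def)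
qed

definition free_dim :: nat where "free_dim = (\<Sum>i\<in>reps 0. label_dim i)"

lemma sum_label_dim: "(\<Sum>i\<in>{1..<L}. label_dim i) = t"
proof -
  have "(\<Sum>i\<in>{1..<2 * n + 1}. label_dim i) = n * (r + r')" for n
    by (induction n) (auto simp: label_dim_def)
  moreover have "L = 2 * (k - 1) + 1" using two_le_k unfolding L_def by linarith
  ultimately show ?thesis by (simp only: t_def)
qed

lemma free_dim_add_le: "free_dim + (L - 1 - card (reps 0)) \<le> t"
proof -
  have "L - 1 - card (reps 0) = (\<Sum>i\<in>{1..<L} - reps 0. 1)"
    using reps_subset_interior by (simp add: card_Diff_subset finite_reps)
  also have "\<dots> \<le> (\<Sum>i\<in>{1..<L} - reps 0. label_dim i)" by (intro sum_mono label_dim_pos)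
  finally have "free_dim + (L - 1 - card (reps 0))
      \<le> (\<Sum>i\<in>{1..<L} - reps 0. label_dim i) + (\<Sum>i\<in>reps 0. label_dim i)"
    by (simp add: free_dim_def)
  also have "\<dots> = t"
    using reps_subset_interior sum_label_dim by (metis finite_atLeastLessThan sum.subset_diff)
  finally show ?thesis .
qed

lemma free_dim_le: "free_dim \<le> t"
  using free_dim_add_le by simp

lemma free_dim_le_card_not_void: "free_dim \<le> card {j \<in> {..<t}. \<not> void j}"
proof -
  let ?Z = "{j \<in> {..<t}. void j}"
  have "card ?Z + free_dim \<le> t"
  proof (cases "?Z = {}")
    case True
    show ?thesis unfolding True using free_dim_le by simp
  next
    case False
    have "L div 2 + 1 = k" using two_le_k unfolding L_def by linarith
    then have "card ?Z + card (reps 0) \<le> k"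
      using card_void_add_card_reps_le[OF reps_0_nonempty False] by simp
    then show ?thesis using free_dim_add_le two_le_k by (simp add: L_def)
  qed
  moreover have "card ?Z + card {j \<in> {..<t}. \<not> void j} = t"
    using card_Un_disjoint[of ?Z "{j \<in> {..<t}. \<not> void j}"]
    by (simp add: disjoint_iff flip: Collect_disj_eq) (simp add: conj_disj_distribL[symmetric])
  ultimately show ?thesis by simp
qed

end

section \<open>Bounding the number of walks\<close>

lemma pigeonhole_cover:
  assumes "finite I" "card I \<le> m" "finite V" "V \<subseteq> (\<Union>i\<in>I. A i)" "V \<noteq> {}"
  shows "\<exists>i\<in>I. card V \<le> card (V \<inter> A i) * m"
proof (rule ccontr)
  assume "\<not> ?thesis"
  then have less: "card (V \<inter> A i) * m < card V" if "i \<in> I" for i using that by auto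
  have "I \<noteq> {}" using assms(4,5) by auto
  have "card V \<le> (\<Sum>i\<in>I. card (V \<inter> A i))"
    using card_UN_le[OF assms(1), of "\<lambda>i. V \<inter> A i"] assms(4) by (metis Int_UN_distrib inf.absorb1)
  then have "card V * m \<le> (\<Sum>i\<in>I. card (V \<inter> A i) * m)"
    by (simp add: sum_distrib_right[symmetric])
  also have "\<dots> < (\<Sum>i\<in>I. card V)" using less \<open>I \<noteq> {}\<close> assms(1) by (intro sum_strict_mono) auto
  also have "\<dots> \<le> card V * m" using assms(2) by (simp add: mult.commute)
  finally show False by simp
qed

lemma subset_const_on_or_inj_on:
  assumes "finite V" "m ^ 2 \<le> card V" "0 < m"
  shows "\<exists>S\<subseteq>V. m \<le> card S \<and> (const_on g S \<or> inj_on g S)"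
proof (cases "m \<le> card (g ` V)")
  case True
  obtain U where "U \<subseteq> V" "inj_on g U" "g ` V = g ` U" using subset_image_inj[of "g ` V" g V] by auto
  then show ?thesis using True card_image[of g U] by (intro exI[of _ U]) auto
next
  case False
  have "V \<noteq> {}" using assms by auto
  then obtain c where "card V \<le> card (V \<inter> g -` {c}) * m"
    using pigeonhole_cover[of "g ` V" m V "\<lambda>c. g -` {c}"] False assms(1) by auto
  then have "m * m \<le> card (V \<inter> g -` {c}) * m" using assms(2) unfolding power2_eq_square by linarith
  then have "m \<le> card (V \<inter> g -` {c})" using assms(3) by simp
  then show ?thesis by (intro exI[of _ "V \<inter> g -` {c}"]) (auto simp: const_on_def)
qed

lemma subset_all_const_on_or_inj_on:
  assumes "finite G" "finite V" "m ^ (2 ^ card G) \<le> card V" "0 < m"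
  shows "\<exists>S\<subseteq>V. m \<le> card S \<and> (\<forall>g\<in>G. const_on g S \<or> inj_on g S)"
  using assms
proof (induction G arbitrary: V rule: finite_induct)
  case (insert g G)
  have "(m ^ (2 ^ card G)) ^ 2 \<le> card V"
    using insert.prems insert.hyps by (simp add: power_mult[symmetric] mult.commute)
  then obtain S where S: "S \<subseteq> V" "m ^ (2 ^ card G) \<le> card S" "const_on g S \<or> inj_on g S"
    using subset_const_on_or_inj_on[OF insert.prems(1)] insert.prems(3) by (metis zero_less_power)
  have "finite S" using S(1) insert.prems(1) by (rule finite_subset)
  then obtain S' where S': "S' \<subseteq> S" "m \<le> card S'" "\<forall>g\<in>G. const_on g S' \<or> inj_on g S'"
    using insert.IH[OF _ S(2)] insert.prems(3) by blast
  have "const_on g S' \<or> inj_on g S'" using S(3) S'(1) const_on_subset inj_on_subset by metis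
  then show ?case using S(1) S' by (intro exI[of _ S']) auto
qed auto

lemma subset_predicates_const_on:
  fixes P :: "('a \<Rightarrow> bool) set"
  assumes "finite P" "finite V" "V \<noteq> {}" "m * 2 ^ card P \<le> card V"
  shows "\<exists>S\<subseteq>V. m \<le> card S \<and> (\<forall>p\<in>P. const_on p S)"
proof -
  define truth where "truth x = {p \<in> P. p x}" for x
  have "truth x \<in> Pow P" for x by (auto simp: truth_def)
  then have "V \<subseteq> (\<Union>T\<in>Pow P. truth -` {T})" by (intro subsetI UN_I) auto
  then have "\<exists>T\<in>Pow P. card V \<le> card (V \<inter> truth -` {T}) * 2 ^ card P"
    using assms(1-3) by (intro pigeonhole_cover) (simp_all add: card_Pow)
  then obtain T where "card V \<le> card (V \<inter> truth -` {T}) * 2 ^ card P" by blast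
  then have "m * 2 ^ card P \<le> card (V \<inter> truth -` {T}) * 2 ^ card P"
    using assms(4) by (rule le_trans[rotated])
  then have "m \<le> card (V \<inter> truth -` {T})" by simp
  moreover have "const_on p (V \<inter> truth -` {T})" if "p \<in> P" for p
    unfolding const_on_def
  proof (intro ballI)
    fix x y assume "x \<in> V \<inter> truth -` {T}" "y \<in> V \<inter> truth -` {T}"
    then have "truth x = truth y" by simp
    then show "p x = p y" using that by (auto simp: truth_def)
  qed
  ultimately show ?thesis by blast
qed

context tower begin

lemma piece_in_strata: "A \<in> pieces f j B \<Longrightarrow> B \<in> strata f j \<Longrightarrow> A \<in> strata f (Suc j)"
  by auto

lemma cut_in_strata:
  assumes "A \<in> pieces f j B" "B \<in> strata f j" "a \<le> L" "b \<le> L" "w \<in> K"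
  shows "{x \<in> A. segment_sum f j a b x = w} \<in> strata f (Suc j)"
proof -
  have "(a, b, w) \<in> {..L} \<times> {..L} \<times> K" using assms(3-5) by simp
  then show ?thesis unfolding strata.simps using assms(1,2) by blast
qed

lemma initial_stratum_coord:
  assumes x0: "x0 \<in> walk_space" and \<rho>: "\<And>i. i \<le> L \<Longrightarrow> i \<notin> I \<Longrightarrow> \<rho> i \<in> J \<and> label_dim (\<rho> i) = label_dim i"
    and g: "g \<in> walk_coords"
  shows "(\<exists>c\<in>K. \<forall>x\<in>initial_stratum I \<rho> x0. g x = c) \<or>
    (\<exists>i\<in>J. \<exists>c<label_dim i. \<forall>x\<in>initial_stratum I \<rho> x0. g x = fst x i c)"
  using g
proof (cases rule: walk_coordsE)
  case (label i c)
  show ?thesis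
  proof (cases "i \<in> I")
    case True
    have "fst x0 i c \<in> K" using x0 label by (auto simp: walk_space_def vecs_def)
    moreover have "\<forall>x\<in>initial_stratum I \<rho> x0. g x = fst x0 i c"
      using True label by (auto simp: initial_stratum_def)
    ultimately show ?thesis by blast
  next
    case False
    have "\<forall>x\<in>initial_stratum I \<rho> x0. g x = fst x (\<rho> i) c"
      using label(1) unfolding label(3) initial_stratum_def by simp
    then show ?thesis using \<rho>[OF label(1) False] label(2) by metis
  qed
next
  case (start c)
  have "snd x0 c \<in> K" using x0 start by (auto simp: walk_space_def vecs_def)
  moreover have "\<forall>x\<in>initial_stratum I \<rho> x0. g x = snd x0 c"
    using start by (auto simp: initial_stratum_def)
  ultimately show ?thesis by blast
qed

lemma hilb_initial_stratum_le:
  assumes x0: "x0 \<in> walk_space" and J: "J \<subseteq> {..L}"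
    and \<rho>: "\<And>i. i \<le> L \<Longrightarrow> i \<notin> I \<Longrightarrow> \<rho> i \<in> J \<and> label_dim (\<rho> i) = label_dim i"
  shows "walk.hilb (initial_stratum I \<rho> x0) d \<le> q ^ ((d + 1) ^ (\<Sum>i\<in>J. label_dim i))"
proof -
  let ?S = "initial_stratum I \<rho> x0" and ?J = "Sigma J (\<lambda>i. {..<label_dim i})"
  define \<Delta> :: "('a walk \<Rightarrow> 'a) set" where "\<Delta> = (\<lambda>(i, c) x. fst x i c) ` ?J"
  have finite_J: "finite J" using J finite_subset by blast
  have mem: "(\<lambda>x. fst x i c) \<in> \<Delta>" if "i \<in> J" "c < label_dim i" for i c
    unfolding \<Delta>_def using that by (intro image_eqI[of _ _ "(i, c)"]) simp_all
  have "walk.hilb ?S d \<le> q ^ ((d + 1) ^ card \<Delta>)"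
  proof (rule walk.hilb_le)
    show "?S \<subseteq> walk_space" by (auto simp: initial_stratum_def)
    show "\<Delta> \<subseteq> walk_coords" using J by (auto simp: \<Delta>_def intro!: label_coord_mem)
    show "(\<exists>c\<in>K. \<forall>x\<in>?S. g x = c) \<or> (\<exists>h\<in>\<Delta>. \<forall>x\<in>?S. g x = h x)" if "g \<in> walk_coords" for g
    proof -
      have "(\<exists>c\<in>K. \<forall>x\<in>?S. g x = c) \<or> (\<exists>i\<in>J. \<exists>c<label_dim i. \<forall>x\<in>?S. g x = fst x i c)"
        using x0 \<rho> that by (rule initial_stratum_coord)
      then show ?thesis
      proof (elim disjE bexE exE conjE)
        fix i c assume "i \<in> J" "c < label_dim i" "\<forall>x\<in>?S. g x = fst x i c"
        then show ?thesis using mem by (intro disjI2 bexI[of _ "\<lambda>x. fst x i c"]) simp_all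
      qed (intro disjI1 bexI)
    qed
  qed
  also have "card \<Delta> \<le> (\<Sum>i\<in>J. label_dim i)"
    unfolding \<Delta>_def using card_image_le[of ?J "\<lambda>(i, c) x. fst x i c"] finite_J by simp
  then have "q ^ ((d + 1) ^ card \<Delta>) \<le> q ^ ((d + 1) ^ (\<Sum>i\<in>J. label_dim i))"
    using two_le_card by (intro power_increasing) auto
  finally show ?thesis .
qed

end

context uniform_walks begin

abbreviation codim_at_least :: "nat \<Rightarrow> 'a walk set \<Rightarrow> 'a walk set \<Rightarrow> bool" where
  "codim_at_least \<equiv> walk.codim_ge irreducibility_degree closing_degree point_bound"

lemma obtain_initial_stratum:
  obtains S0 where "S0 \<in> strata f 0" "S \<subseteq> S0" "\<And>d. walk.hilb S0 d \<le> q ^ ((d + 1) ^ free_dim)"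
proof -
  obtain x0 where x0: "x0 \<in> S" using obtain_two_walks by blast
  define I where "I = {i \<in> {..L}. const_at 0 i}"
  define \<rho> where "\<rho> = restrict (representative 0) {..L}"
  have same: "same_vertex 0 (\<rho> i) i" if "i \<le> L" for i
    using same_representative that by (simp add: \<rho>_def)
  show thesis
  proof (rule that)
    have "representative 0 i \<le> L" if "i \<le> L" for i using representative_le that by (rule le_trans)
    then have "\<rho> \<in> {..L} \<rightarrow>\<^sub>E {..L}" by (simp add: \<rho>_def)
    moreover have "I \<in> Pow {..L}" by (auto simp: I_def)
    ultimately show "initial_stratum I \<rho> x0 \<in> strata f 0"
      unfolding strata.simps using x0 walks by (intro image_eqI[of _ _ "(I, \<rho>, x0)"]) auto
    show "S \<subseteq> initial_stratum I \<rho> x0"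
    proof
      fix x assume x: "x \<in> S"
      have "snd x = snd x0" using const_onD[OF const_start_coords x x0] .
      moreover have "fst x i = fst x0 i" if "i \<in> I" for i
      proof -
        have "vertex_at f 0 i x = vertex_at f 0 i x0"
          using that x x0 unfolding I_def const_at_def const_on_def by blast
        then show ?thesis by (simp add: vertex_at_def)
      qed
      moreover have "fst x i = fst x (\<rho> i)" if "i \<le> L" for i
        using same[OF that] x by (simp add: same_vertex_def vertex_at_def)
      ultimately show "x \<in> initial_stratum I \<rho> x0" using x walks by (auto simp: initial_stratum_def)
    qed
    show "walk.hilb (initial_stratum I \<rho> x0) d \<le> q ^ ((d + 1) ^ free_dim)" for d
      unfolding free_dim_def
    proof (rule hilb_initial_stratum_le)
      show "x0 \<in> walk_space" "reps 0 \<subseteq> {..L}" using x0 walks by (auto simp: reps_def)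
      show "\<rho> i \<in> reps 0 \<and> label_dim (\<rho> i) = label_dim i" if "i \<le> L" "i \<notin> I" for i
        using that representative_in_reps[of i 0] same_parity[OF same[OF that(1)]]
        by (auto simp: \<rho>_def I_def label_dim_def)
    qed
  qed
qed

lemma uncancelled_if_single_edge:
  assumes A: "A \<in> pieces f j B" and B: "B \<in> strata f j" and "j < t" and single: "single_edge j a b m"
    and xy: "x \<in> S" "y \<in> S" "x \<in> A" "y \<in> A" "x \<noteq> y"
  shows "uncancelled f j a b m A"
proof -
  have m: "a \<le> m" "m < b" "b \<le> L" "\<not> (const_at j m \<and> const_at j (Suc m))"
    "{i \<in> {a..<b}. same_edge j i m} = {m}"
    using single by (auto simp: single_edge_def)
  have "edge_coeff f j a b m z \<noteq> 0" if "z \<in> A" for z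
  proof -
    have "edge_at f j z i = edge_at f j z m \<longleftrightarrow> same_edge j i m" if "i \<in> {a..<b}" for i
    proof -
      have "(i, m) \<in> edge_coincidences f j z \<longleftrightarrow> (i, m) \<in> edge_coincidences f j x"
        using piece(3)[OF A stratum_subset[OF B] \<open>z \<in> A\<close> xy(3)] by simp
      then show ?thesis
        using that m(2,3) same_edge_iff[of j i m x] \<open>j < t\<close> xy(1) by (simp add: edge_coincidences_def)
    qed
    then have "{i \<in> {a..<b}. edge_at f j z i = edge_at f j z m} = {m}" using m(5) by blast
    then show ?thesis using sign_unit_nonzero by (simp add: edge_coeff_def)
  qed
  moreover have "edge_at f j x m \<noteq> edge_at f j y m"
    using edge_at_neq[of j m x y] m \<open>j < t\<close> xy by auto
  ultimately show ?thesis using m(1-3) xy(3,4) by (auto simp: uncancelled_def)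
qed

lemma exists_cut_stratum:
  assumes A: "A \<in> pieces f j B" and B: "B \<in> strata f j" and "j < t" "\<not> void j"
    and xy: "x \<in> S" "y \<in> S" "x \<in> A" "y \<in> A" "x \<noteq> y" and codim: "codim_at_least i S0 A"
  shows "\<exists>C\<in>strata f (Suc j). S \<inter> A \<subseteq> C \<and> codim_at_least (Suc i) S0 C"
proof -
  obtain a b m where single: "single_edge j a b m" using \<open>\<not> void j\<close> by (auto simp: void_def)
  have ab: "a \<le> b" "b \<le> L" and closed: "closed_at (Suc j) a b"
    using single by (auto simp: single_edge_def)
  define w where "w = segment_sum f j a b x"
  have w: "segment_sum f j a b z = w" if "z \<in> S" for z
    using const_onD[OF segment_sum_const[OF ab(1) closed] that xy(1)] by (simp add: w_def)
  have poly: "polyfun walk_coords closing_degree (segment_sum f j a b)"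
    using polyfun_segment_sum[OF \<open>j < t\<close> ab(2)] .
  have "x \<in> walk_space" using xy(1) walks by blast
  then have "w \<in> K" unfolding w_def by (rule walk.polyfun_mem[OF poly])
  have "\<exists>z\<in>A. segment_sum f j a b z \<noteq> w"
    using generic_f[OF \<open>j < t\<close>] A B \<open>w \<in> K\<close> uncancelled_if_single_edge[OF A B \<open>j < t\<close> single xy]
    unfolding generic_def by blast
  then have nonzero: "\<exists>z\<in>A. segment_sum f j a b z - w \<noteq> 0" by simp
  let ?C = "{z \<in> A. segment_sum f j a b z - w = 0}"
  have "?C = {z \<in> A. segment_sum f j a b z = w}" by simp
  moreover have "{z \<in> A. segment_sum f j a b z = w} \<in> strata f (Suc j)"
    using cut_in_strata[OF A B, of a b] ab \<open>w \<in> K\<close> by simp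
  moreover have "codim_at_least (Suc i) S0 ?C"
    using codim piece(2)[OF A stratum_subset[OF B]] piece_subset[OF A B]
      polyfun_diff[OF poly polyfun_const[OF \<open>w \<in> K\<close>]] nonzero by (rule walk.codim_ge_cut)
  moreover have "S \<inter> A \<subseteq> {z \<in> A. segment_sum f j a b z = w}" using w by blast
  ultimately show ?thesis by (intro bexI[of _ ?C]) (simp_all only:)
qed

lemma obtain_large_piece:
  assumes B: "B \<in> strata f j" and S': "S' \<subseteq> S" "S' \<subseteq> B" "2 * max_pieces \<le> card S'"
  obtains A x y where "A \<in> pieces f j B" "card S' \<le> card (S' \<inter> A) * max_pieces"
    "x \<in> S' \<inter> A" "y \<in> S' \<inter> A" "x \<noteq> y"
proof -
  have fin: "finite S'" using S'(1) finite_S by (rule finite_subset)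
  have "S' \<noteq> {}" using S'(3) one_le_max_pieces by auto
  moreover have "S' \<subseteq> (\<Union>A\<in>pieces f j B. A)" using S'(2) Union_pieces[OF stratum_subset[OF B]] by simp
  ultimately obtain A where A: "A \<in> pieces f j B" "card S' \<le> card (S' \<inter> A) * max_pieces"
    using pigeonhole_cover[OF finite_pieces[OF stratum_subset[OF B]]
      card_pieces_le[OF stratum_subset[OF B]] fin]
    by blast
  have "2 * max_pieces \<le> card (S' \<inter> A) * max_pieces" using S'(3) A(2) by (rule le_trans)
  then have "2 \<le> card (S' \<inter> A)" using one_le_max_pieces by simp
  then obtain x y where "x \<in> S' \<inter> A" "y \<in> S' \<inter> A" "x \<noteq> y"
    using card_le_Suc0_iff_eq[of "S' \<inter> A"] fin by (metis finite_Int not_less_eq_eq numeral_2_eq_2)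
  then show thesis using that A by blast
qed

lemma exists_next_stratum:
  assumes B: "B \<in> strata f j" and S': "S' \<subseteq> S" "S' \<subseteq> B" "2 * max_pieces \<le> card S'"
    and "j < t" and J: "J \<subseteq> {j. \<not> void j}" and codim: "codim_at_least (card (J \<inter> {..<j})) S0 B"
  shows "\<exists>C S''. C \<in> strata f (Suc j) \<and> S'' \<subseteq> S' \<and> S'' \<subseteq> C \<and> card S' \<le> card S'' * max_pieces \<and>
    codim_at_least (card (J \<inter> {..<Suc j})) S0 C"
proof -
  obtain A x y where A: "A \<in> pieces f j B" and card: "card S' \<le> card (S' \<inter> A) * max_pieces"
    and xy: "x \<in> S' \<inter> A" "y \<in> S' \<inter> A" "x \<noteq> y" using B S' by (rule obtain_large_piece)
  have codim_A: "codim_at_least (card (J \<inter> {..<j})) S0 A"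
    using codim piece(1)[OF A stratum_subset[OF B]] stratum_subset[OF B]
    by (rule walk.codim_ge_subset)
  have "\<exists>C\<in>strata f (Suc j). S' \<inter> A \<subseteq> C \<and> codim_at_least (card (J \<inter> {..<Suc j})) S0 C"
  proof (cases "j \<in> J")
    case True
    then have "J \<inter> {..<Suc j} = insert j (J \<inter> {..<j})" by auto
    then have "card (J \<inter> {..<Suc j}) = Suc (card (J \<inter> {..<j}))" by simp
    moreover obtain C where "C \<in> strata f (Suc j)" "S \<inter> A \<subseteq> C"
      "codim_at_least (Suc (card (J \<inter> {..<j}))) S0 C"
      using exists_cut_stratum[OF A B \<open>j < t\<close> _ _ _ _ _ xy(3) codim_A] True J xy(1,2) S'(1) by blast
    moreover from this have "S' \<inter> A \<subseteq> C" using S'(1) by blast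
    ultimately show ?thesis by (intro bexI[of _ C]) (simp_all del: strata.simps)
  next
    case False
    then have "J \<inter> {..<Suc j} = J \<inter> {..<j}" by (auto simp: less_Suc_eq)
    moreover have "A \<in> strata f (Suc j)" using A B by (rule piece_in_strata)
    ultimately show ?thesis using codim_A by (intro bexI[of _ A]) simp_all
  qed
  then show ?thesis using card by blast
qed

lemma exists_stratum_of_codim:
  assumes S0: "S0 \<in> strata f 0" "S \<subseteq> S0" and big: "point_bound * max_pieces ^ t \<le> card S"
    and J: "J \<subseteq> {j. \<not> void j}" and "j \<le> t"
  shows "\<exists>B S'. B \<in> strata f j \<and> S' \<subseteq> S \<and> S' \<subseteq> B \<and> card S \<le> card S' * max_pieces ^ j \<and>
    codim_at_least (card (J \<inter> {..<j})) S0 B"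
  using \<open>j \<le> t\<close>
proof (induction j)
  case 0
  then show ?case using S0 walk.codim_ge_refl by (intro exI[of _ S0] exI[of _ S]) simp
next
  case (Suc j)
  then obtain B S' where B: "B \<in> strata f j" and S': "S' \<subseteq> S" "S' \<subseteq> B" "card S \<le> card S' * max_pieces ^ j"
    and codim: "codim_at_least (card (J \<inter> {..<j})) S0 B" by auto
  have "(point_bound * max_pieces) * max_pieces ^ j = point_bound * max_pieces ^ Suc j" by simp
  also have "\<dots> \<le> point_bound * max_pieces ^ t"
    using Suc.prems one_le_max_pieces by (intro mult_le_mono2 power_increasing) auto
  also have "\<dots> \<le> card S' * max_pieces ^ j" using big S'(3) by (rule le_trans)
  finally have "point_bound * max_pieces \<le> card S'" using one_le_max_pieces by simp
  moreover have "2 \<le> point_bound" by (simp add: point_bound_def)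
  ultimately have "2 * max_pieces \<le> card S'" using mult_le_mono1 le_trans by blast
  then obtain C S'' where C: "C \<in> strata f (Suc j)" "S'' \<subseteq> S'" "S'' \<subseteq> C" "card S' \<le> card S'' * max_pieces"
    "codim_at_least (card (J \<inter> {..<Suc j})) S0 C"
    using exists_next_stratum[OF B S'(1,2) _ _ J codim] Suc.prems by (auto simp del: strata.simps)
  have "card S \<le> (card S'' * max_pieces) * max_pieces ^ j"
    using S'(3) C(4) by (meson le_trans mult_le_mono1)
  then have "card S \<le> card S'' * max_pieces ^ Suc j" by (simp add: mult.assoc)
  then show ?case using C S'(1) by blast
qed

lemma card_uniform_less: "card S < point_bound * max_pieces ^ t"
proof (rule ccontr)
  assume "\<not> card S < point_bound * max_pieces ^ t"
  then have big: "point_bound * max_pieces ^ t \<le> card S" by simp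
  obtain S0 where S0: "S0 \<in> strata f 0" "S \<subseteq> S0" "\<And>d. walk.hilb S0 d \<le> q ^ ((d + 1) ^ free_dim)"
    using obtain_initial_stratum by blast
  obtain J where J: "J \<subseteq> {j \<in> {..<t}. \<not> void j}" "card J = free_dim"
    using obtain_subset_with_card_n[OF free_dim_le_card_not_void] by metis
  then have "J \<inter> {..<t} = J" by auto
  then obtain B S' where B: "B \<in> strata f t" and S': "S' \<subseteq> B" "card S \<le> card S' * max_pieces ^ t"
    and codim: "codim_at_least free_dim S0 B"
    using exists_stratum_of_codim[OF S0(1,2) big _ order.refl, of J] J by auto
  have "(free_dim * closing_degree + 2) ^ free_dim \<le> (t * closing_degree + 2) ^ free_dim"
    using free_dim_le by (intro power_mono) auto
  also have "\<dots> \<le> (t * closing_degree + 2) ^ t" using free_dim_le by (intro power_increasing) auto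
  finally have "(free_dim * closing_degree + 2) ^ free_dim < point_bound"
    by (simp add: point_bound_def)
  moreover have "point_bound * (free_dim * closing_degree + 1) \<le> irreducibility_degree"
    unfolding irreducibility_degree_def
    by (rule trans_le_add1, rule mult_le_mono2) (simp add: free_dim_le)
  ultimately have "card B < point_bound"
    using codim stratum_subset[OF B] S0(3) by (intro walk.card_less_if_codim_ge_dim)
  moreover have "point_bound * max_pieces ^ t \<le> card S' * max_pieces ^ t"
    using big S'(2) by (rule le_trans)
  then have "point_bound \<le> card S'" using one_le_max_pieces by simp
  moreover have "card S' \<le> card B"
    using S'(1) walk.finite_subset_space[OF stratum_subset[OF B]] by (rule card_mono[rotated])
  ultimately show False by simp
qed

end

context tower begin

definition max_uniform :: nat where "max_uniform = point_bound * max_pieces ^ t"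

definition max_walks :: nat where
  "max_walks = (max_uniform * 2 ^ ((t + 1) * ((L + 1) * (L + 1)))) ^ (2 ^ ((t + 1) * (L + 1)))"

lemma two_le_max_uniform: "2 \<le> max_uniform"
  using one_le_max_pieces mult_le_mono[of 2 point_bound 1 "max_pieces ^ t"]
  by (simp add: max_uniform_def point_bound_def)

end

context generic_tower begin

lemma uniform_subset:
  assumes "finite V" "max_walks \<le> card V"
  obtains S where "S \<subseteq> V" "max_uniform \<le> card S"
    "\<And>j i. j \<le> t \<Longrightarrow> i \<le> L \<Longrightarrow> const_on (vertex_at f j i) S \<or> inj_on (vertex_at f j i) S"
    "\<And>j i i'. j \<le> t \<Longrightarrow> i \<le> L \<Longrightarrow> i' \<le> L \<Longrightarrow> const_on (\<lambda>x. vertex_at f j i x = vertex_at f j i' x) S"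
proof -
  let ?I = "{..t} \<times> {..L}" and ?J = "{..t} \<times> {..L} \<times> {..L}"
  define G where "G = (\<lambda>(j, i). vertex_at f j i) ` ?I"
  define P where "P = (\<lambda>(j, i, i') x. vertex_at f j i x = vertex_at f j i' x) ` ?J"
  have fin: "finite G" "finite P" by (simp_all add: G_def P_def)
  have "card G \<le> card ?I" "card P \<le> card ?J" unfolding G_def P_def by (rule card_image_le; simp)+
  then have card: "card G \<le> (t + 1) * (L + 1)" "card P \<le> (t + 1) * ((L + 1) * (L + 1))"
    by (simp_all add: card_cartesian_product)
  let ?m = "max_uniform * 2 ^ card P"
  have pos: "0 < ?m" using two_le_max_uniform by simp
  have "?m ^ (2 ^ card G) \<le> ?m ^ (2 ^ ((t + 1) * (L + 1)))"
    using card(1) pos by (intro power_increasing) auto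
  also have "\<dots> \<le> max_walks"
    unfolding max_walks_def using card(2) by (intro power_mono mult_le_mono2 power_increasing) auto
  finally have "?m ^ (2 ^ card G) \<le> card V" using assms(2) by (rule le_trans)
  then obtain S1 where S1: "S1 \<subseteq> V" "?m \<le> card S1" "\<forall>g\<in>G. const_on g S1 \<or> inj_on g S1"
    using subset_all_const_on_or_inj_on[OF fin(1) assms(1) _ pos] by blast
  then have "S1 \<noteq> {}" using pos by auto
  then obtain S where S: "S \<subseteq> S1" "max_uniform \<le> card S" "\<forall>p\<in>P. const_on p S"
    using subset_predicates_const_on[OF fin(2) finite_subset[OF S1(1) assms(1)] _ S1(2)] by blast
  show thesis
  proof (rule that[of S])
    show "S \<subseteq> V" "max_uniform \<le> card S" using S S1 by auto
    fix i j assume ij: "j \<le> t" "i \<le> L"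
    then have "vertex_at f j i \<in> G" by (auto simp: G_def)
    then show "const_on (vertex_at f j i) S \<or> inj_on (vertex_at f j i) S"
      using S1(3) S(1) const_on_subset inj_on_subset by blast
    fix i' assume "i' \<le> L"
    then have "(\<lambda>x. vertex_at f j i x = vertex_at f j i' x) \<in> P"
      unfolding P_def using ij by (intro image_eqI[of _ _ "(j, i, i')"]) auto
    then show "const_on (\<lambda>x. vertex_at f j i x = vertex_at f j i' x) S" using S(3) by blast
  qed
qed

theorem card_walks_less:
  assumes "V \<subseteq> walk_space" "const_on snd V" "const_on (\<lambda>x. fst x 0) V" "const_on (vertex_at f t L) V"
    and nonback: "\<And>x i. x \<in> V \<Longrightarrow> i + 2 \<le> L \<Longrightarrow> fst x i \<noteq> fst x (i + 2)"
  shows "card V < max_walks"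
proof (rule ccontr)
  assume "\<not> card V < max_walks"
  then have big: "max_walks \<le> card V" by simp
  obtain S where S: "S \<subseteq> V" "max_uniform \<le> card S"
    "\<And>j i. j \<le> t \<Longrightarrow> i \<le> L \<Longrightarrow> const_on (vertex_at f j i) S \<or> inj_on (vertex_at f j i) S"
    "\<And>j i i'. j \<le> t \<Longrightarrow> i \<le> L \<Longrightarrow> i' \<le> L \<Longrightarrow> const_on (\<lambda>x. vertex_at f j i x = vertex_at f j i' x) S"
    by (rule uniform_subset[OF walk.finite_subset_space[OF assms(1)] big]) blast
  interpret uniform_walks K e k r r' f S
  proof unfold_locales
    show "2 \<le> card S" using two_le_max_uniform S(2) by (rule le_trans)
    show "const_on snd S" "const_on (\<lambda>x. fst x 0) S" "const_on (vertex_at f t L) S"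
      using assms(2-4) S(1) const_on_subset by blast+
  qed (use S assms(1) nonback in auto)
  show False using card_uniform_less S(2) by (simp add: max_uniform_def)
qed

end

section \<open>Graphs\<close>

definition map_graph :: "('v \<Rightarrow> 'w) \<Rightarrow> 'v ugraph \<Rightarrow> 'w ugraph" where
  "map_graph h G = (h ` verts G, (`) h ` edges G)"

lemma bipartite_with_parts_map_graph:
  assumes "bipartite_with_parts G M N" and h: "inj_on h (verts G)"
  shows "bipartite_with_parts (map_graph h G) (h ` M) (h ` N)"
  unfolding bipartite_with_parts_def finite_simple_graph_def
proof (intro conjI ballI)
  have verts: "finite (verts G)" "verts G = M \<union> N" "M \<inter> N = {}"
    and edge: "\<And>d. d \<in> edges G \<Longrightarrow> d \<subseteq> verts G \<and> card d = 2 \<and> (\<exists>x\<in>M. \<exists>y\<in>N. d = {x, y})"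
    using assms(1) by (auto simp: bipartite_with_parts_def finite_simple_graph_def)
  show "finite (verts (map_graph h G))" using verts by (simp add: map_graph_def)
  show "verts (map_graph h G) = h ` M \<union> h ` N" using verts by (auto simp: map_graph_def)
  show "h ` M \<inter> h ` N = {}" using inj_on_image_Int[OF h, of M N] verts by auto
  fix d assume "d \<in> edges (map_graph h G)"
  then obtain d0 where d0: "d0 \<in> edges G" "d = h ` d0" by (auto simp: map_graph_def)
  show "d \<subseteq> verts (map_graph h G)" using edge[OF d0(1)] d0(2) by (auto simp: map_graph_def)
  show "card d = 2" using edge[OF d0(1)] d0(2) h by (metis card_image inj_on_subset)
  show "\<exists>x\<in>h ` M. \<exists>y\<in>h ` N. d = {x, y}" using edge[OF d0(1)] d0(2) by auto
qed

lemma card_edges_map_graph: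
  assumes "finite_simple_graph G" "inj_on h (verts G)"
  shows "card (edges (map_graph h G)) = card (edges G)"
proof -
  have "inj_on ((`) h) (edges G)"
    using inj_on_image_Pow[OF assms(2)]
    by (rule inj_on_subset) (use assms(1) in \<open>auto simp: finite_simple_graph_def\<close>)
  then show ?thesis by (simp add: map_graph_def card_image)
qed

lemma free_of_map_graph:
  assumes G: "finite_simple_graph G" and h: "inj_on h (verts G)" and free: "free_of G H"
  shows "free_of (map_graph h G) H"
  unfolding free_of_def
proof
  assume "contains_copy (map_graph h G) H"
  then obtain \<phi> where \<phi>: "inj_on \<phi> (verts H)" "\<phi> ` verts H \<subseteq> h ` verts G"
    "\<forall>d\<in>edges H. \<phi> ` d \<in> (`) h ` edges G"
    by (auto simp: contains_copy_def map_graph_def)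
  let ?g = "inv_into (verts G) h"
  have "inj_on (?g \<circ> \<phi>) (verts H)" using \<phi>(1,2) by (intro comp_inj_on inj_on_inv_into)
  moreover have "(?g \<circ> \<phi>) ` verts H \<subseteq> verts G"
    using \<phi>(2) by (auto simp: image_subset_iff intro!: inv_into_into)
  moreover have "(?g \<circ> \<phi>) ` d \<in> edges G" if "d \<in> edges H" for d
  proof -
    obtain d0 where d0: "d0 \<in> edges G" "\<phi> ` d = h ` d0" using \<phi>(3) \<open>d \<in> edges H\<close> by auto
    have "?g ` (h ` d0) = d0"
      using G d0(1) h by (intro inv_into_image_cancel) (auto simp: finite_simple_graph_def)
    then show ?thesis using d0 by (simp only: image_comp[symmetric])
  qed
  ultimately have "contains_copy G H" unfolding contains_copy_def by blast
  then show False using free by (simp add: free_of_def)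
qed

lemma contains_theta_graphE:
  assumes "contains_copy G (theta_graph s n)"
  obtains w where "\<And>i j. i < s \<Longrightarrow> j \<le> n \<Longrightarrow> w i j \<in> verts G"
    and "\<And>i j. i < s \<Longrightarrow> j < n \<Longrightarrow> {w i j, w i (Suc j)} \<in> edges G"
    and "\<And>i i'. w i 0 = w i' 0" and "\<And>i i'. w i n = w i' n"
    and "\<And>i j j'. i < s \<Longrightarrow> j \<le> n \<Longrightarrow> j' \<le> n \<Longrightarrow> w i j = w i j' \<Longrightarrow> j = j'"
    and "\<And>i i' j. i < s \<Longrightarrow> i' < s \<Longrightarrow> 0 < j \<Longrightarrow> j < n \<Longrightarrow> w i j = w i' j \<Longrightarrow> i = i'"
proof -
  obtain \<phi> where \<phi>: "inj_on \<phi> (verts (theta_graph s n))" "\<phi> ` verts (theta_graph s n) \<subseteq> verts G"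
    "\<forall>d\<in>edges (theta_graph s n). \<phi> ` d \<in> edges G" using assms by (auto simp: contains_copy_def)
  define w where "w i j = \<phi> (theta_vertex n i j)" for i j
  have vert: "theta_vertex n i j \<in> verts (theta_graph s n)" if "i < s" "j \<le> n" for i j
    using that by (auto simp: theta_graph_def)
  have w_eq: "theta_vertex n i j = theta_vertex n i' j'"
    if "w i j = w i' j'" "i < s" "j \<le> n" "i' < s" "j' \<le> n" for i j i' j'
    using inj_onD[OF \<phi>(1) that(1)[unfolded w_def] vert vert] that(2-) .
  show thesis
  proof (rule that)
    show "w i j \<in> verts G" if "i < s" "j \<le> n" for i j using \<phi>(2) vert[OF that] by (auto simp: w_def)
    show "{w i j, w i (Suc j)} \<in> edges G" if "i < s" "j < n" for i j
    proof -
      have "{theta_vertex n i j, theta_vertex n i (Suc j)} \<in> edges (theta_graph s n)"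
        using that by (auto simp: theta_graph_def)
      then show ?thesis using \<phi>(3) by (auto simp: w_def)
    qed
    show "w i 0 = w i' 0" "w i n = w i' n" for i i' by (simp_all add: w_def theta_vertex_def)
    show "j = j'" if "i < s" "j \<le> n" "j' \<le> n" "w i j = w i j'" for i j j'
      using w_eq[OF that(4,1,2,1,3)] by (auto simp: theta_vertex_def split: if_splits)
    show "i = i'" if "i < s" "i' < s" "0 < j" "j < n" "w i j = w i' j" for i i' j
      using w_eq[OF that(5,1) _ that(2)] that(3,4) by (auto simp: theta_vertex_def)
  qed
qed

section \<open>The graph of the tower\<close>

definition trunc :: "nat \<Rightarrow> 'a::zero coords \<Rightarrow> 'a coords" where
  "trunc j u = (\<lambda>c. if c < j then u c else 0)"

lemma trunc_0: "trunc 0 u = (\<lambda>_. 0)"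
  by (simp add: trunc_def)

lemma trunc_Suc: "trunc (Suc j) u = (trunc j u)(j := u j)"
  by (auto simp: trunc_def fun_eq_iff less_Suc_eq)

context finite_subfield begin

lemma vecs_mono: "m \<le> n \<Longrightarrow> vecs m \<subseteq> vecs n"
  unfolding vecs_def using zero_mem by (auto intro: le_trans) (metis linorder_not_le)

lemma trunc_vecs: "u \<in> vecs n \<Longrightarrow> trunc n u = u"
  by (auto simp: trunc_def vecs_def fun_eq_iff)

lemma trunc_mem: "u \<in> vecs n \<Longrightarrow> trunc j u \<in> vecs n"
  by (auto simp: trunc_def vecs_def zero_mem)

lemma triangular_unique:
  assumes "u \<in> vecs n" "v \<in> vecs n"
    and "\<And>j. j < n \<Longrightarrow> u j = F j (trunc j u)" "\<And>j. j < n \<Longrightarrow> v j = F j (trunc j v)"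
  shows "u = v"
proof -
  have "trunc j u = trunc j v" if "j \<le> n" for j
    using that by (induction j) (auto simp: trunc_0 trunc_Suc assms(3,4))
  then show ?thesis using trunc_vecs assms(1,2) by (metis order.refl)
qed

lemma triangular_exists:
  assumes "\<And>j u. j < n \<Longrightarrow> u \<in> vecs j \<Longrightarrow> F j u \<in> K"
  shows "\<exists>u\<in>vecs n. \<forall>j<n. u j = F j (trunc j u)"
  using assms
proof (induction n)
  case 0
  then show ?case by (intro bexI[of _ "\<lambda>_. 0"]) (auto simp: vecs_def)
next
  case (Suc n)
  then obtain u where u: "u \<in> vecs n" "\<forall>j<n. u j = F j (trunc j u)" by auto
  let ?u = "u(n := F n u)"
  have trunc: "trunc j ?u = trunc j u" if "j \<le> n" for j using that by (auto simp: trunc_def)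
  have "?u \<in> vecs (Suc n)" using u(1) Suc.prems[of n u] by (auto simp: vecs_def less_Suc_eq)
  moreover have "?u j = F j (trunc j ?u)" if "j < Suc n" for j
    using that u trunc[of j] trunc_vecs[OF u(1)] by (cases "j = n") auto
  ultimately show ?case by blast
qed

end

context polynomial_tower begin

definition adjacent :: "'a coords \<times> 'a coords \<Rightarrow> 'a coords \<times> 'a coords \<Rightarrow> bool" where
  "adjacent w z \<longleftrightarrow>
    (\<forall>j<t. snd w j + snd z j = f j (fst w, fst z, trunc j (snd w), trunc j (snd z)))"

definition M_side :: "(bool \<times> 'a coords \<times> 'a coords) set" where
  "M_side = {False} \<times> vecs r \<times> vecs t"

definition N_side :: "(bool \<times> 'a coords \<times> 'a coords) set" where
  "N_side = {True} \<times> vecs r' \<times> vecs t"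

definition tower_graph :: "(bool \<times> 'a coords \<times> 'a coords) ugraph" where
  "tower_graph = (M_side \<union> N_side,
    {{v, v'} | v v'. v \<in> M_side \<and> v' \<in> N_side \<and> adjacent (snd v) (snd v')})"

lemma tower_graph_edgeI:
  "v \<in> M_side \<Longrightarrow> v' \<in> N_side \<Longrightarrow> adjacent (snd v) (snd v') \<Longrightarrow> {v, v'} \<in> edges tower_graph"
  unfolding tower_graph_def snd_conv by blast

lemma adjacent_unique_right:
  assumes "adjacent w z" "adjacent w z'" "fst z = fst z'" "snd z \<in> vecs t" "snd z' \<in> vecs t"
  shows "z = z'"
proof -
  have "snd z = snd z'"
    by (rule triangular_unique[OF assms(4,5), of "\<lambda>j v. f j (fst w, fst z, trunc j (snd w), v) - snd w j"])
      (use assms(1-3) in \<open>simp_all add: adjacent_def eq_diff_eq add.commute\<close>)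
  then show ?thesis using assms(3) by (simp add: prod_eq_iff)
qed

lemma adjacent_unique_left:
  assumes "adjacent w z" "adjacent w' z" "fst w = fst w'" "snd w \<in> vecs t" "snd w' \<in> vecs t"
  shows "w = w'"
proof -
  have "snd w = snd w'"
    by (rule triangular_unique[OF assms(4,5), of "\<lambda>j u. f j (fst w, fst z, u, trunc j (snd z)) - snd z j"])
      (use assms(1-3) in \<open>simp_all add: adjacent_def eq_diff_eq add.commute\<close>)
  then show ?thesis using assms(3) by (simp add: prod_eq_iff)
qed

lemma exists_adjacent:
  assumes "a \<in> vecs r" "b \<in> vecs r'" "u \<in> vecs t"
  shows "\<exists>v\<in>vecs t. adjacent (a, u) (b, v)"
proof -
  have "f j (a, b, trunc j u, v) - u j \<in> K" if "j < t" "v \<in> vecs j" for j v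
  proof (rule diff_mem)
    have "v \<in> vecs t" using that vecs_mono[of j t] by auto
    then have "(a, b, trunc j u, v) \<in> edge_space" using assms trunc_mem by (simp add: edge_space_def)
    then show "f j (a, b, trunc j u, v) \<in> K" by (rule edge.polyfun_mem[OF polyfun_f[OF that(1)]])
    show "u j \<in> K" using assms(3) that(1) by (simp add: vecs_def)
  qed
  then obtain v where v: "v \<in> vecs t" "\<forall>j<t. v j = f j (a, b, trunc j u, trunc j v) - u j"
    using triangular_exists[of t "\<lambda>j v. f j (a, b, trunc j u, v) - u j"] by blast
  have "adjacent (a, u) (b, v)" unfolding adjacent_def
    using v(2) by (simp add: eq_diff_eq add.commute)
  then show ?thesis using v(1) by blast
qed

lemma bipartite_tower_graph: "bipartite_with_parts tower_graph M_side N_side"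
  unfolding bipartite_with_parts_def finite_simple_graph_def
proof (intro conjI ballI)
  show disjoint: "M_side \<inter> N_side = {}" by (auto simp: M_side_def N_side_def)
  show "finite (verts tower_graph)" by (simp add: tower_graph_def M_side_def N_side_def finite_vecs)
  show "verts tower_graph = M_side \<union> N_side" by (simp add: tower_graph_def)
  fix d assume "d \<in> edges tower_graph"
  then obtain v v' where d: "d = {v, v'}" "v \<in> M_side" "v' \<in> N_side" by (auto simp: tower_graph_def)
  then show "d \<subseteq> verts tower_graph" "\<exists>x\<in>M_side. \<exists>y\<in>N_side. d = {x, y}" by (auto simp: tower_graph_def)
  have "v \<noteq> v'" using d(2,3) disjoint by blast
  then show "card d = 2" using d(1) by simp
qed

lemma card_M_side: "card M_side = q ^ (r + t)" and card_N_side: "card N_side = q ^ (r' + t)"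
  by (simp_all add: M_side_def N_side_def card_cartesian_product card_vecs power_add)

lemma card_edges_tower_graph: "q ^ (r + r' + t) \<le> card (edges tower_graph)"
proof -
  let ?D = "vecs r \<times> vecs r' \<times> vecs t"
  define v where "v a b u = (SOME v. v \<in> vecs t \<and> adjacent (a, u) (b, v))" for a b u
  have v: "v a b u \<in> vecs t \<and> adjacent (a, u) (b, v a b u)" if "a \<in> vecs r" "b \<in> vecs r'" "u \<in> vecs t"
    for a b u
  proof -
    have "\<exists>v. v \<in> vecs t \<and> adjacent (a, u) (b, v)" using exists_adjacent[OF that] by blast
    from someI_ex[OF this] show ?thesis unfolding v_def .
  qed
  define d where "d = (\<lambda>(a, b, u). {(False, a, u), (True, b, v a b u)})"
  have "inj_on d ?D"
  proof (rule inj_onI)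
    fix x y assume d_eq: "d x = d y"
    obtain a b u a' b' u' where xy: "x = (a, b, u)" "y = (a', b', u')" by (cases x, cases y)
    have "{(False, a, u), (True, b, v a b u)} = {(False, a', u'), (True, b', v a' b' u')}"
      using d_eq by (simp only: xy d_def case_prod_conv)
    then show "x = y" by (simp only: xy doubleton_eq_iff prod.inject) blast
  qed
  moreover have "d ` ?D \<subseteq> edges tower_graph"
  proof clarify
    fix a b u assume "a \<in> vecs r" "b \<in> vecs r'" "u \<in> vecs t"
    then have "(False, a, u) \<in> M_side" "(True, b, v a b u) \<in> N_side" "adjacent (a, u) (b, v a b u)"
      using v[of a b u] by (auto simp: M_side_def N_side_def)
    then show "d (a, b, u) \<in> edges tower_graph"
      unfolding d_def case_prod_conv by (intro tower_graph_edgeI) simp_all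
  qed
  moreover have "finite (edges tower_graph)"
    by (rule finite_subset[of _ "Pow (M_side \<union> N_side)"])
      (auto simp: tower_graph_def M_side_def N_side_def finite_vecs)
  ultimately have "card ?D \<le> card (edges tower_graph)" by (rule card_inj_on_le)
  then show ?thesis by (simp add: card_cartesian_product card_vecs power_add mult.assoc)
qed

lemma tower_graph_edgeD:
  assumes "{v, v'} \<in> edges tower_graph"
  shows "v \<in> M_side \<Longrightarrow> v' \<in> N_side \<and> adjacent (snd v) (snd v')"
    "v \<in> N_side \<Longrightarrow> v' \<in> M_side \<and> adjacent (snd v') (snd v)"
proof -
  have "M_side \<inter> N_side = {}" by (auto simp: M_side_def N_side_def)
  then show "v \<in> M_side \<Longrightarrow> v' \<in> N_side \<and> adjacent (snd v) (snd v')"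
    "v \<in> N_side \<Longrightarrow> v' \<in> M_side \<and> adjacent (snd v') (snd v)"
    using assms by (auto simp: tower_graph_def doubleton_eq_iff)
qed

definition path_from_M :: "(nat \<Rightarrow> bool \<times> 'a coords \<times> 'a coords) \<Rightarrow> bool" where
  "path_from_M p \<longleftrightarrow> p 0 \<in> M_side \<and> (\<forall>j<L. {p j, p (Suc j)} \<in> edges tower_graph)"

definition walk_of_path :: "(nat \<Rightarrow> bool \<times> 'a coords \<times> 'a coords) \<Rightarrow> 'a walk" where
  "walk_of_path p = ((\<lambda>j. if j \<le> L then fst (snd (p j)) else (\<lambda>_. 0)), snd (snd (p 0)))"

lemma path_from_M_side:
  assumes "path_from_M p" "j \<le> L"
  shows "p j \<in> (if even j then M_side else N_side)"
  using assms(2)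
proof (induction j)
  case 0
  then show ?case using assms(1) by (simp add: path_from_M_def)
next
  case (Suc j)
  then have "{p j, p (Suc j)} \<in> edges tower_graph" using assms(1) by (simp add: path_from_M_def)
  then show ?case using tower_graph_edgeD Suc by (auto split: if_splits)
qed

lemma path_from_M_vertex:
  assumes "path_from_M p" "j \<le> L"
  shows "fst (p j) = odd j" "fst (snd (p j)) \<in> vecs (label_dim j)" "snd (snd (p j)) \<in> vecs t"
  using path_from_M_side[OF assms]
  by (auto simp: M_side_def N_side_def label_dim_def split: if_splits)

lemma path_from_M_adjacent:
  assumes "path_from_M p" "j < L"
  shows "if even j then adjacent (snd (p j)) (snd (p (Suc j))) else adjacent (snd (p (Suc j))) (snd (p j))"
proof -
  have "{p j, p (Suc j)} \<in> edges tower_graph" using assms by (simp add: path_from_M_def)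
  then show ?thesis
    using tower_graph_edgeD path_from_M_side[OF assms(1), of j] assms(2) by (auto split: if_splits)
qed

lemma path_from_M_reverse:
  assumes "p 0 \<in> N_side" and edges: "\<And>j. j < L \<Longrightarrow> {p j, p (Suc j)} \<in> edges tower_graph"
  shows "path_from_M (\<lambda>j. p (L - j))"
  unfolding path_from_M_def
proof (intro conjI allI impI)
  have "p j \<in> (if even j then N_side else M_side)" if "j \<le> L" for j
    using that
  proof (induction j)
    case (Suc j)
    then show ?case using tower_graph_edgeD[OF edges[of j]] by (auto split: if_splits)
  qed (simp add: assms(1))
  moreover have "odd L" using two_le_k by (simp add: L_def)
  ultimately show "p (L - 0) \<in> M_side" by (metis diff_zero order.refl)
  fix j assume "j < L"
  then have "Suc (L - Suc j) = L - j" by simp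
  then show "{p (L - j), p (L - Suc j)} \<in> edges tower_graph"
    using edges[of "L - Suc j"] \<open>j < L\<close> by (simp add: insert_commute)
qed

lemma walk_of_path_mem: "path_from_M p \<Longrightarrow> walk_of_path p \<in> walk_space"
  using path_from_M_vertex by (auto simp: walk_space_def walk_of_path_def)

lemma lift_coords_walk_of_path:
  assumes p: "path_from_M p" and "j \<le> t" "i \<le> L"
  shows "lift_coords f (walk_of_path p) j i = trunc j (snd (snd (p i)))"
  using assms(2,3)
proof (induction j arbitrary: i)
  case 0
  show ?case by (simp add: trunc_0)
next
  case (Suc j)
  let ?x = "walk_of_path p"
  have IH: "lift_coords f ?x j i = trunc j (snd (snd (p i)))" if "i \<le> L" for i
    using Suc.IH Suc.prems(1) that by simp
  have "coord_along (f j) (edge_of (fst ?x) (lift_coords f ?x j)) (snd ?x j) i = snd (snd (p i)) j"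
    if "i \<le> L" for i
    using that
  proof (induction i)
    case 0
    then show ?case by (simp add: walk_of_path_def)
  next
    case (Suc i)
    then have i: "i \<le> L" "i < L" by auto
    have "f j (edge_of (fst ?x) (lift_coords f ?x j) i) = snd (snd (p i)) j + snd (snd (p (Suc i))) j"
      using path_from_M_adjacent[OF p i(2)] \<open>Suc j \<le> t\<close> IH[of i] IH[of "Suc i"] i Suc.prems
      by (cases "even i") (auto simp: adjacent_def edge_of_def even_end_def odd_end_def
          walk_of_path_def add.commute)
    then show ?case using Suc.IH[OF i(1)] by simp
  qed
  then show ?case using IH Suc.prems by (simp add: trunc_Suc)
qed

lemma vertex_at_walk_of_path:
  assumes "path_from_M p" "i \<le> L"
  shows "vertex_at f t i (walk_of_path p) = snd (p i)"
  using lift_coords_walk_of_path[OF assms(1) order.refl assms(2)] trunc_vecs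
    path_from_M_vertex(3)[OF assms] assms(2)
  by (simp add: vertex_at_def prod_eq_iff) (simp add: walk_of_path_def)

lemma path_from_M_label_neq:
  assumes p: "path_from_M p" and j: "j + 2 \<le> L" and "p j \<noteq> p (j + 2)"
  shows "fst (snd (p j)) \<noteq> fst (snd (p (j + 2)))"
proof
  assume labels_eq: "fst (snd (p j)) = fst (snd (p (j + 2)))"
  have mem: "snd (snd (p j)) \<in> vecs t" "snd (snd (p (j + 2))) \<in> vecs t"
    using path_from_M_vertex[OF p] j by auto
  have adj: "if even i then adjacent (snd (p i)) (snd (p (Suc i)))
      else adjacent (snd (p (Suc i))) (snd (p i))"
    if "i \<in> {j, Suc j}" for i using path_from_M_adjacent[OF p, of i] that j by auto
  have "snd (p j) = snd (p (j + 2))"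
  proof (cases "even j")
    case True
    then show ?thesis using adj[of j] adj[of "Suc j"] adjacent_unique_left[OF _ _ labels_eq mem] by auto
  next
    case False
    then show ?thesis using adj[of j] adj[of "Suc j"] adjacent_unique_right[OF _ _ labels_eq mem] by auto
  qed
  moreover have "fst (p j) = fst (p (j + 2))" using path_from_M_vertex(1)[OF p] j by simp
  ultimately show False using assms(3) by (simp add: prod_eq_iff)
qed

end

context generic_tower begin

lemma card_paths_less:
  assumes p: "\<And>i. i < s \<Longrightarrow> path_from_M (p i)"
    and ends: "\<And>i. i < s \<Longrightarrow> p i 0 = v" "\<And>i. i < s \<Longrightarrow> p i L = v'"
    and nonback: "\<And>i j. i < s \<Longrightarrow> j + 2 \<le> L \<Longrightarrow> p i j \<noteq> p i (j + 2)"
    and inj: "\<And>i i'. i < s \<Longrightarrow> i' < s \<Longrightarrow> p i 1 = p i' 1 \<Longrightarrow> i = i'"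
  shows "s < max_walks"
proof -
  let ?walk = "\<lambda>i. walk_of_path (p i)"
  have vertex: "vertex_at f t j (?walk i) = snd (p i j)" if "i < s" "j \<le> L" for i j
    using vertex_at_walk_of_path p that by blast
  have "inj_on ?walk {..<s}"
  proof (rule inj_onI)
    fix i i' assume i: "i \<in> {..<s}" "i' \<in> {..<s}" "?walk i = ?walk i'"
    then have "snd (p i 1) = snd (p i' 1)" using vertex[of i 1] vertex[of i' 1] three_le_L by simp
    moreover have "fst (p i 1) = fst (p i' 1)" using path_from_M_vertex(1)[OF p] i three_le_L by simp
    ultimately show "i = i'" using inj i by (simp add: prod_eq_iff)
  qed
  moreover have "card (?walk ` {..<s}) < max_walks"
  proof (rule card_walks_less)
    show "?walk ` {..<s} \<subseteq> walk_space" using walk_of_path_mem p by auto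
    show "const_on snd (?walk ` {..<s})" "const_on (\<lambda>x. fst x 0) (?walk ` {..<s})"
      using ends(1) by (auto simp: const_on_def walk_of_path_def)
    show "const_on (vertex_at f t L) (?walk ` {..<s})"
      using vertex ends(2) by (auto simp: const_on_def)
    show "fst x j \<noteq> fst x (j + 2)" if "x \<in> ?walk ` {..<s}" "j + 2 \<le> L" for x j
      using that path_from_M_label_neq[OF p that(2) nonback] by (auto simp: walk_of_path_def)
  qed
  ultimately show ?thesis by (simp add: card_image)
qed

lemma theta_free_tower_graph:
  assumes "max_walks < s"
  shows "free_of tower_graph (theta_graph s L)"
  unfolding free_of_def
proof
  assume "contains_copy tower_graph (theta_graph s L)"
  then obtain w where verts: "\<And>i j. i < s \<Longrightarrow> j \<le> L \<Longrightarrow> w i j \<in> verts tower_graph"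
    and edges: "\<And>i j. i < s \<Longrightarrow> j < L \<Longrightarrow> {w i j, w i (Suc j)} \<in> edges tower_graph"
    and ends: "\<And>i i'. w i 0 = w i' 0" "\<And>i i'. w i L = w i' L"
    and inj: "\<And>i j j'. i < s \<Longrightarrow> j \<le> L \<Longrightarrow> j' \<le> L \<Longrightarrow> w i j = w i j' \<Longrightarrow> j = j'"
    and disjoint: "\<And>i i' j. i < s \<Longrightarrow> i' < s \<Longrightarrow> 0 < j \<Longrightarrow> j < L \<Longrightarrow> w i j = w i' j \<Longrightarrow> i = i'"
    by (rule contains_theta_graphE) blast
  have "w 0 0 \<in> M_side \<union> N_side" using verts[of 0 0] assms by (auto simp: tower_graph_def)
  then have "s < max_walks"
  proof
    assume "w 0 0 \<in> M_side"
    then have "path_from_M (w i)" if "i < s" for i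
      using edges[OF that] ends(1)[of i 0] by (simp add: path_from_M_def)
    then show ?thesis
    proof (rule card_paths_less)
      show "w i 0 = w 0 0" "w i L = w 0 L" for i using ends by blast+
      show "w i j \<noteq> w i (j + 2)" if "i < s" "j + 2 \<le> L" for i j using inj[of i j "j + 2"] that by auto
      show "i = i'" if "i < s" "i' < s" "w i 1 = w i' 1" for i i'
        using disjoint[of i i' 1] that three_le_L by simp
    qed
  next
    assume "w 0 0 \<in> N_side"
    then have "path_from_M (\<lambda>j. w i (L - j))" if "i < s" for i
      using edges[OF that] ends(1)[of i 0] by (intro path_from_M_reverse) simp_all
    then show ?thesis
    proof (rule card_paths_less)
      show "w i (L - 0) = w 0 L" "w i (L - L) = w 0 0" for i using ends[of i 0] by simp_all
      show "w i (L - j) \<noteq> w i (L - (j + 2))" if "i < s" "j + 2 \<le> L" for i j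
        using inj[of i "L - j" "L - (j + 2)"] that by auto
      show "i = i'" if "i < s" "i' < s" "w i (L - 1) = w i' (L - 1)" for i i'
        using disjoint[of i i' "L - 1"] that three_le_L by simp
    qed
  qed
  then show False using assms by simp
qed

end

context tower begin

theorem exists_theta_free_graph:
  assumes "min_field_size \<le> q" "max_walks < s"
  shows "\<exists>(G :: nat ugraph) M N. bipartite_with_parts G M N \<and> card M = q ^ (r + t) \<and> card N = q ^ (r' + t) \<and>
    q ^ (r + r' + t) \<le> card (edges G) \<and> free_of G (theta_graph s L)"
proof -
  obtain f where "generic_tower K e k r r' f" using exists_generic_tower[OF assms(1)] by blast
  then interpret generic_tower K e k r r' f .
  have G: "finite_simple_graph tower_graph" and fin: "finite (verts tower_graph)"
    and MN: "M_side \<subseteq> verts tower_graph" "N_side \<subseteq> verts tower_graph"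
    using bipartite_tower_graph by (auto simp: bipartite_with_parts_def finite_simple_graph_def)
  obtain h :: "bool \<times> 'a coords \<times> 'a coords \<Rightarrow> nat" where h: "inj_on h (verts tower_graph)"
    using finite_imp_inj_to_nat_seg[OF fin] by blast
  have "card (h ` M_side) = q ^ (r + t)" "card (h ` N_side) = q ^ (r' + t)"
    using inj_on_subset[OF h] MN by (simp_all add: card_image card_M_side card_N_side)
  then show ?thesis
    using bipartite_with_parts_map_graph[OF bipartite_tower_graph h] card_edges_map_graph[OF G h]
      free_of_map_graph[OF G h theta_free_tower_graph[OF assms(2)]] card_edges_tower_graph by metis
qed

end

section \<open>Existence of finite subfields\<close>

lemma (in ring_hom_ring) hom_add_pow_one: "h ([(n::nat)] \<cdot>\<^bsub>R\<^esub> \<one>\<^bsub>R\<^esub>) = [n] \<cdot>\<^bsub>S\<^esub> \<one>\<^bsub>S\<^esub>"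
  by (induction n) auto

lemma (in domain) linear_mem: "a \<in> carrier R \<Longrightarrow> [\<one>, \<ominus> a] \<in> carrier (poly_ring R)"
  unfolding sym[OF univ_poly_carrier] polynomial_def by auto

lemma (in domain) var_eq_linear_add_const:
  "a \<in> carrier R \<Longrightarrow> X = [\<one>, \<ominus> a] \<oplus>\<^bsub>poly_ring R\<^esub> poly_of_const a"
  by (auto simp: univ_poly_add poly_of_const_def var_def l_neg r_zero)

lemma (in domain) var_pow_linear_cofactor:
  assumes a: "a \<in> carrier R"
  shows "\<exists>G\<in>carrier (poly_ring R). eval G a = [Suc m] \<cdot> (a [^] m) \<and>
    X [^]\<^bsub>poly_ring R\<^esub> Suc m = [\<one>, \<ominus> a] \<otimes>\<^bsub>poly_ring R\<^esub> G \<oplus>\<^bsub>poly_ring R\<^esub> poly_of_const (a [^] Suc m)"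
proof -
  let ?P = "poly_ring R" and ?lin = "[\<one>, \<ominus> a]"
  note sub = carrier_is_subring
  interpret P: domain ?P using univ_poly_is_domain[OF sub] .
  interpret eval: ring_hom_ring ?P R "\<lambda>p. eval p a" using eval_ring_hom[OF sub a] .
  interpret const: ring_hom_ring R ?P poly_of_const using canonical_embedding_ring_hom[OF sub] by simp
  have X: "X \<in> carrier ?P" using var_closed(1)[OF sub] .
  have lin: "?lin \<in> carrier ?P" using a by (rule linear_mem)
  have X_eq: "X = ?lin \<oplus>\<^bsub>?P\<^esub> poly_of_const a" using a by (rule var_eq_linear_add_const)
  have eval_const: "eval (poly_of_const c) a = c" if "c \<in> carrier R" for c
    using that a by (simp add: poly_of_const_def)
  show ?thesis
  proof (induction m)
    case 0
    show ?case using X X_eq lin a by (intro bexI[of _ "\<one>\<^bsub>?P\<^esub>"]) auto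
  next
    case (Suc m)
    let ?c = "poly_of_const (a [^] Suc m)"
    have c: "?c \<in> carrier ?P" using a by (intro const.hom_closed) simp
    obtain G where G: "G \<in> carrier ?P" "eval G a = [Suc m] \<cdot> (a [^] m)"
      "X [^]\<^bsub>?P\<^esub> Suc m = ?lin \<otimes>\<^bsub>?P\<^esub> G \<oplus>\<^bsub>?P\<^esub> ?c" using Suc.IH by blast
    let ?G = "G \<otimes>\<^bsub>?P\<^esub> X \<oplus>\<^bsub>?P\<^esub> ?c"
    have "X [^]\<^bsub>?P\<^esub> Suc (Suc m) = (?lin \<otimes>\<^bsub>?P\<^esub> G \<oplus>\<^bsub>?P\<^esub> ?c) \<otimes>\<^bsub>?P\<^esub> X"
      using G(3) by simp
    also have "\<dots> = ?lin \<otimes>\<^bsub>?P\<^esub> (G \<otimes>\<^bsub>?P\<^esub> X) \<oplus>\<^bsub>?P\<^esub> ?c \<otimes>\<^bsub>?P\<^esub> (?lin \<oplus>\<^bsub>?P\<^esub> poly_of_const a)"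
      using G(1) X lin c a by (simp add: P.l_distr P.m_assoc X_eq[symmetric])
    also have "\<dots> = ?lin \<otimes>\<^bsub>?P\<^esub> ?G \<oplus>\<^bsub>?P\<^esub> ?c \<otimes>\<^bsub>?P\<^esub> poly_of_const a"
      using G(1) X lin c a by (simp add: P.r_distr P.a_assoc P.m_comm)
    also have "?c \<otimes>\<^bsub>?P\<^esub> poly_of_const a = poly_of_const (a [^] Suc (Suc m))"
      using a by simp
    finally have expansion: "X [^]\<^bsub>?P\<^esub> Suc (Suc m) = ?lin \<otimes>\<^bsub>?P\<^esub> ?G \<oplus>\<^bsub>?P\<^esub> poly_of_const (a [^] Suc (Suc m))" .
    have "eval ?G a = [Suc m] \<cdot> (a [^] m) \<otimes> a \<oplus> a [^] Suc m"
      using G X c a by (simp add: eval_var eval_const)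
    also have "\<dots> = [Suc (Suc m)] \<cdot> (a [^] Suc m)" using a by (simp add: add_pow_ldistr l_distr)
    finally show ?case using expansion G(1) X c by (intro bexI[of _ ?G]) auto
  qed
qed

definition (in ring) power_fixed_poly :: "nat \<Rightarrow> 'a list" where
  "power_fixed_poly n = X [^]\<^bsub>poly_ring R\<^esub> n \<ominus>\<^bsub>poly_ring R\<^esub> X"

lemma (in domain) power_fixed_poly_closed: "power_fixed_poly n \<in> carrier (poly_ring R)"
proof -
  interpret P: domain "poly_ring R" using univ_poly_is_domain[OF carrier_is_subring] .
  show ?thesis using var_closed(1)[OF carrier_is_subring] by (simp add: power_fixed_poly_def)
qed

lemma (in domain) eval_power_fixed_poly:
  assumes "x \<in> carrier R"
  shows "eval (power_fixed_poly n) x = x [^] n \<ominus> x"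
proof -
  interpret eval: ring_hom_ring "poly_ring R" R "\<lambda>p. eval p x"
    using eval_ring_hom[OF carrier_is_subring assms] .
  show ?thesis
    using var_closed(1)[OF carrier_is_subring] assms
    by (simp add: power_fixed_poly_def a_minus_def eval.hom_nat_pow eval_var)
qed

lemma (in domain) degree_power_fixed_poly:
  assumes "1 < n"
  shows "degree (power_fixed_poly n) = n"
proof -
  note sub = carrier_is_subring
  have "power_fixed_poly n = poly_add (monom \<one> n) [\<ominus> \<one>, \<zero>]"
    using univ_poly_a_inv_def'[OF sub var_closed(1)[OF sub]] unitary_monom_eq_var_pow[OF sub, of n]
    by (simp add: power_fixed_poly_def a_minus_def univ_poly_add var_def)
  moreover have "polynomial (carrier R) (monom \<one> n)" using monom_is_polynomial[OF sub, of \<one> n] by simp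
  moreover have "polynomial (carrier R) [\<ominus> \<one>, \<zero>]" unfolding polynomial_def by simp
  ultimately show ?thesis
    using poly_add_degree_eq[OF sub, of "monom \<one> n" "[\<ominus> \<one>, \<zero>]"] assms by (simp add: monom_def)
qed

text \<open>The cofactor of \<open>X - a\<close> in \<open>X\<^sup>n - X\<close> has the value \<open>n a\<^sup>n\<^sup>-\<^sup>1 - 1 = - 1\<close> at a root \<open>a\<close>.\<close>

lemma (in field) power_fixed_poly_simple_root:
  assumes char: "[(n::nat)] \<cdot> \<one> = \<zero>" and "0 < n" and a: "a \<in># roots (power_fixed_poly n)"
  shows "count (roots (power_fixed_poly n)) a = 1"
proof -
  let ?P = "poly_ring R" and ?lin = "[\<one>, \<ominus> a]"
  interpret P: domain ?P using univ_poly_is_domain[OF carrier_is_subring] .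
  obtain m where m: "n = Suc m" using \<open>0 < n\<close> by (cases n) auto
  have a: "a \<in> carrier R" "a [^] n = a"
    using a roots_mem_iff_is_root[OF power_fixed_poly_closed] eval_power_fixed_poly
    by (auto simp: is_root_def)
  interpret eval: ring_hom_ring ?P R "\<lambda>p. eval p a" using eval_ring_hom[OF carrier_is_subring a(1)] .
  obtain G where G: "G \<in> carrier ?P" "eval G a = [n] \<cdot> (a [^] m)"
    "X [^]\<^bsub>?P\<^esub> n = ?lin \<otimes>\<^bsub>?P\<^esub> G \<oplus>\<^bsub>?P\<^esub> poly_of_const a"
    using var_pow_linear_cofactor[OF a(1), of m] a(2) unfolding m by metis
  define H where "H = G \<ominus>\<^bsub>?P\<^esub> \<one>\<^bsub>?P\<^esub>"
  have H: "H \<in> carrier ?P" using G(1) by (simp add: H_def)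
  have lin: "?lin \<in> carrier ?P" using linear_mem[OF a(1)] .
  have const: "poly_of_const a \<in> carrier ?P"
    using ring_hom_memE(1)[OF canonical_embedding_is_hom[OF carrier_is_subring]] a(1) by simp
  have "power_fixed_poly n = (?lin \<otimes>\<^bsub>?P\<^esub> G \<oplus>\<^bsub>?P\<^esub> poly_of_const a) \<ominus>\<^bsub>?P\<^esub> (?lin \<oplus>\<^bsub>?P\<^esub> poly_of_const a)"
    unfolding power_fixed_poly_def G(3) using var_eq_linear_add_const[OF a(1)] by simp
  also have "\<dots> = ?lin \<otimes>\<^bsub>?P\<^esub> H" unfolding H_def using lin const G(1) by algebra
  finally have factor: "power_fixed_poly n = ?lin \<otimes>\<^bsub>?P\<^esub> H" .
  have "[n] \<cdot> (a [^] m) = [n] \<cdot> \<one> \<otimes> a [^] m" using a(1) by (simp add: add_pow_ldistr)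
  then have "eval H a = \<ominus> \<one>" using G(1,2) a(1) char by (simp add: H_def a_minus_def)
  moreover have "\<ominus> \<one> \<noteq> \<zero>" by (metis minus_minus minus_zero one_closed one_not_zero)
  ultimately have nonroot: "eval H a \<noteq> \<zero>" by simp
  then have "a \<notin># roots H" "H \<noteq> []" using roots_mem_iff_is_root[OF H] by (auto simp: is_root_def)
  then show ?thesis
    using poly_mult_degree_one_monic_imp_same_roots[OF a(1) H] by (simp add: factor count_eq_zero_iff)
qed

lemma (in algebraically_closed) card_power_fixed_points:
  assumes n: "1 < n" and char: "[(n::nat)] \<cdot> \<one> = \<zero>"
  shows "card {x \<in> carrier L. x [^] n = x} = n"
proof -
  let ?p = "power_fixed_poly n"
  have "count (roots ?p) a = 1" if "a \<in># roots ?p" for a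
    using power_fixed_poly_simple_root[OF char _ that] n by simp
  then have "roots ?p = mset_set (set_mset (roots ?p))"
    by (intro multiset_eqI) (simp add: count_mset_set' count_eq_zero_iff)
  moreover have "size (roots ?p) = n"
    using roots_over_carrier[OF power_fixed_poly_closed] degree_power_fixed_poly[OF n]
    by (simp add: splitted_def)
  ultimately have "card (set_mset (roots ?p)) = n" by (metis size_mset_set)
  moreover have "set_mset (roots ?p) = {x \<in> carrier L. x [^] n = x}"
    using roots_mem_iff_is_root[OF power_fixed_poly_closed] eval_power_fixed_poly
      degree_power_fixed_poly[OF n] n
    by (auto simp: is_root_def)
  ultimately show ?thesis by simp
qed

text \<open>For nonprime \<open>p\<close> the characteristic is \<open>2\<close>, a junk value that makes every \<open>AC p\<close> a field.\<close>

definition AC :: "nat \<Rightarrow> ((int list \<times> nat) multiset \<Rightarrow> int) ring" where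
  "AC p = field.alg_closure (residue_ring (int (if Factorial_Ring.prime p then p else 2)))"

lemma (in residues_prime) add_pow_char_one: "[p] \<cdot>\<^bsub>R\<^esub> \<one>\<^bsub>R\<^esub> = \<zero>\<^bsub>R\<^esub>"
proof -
  have "[m] \<cdot>\<^bsub>R\<^esub> \<one>\<^bsub>R\<^esub> = int m mod int p" for m :: nat
    by (induction m) (simp_all add: res_zero_eq res_add_eq res_one_eq mod_simps add.commute)
  then show ?thesis by (simp add: res_zero_eq)
qed

lemma algebraically_closed_AC: "algebraically_closed (AC p)"
  and AC_char: "Factorial_Ring.prime p \<Longrightarrow> [p] \<cdot>\<^bsub>AC p\<^esub> \<one>\<^bsub>AC p\<^esub> = \<zero>\<^bsub>AC p\<^esub>"
proof -
  define p' where "p' = (if Factorial_Ring.prime p then p else 2)"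
  define R where "R = residue_ring (int p')"
  interpret R: residues_prime p' R by unfold_locales (simp_all add: R_def p'_def)
  have AC: "algebraic_closure (AC p) (R.indexed_const ` carrier R)"
    and hom: "R.indexed_const \<in> ring_hom R (AC p)"
    using R.alg_closureE by (simp_all add: AC_def p'_def R_def)
  interpret AC: algebraic_closure "AC p" "R.indexed_const ` carrier R" by (rule AC)
  show "algebraically_closed (AC p)" by unfold_locales
  interpret const: ring_hom_ring R "AC p" R.indexed_const
    using hom by (intro ring_hom_ring.intro R.ring_axioms AC.ring_axioms ring_hom_ring_axioms.intro)
  assume "Factorial_Ring.prime p"
  then show "[p] \<cdot>\<^bsub>AC p\<^esub> \<one>\<^bsub>AC p\<^esub> = \<zero>\<^bsub>AC p\<^esub>"
    using const.hom_add_pow_one[of p] R.add_pow_char_one by (simp add: p'_def)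
qed

lemma field_AC: "field (AC p)"
  using algebraically_closed_AC by (rule algebraically_closed.axioms(1))

interpretation AC: domain "AC p" for p
  using field_AC by (rule field.axioms(1))

text \<open>
  The product over all primes of the algebraic closures of the prime fields: one type that contains
  all finite fields.
\<close>

typedef uring = "{f :: nat \<Rightarrow> (int list \<times> nat) multiset \<Rightarrow> int. \<forall>p. f p \<in> carrier (AC p)}"
  by (rule exI[of _ "\<lambda>p. \<zero>\<^bsub>AC p\<^esub>"]) simp

setup_lifting type_definition_uring

instantiation uring :: comm_ring_1
begin

lift_definition zero_uring :: uring is "\<lambda>p. \<zero>\<^bsub>AC p\<^esub>" by simp
lift_definition one_uring :: uring is "\<lambda>p. \<one>\<^bsub>AC p\<^esub>" by simp
lift_definition plus_uring :: "uring \<Rightarrow> uring \<Rightarrow> uring" is "\<lambda>f g p. f p \<oplus>\<^bsub>AC p\<^esub> g p" by simp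
lift_definition times_uring :: "uring \<Rightarrow> uring \<Rightarrow> uring" is "\<lambda>f g p. f p \<otimes>\<^bsub>AC p\<^esub> g p" by simp
lift_definition uminus_uring :: "uring \<Rightarrow> uring" is "\<lambda>f p. \<ominus>\<^bsub>AC p\<^esub> f p" by simp
lift_definition minus_uring :: "uring \<Rightarrow> uring \<Rightarrow> uring" is "\<lambda>f g p. f p \<ominus>\<^bsub>AC p\<^esub> g p" by simp

instance
proof
  fix a b c :: uring
  show "a * b * c = a * (b * c)" by transfer (simp add: AC.m_assoc)
  show "a * b = b * a" by transfer (simp add: AC.m_comm)
  show "1 * a = a" by transfer simp
  show "a + b + c = a + (b + c)" by transfer (simp add: AC.a_assoc)
  show "a + b = b + a" by transfer (simp add: AC.a_comm)
  show "0 + a = a" by transfer simp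
  show "- a + a = 0" by transfer (simp add: AC.l_neg)
  show "a - b = a + - b" by transfer (simp add: a_minus_def)
  show "(a + b) * c = a * c + b * c" by transfer (simp add: AC.l_distr)
  show "(0::uring) \<noteq> 1" by transfer (metis AC.one_not_zero)
qed

end

definition incl :: "nat \<Rightarrow> ((int list \<times> nat) multiset \<Rightarrow> int) \<Rightarrow> uring" where
  "incl p x = Abs_uring (\<lambda>p'. if p' = p then x else \<zero>\<^bsub>AC p'\<^esub>)"

lemma Rep_uring_carrier: "Rep_uring u p \<in> carrier (AC p)"
  using Rep_uring[of u] by simp

lemma Rep_uring_power: "Rep_uring (u ^ n) p = Rep_uring u p [^]\<^bsub>AC p\<^esub> n"
  by (induction n) (simp_all add: one_uring.rep_eq times_uring.rep_eq AC.m_comm Rep_uring_carrier)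

lemma Rep_uring_of_nat: "Rep_uring (of_nat n) p = [n] \<cdot>\<^bsub>AC p\<^esub> \<one>\<^bsub>AC p\<^esub>"
  by (induction n) (simp_all add: zero_uring.rep_eq one_uring.rep_eq plus_uring.rep_eq AC.a_comm)

lemma Rep_uring_incl:
  "x \<in> carrier (AC p) \<Longrightarrow> Rep_uring (incl p x) = (\<lambda>p'. if p' = p then x else \<zero>\<^bsub>AC p'\<^esub>)"
  unfolding incl_def by (rule Abs_uring_inverse) simp

lemma incl_hom:
  assumes "x \<in> carrier (AC p)" "y \<in> carrier (AC p)"
  shows "incl p (x \<oplus>\<^bsub>AC p\<^esub> y) = incl p x + incl p y" "incl p (x \<otimes>\<^bsub>AC p\<^esub> y) = incl p x * incl p y"
    "incl p (\<ominus>\<^bsub>AC p\<^esub> x) = - incl p x"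
  unfolding Rep_uring_inject[symmetric] using assms
  by (auto simp: Rep_uring_incl plus_uring.rep_eq times_uring.rep_eq uminus_uring.rep_eq fun_eq_iff)

lemma incl_zero: "incl p \<zero>\<^bsub>AC p\<^esub> = 0"
  unfolding Rep_uring_inject[symmetric] by (auto simp: Rep_uring_incl zero_uring.rep_eq)

lemma inj_on_incl: "inj_on (incl p) (carrier (AC p))"
  by (rule inj_onI) (metis Rep_uring_incl)

lemma finite_subfield_incl:
  assumes S: "subfield S (AC p)" "finite S"
  shows "finite_subfield (incl p ` S) (incl p \<one>\<^bsub>AC p\<^esub>)"
proof
  note ring = subringE[OF subfieldE(1)[OF S(1)]]
  have carrier: "x \<in> carrier (AC p)" if "x \<in> S" for x using ring(1) that by blast
  show "finite (incl p ` S)" using S(2) by simp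
  show "incl p \<one>\<^bsub>AC p\<^esub> \<in> incl p ` S" using ring(3) by simp
  show "incl p \<one>\<^bsub>AC p\<^esub> \<noteq> 0"
    using inj_onD[OF inj_on_incl, of p "\<one>\<^bsub>AC p\<^esub>" "\<zero>\<^bsub>AC p\<^esub>"] by (auto simp: incl_zero)
  fix u assume "u \<in> incl p ` S"
  then obtain x where x: "x \<in> S" "u = incl p x" by blast
  show "- u \<in> incl p ` S" using x ring(5) incl_hom(3)[of x p, symmetric] carrier by auto
  show "incl p \<one>\<^bsub>AC p\<^esub> * u = u" using x carrier incl_hom(2)[of "\<one>\<^bsub>AC p\<^esub>" p x] by simp
  show "u + v \<in> incl p ` S" "u * v \<in> incl p ` S" if v: "v \<in> incl p ` S" for v
  proof -
    obtain y where y: "y \<in> S" "v = incl p y" using v by blast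
    show "u + v \<in> incl p ` S" "u * v \<in> incl p ` S"
      using x y ring(6,7)[OF x(1) y(1)] incl_hom(1,2)[of x p y] carrier by (metis image_eqI)+
  qed
  show "\<exists>v\<in>incl p ` S. u * v = incl p \<one>\<^bsub>AC p\<^esub>" if "u \<noteq> 0"
  proof -
    have "x \<in> S - {\<zero>\<^bsub>AC p\<^esub>}" using x that incl_zero by auto
    from AC.subfield_m_inv[OF S(1) this] show ?thesis
      using x carrier incl_hom(2)[of x p "inv\<^bsub>AC p\<^esub> x"] by auto
  qed
qed

lemma frobenius_add:
  fixes u v :: "'a::comm_ring_1"
  assumes p: "Factorial_Ring.prime p" and u: "of_nat p * u = 0"
  shows "(u + v) ^ p = u ^ p + v ^ p"
proof -
  have "of_nat (p choose i) * u ^ i * v ^ (p - i) = 0" if i: "i \<in> {..p} - {0, p}" for i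
  proof -
    have "p dvd (p choose i)" using p i by (intro dvd_choose_prime) auto
    then obtain c where c: "p choose i = p * c" by blast
    obtain i' where i': "i = Suc i'" using i by (cases i) auto
    have "of_nat (p choose i) * u ^ i = of_nat c * u ^ i' * (of_nat p * u)"
      unfolding c by (simp add: i' algebra_simps)
    then show ?thesis using u by simp
  qed
  then have "(u + v) ^ p = (\<Sum>i\<in>{0, p}. of_nat (p choose i) * u ^ i * v ^ (p - i))"
    unfolding binomial_ring by (intro sum.mono_neutral_right) auto
  also have "\<dots> = u ^ p + v ^ p" using prime_gt_0_nat[OF p] by simp
  finally show ?thesis .
qed

lemma frobenius_power_add:
  fixes u v :: "'a::comm_ring_1"
  assumes p: "Factorial_Ring.prime p" and u: "of_nat p * u = 0"
  shows "(u + v) ^ (p ^ n) = u ^ (p ^ n) + v ^ (p ^ n)"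
proof (induction n)
  case (Suc n)
  obtain m where "p ^ n = Suc m" using prime_gt_0_nat[OF p] by (metis gr0_implies_Suc zero_less_power)
  then have "of_nat p * u ^ (p ^ n) = 0" using u by (simp add: mult.assoc[symmetric])
  then have "(u ^ p ^ n + v ^ p ^ n) ^ p = (u ^ p ^ n) ^ p + (v ^ p ^ n) ^ p"
    by (rule frobenius_add[OF p])
  then show ?case using Suc by (simp only: power_Suc2 power_mult)
qed simp

lemma AC_frobenius_add:
  assumes p: "Factorial_Ring.prime p" and xy: "x \<in> carrier (AC p)" "y \<in> carrier (AC p)"
  shows "(x \<oplus>\<^bsub>AC p\<^esub> y) [^]\<^bsub>AC p\<^esub> (p ^ n) = x [^]\<^bsub>AC p\<^esub> (p ^ n) \<oplus>\<^bsub>AC p\<^esub> y [^]\<^bsub>AC p\<^esub> (p ^ n)"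
proof -
  have "of_nat p * incl p x = 0"
    unfolding Rep_uring_inject[symmetric] fun_eq_iff times_uring.rep_eq Rep_uring_of_nat zero_uring.rep_eq
    using AC_char[OF p] xy by (auto simp: Rep_uring_incl)
  from arg_cong[OF frobenius_power_add[OF p this, of "incl p y" n], of "\<lambda>u. Rep_uring u p"]
  show ?thesis using xy by (simp add: Rep_uring_power plus_uring.rep_eq Rep_uring_incl)
qed

lemma subfield_frobenius_fixed:
  assumes p: "Factorial_Ring.prime p" and "Q = p ^ n"
  shows "subfield {x \<in> carrier (AC p). x [^]\<^bsub>AC p\<^esub> Q = x} (AC p)"
proof (rule field.subfieldI'[OF field_AC AC.subringI])
  let ?S = "{x \<in> carrier (AC p). x [^]\<^bsub>AC p\<^esub> Q = x}"
  have Q: "0 < Q" using prime_gt_0_nat[OF p] assms(2) by simp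
  note add = AC_frobenius_add[OF p, of _ _ n, folded assms(2)]
  show "?S \<subseteq> carrier (AC p)" "\<one>\<^bsub>AC p\<^esub> \<in> ?S" by auto
  fix x assume "x \<in> ?S"
  then have x: "x \<in> carrier (AC p)" "x [^]\<^bsub>AC p\<^esub> Q = x" by auto
  have mult: "(x \<otimes>\<^bsub>AC p\<^esub> y) [^]\<^bsub>AC p\<^esub> Q = x \<otimes>\<^bsub>AC p\<^esub> y [^]\<^bsub>AC p\<^esub> Q" if "y \<in> carrier (AC p)" for y
    using AC.pow_mult_distrib[OF AC.m_comm] x that by metis
  show "x \<oplus>\<^bsub>AC p\<^esub> y \<in> ?S" "x \<otimes>\<^bsub>AC p\<^esub> y \<in> ?S" if "y \<in> ?S" for y
    using that x add mult by auto
  show "\<ominus>\<^bsub>AC p\<^esub> x \<in> ?S"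
  proof -
    have "(\<ominus>\<^bsub>AC p\<^esub> x) [^]\<^bsub>AC p\<^esub> Q \<oplus>\<^bsub>AC p\<^esub> x = \<zero>\<^bsub>AC p\<^esub>"
      using add[of "\<ominus>\<^bsub>AC p\<^esub> x" x] x Q by (simp add: AC.l_neg AC.nat_pow_zero)
    then have "\<ominus>\<^bsub>AC p\<^esub> x = (\<ominus>\<^bsub>AC p\<^esub> x) [^]\<^bsub>AC p\<^esub> Q"
      using x(1) by (intro AC.minus_equality) auto
    then show ?thesis using x(1) by simp
  qed
next
  fix x assume "x \<in> {x \<in> carrier (AC p). x [^]\<^bsub>AC p\<^esub> Q = x} - {\<zero>\<^bsub>AC p\<^esub>}"
  then have x: "x \<in> carrier (AC p)" "x [^]\<^bsub>AC p\<^esub> Q = x" "x \<in> Units (AC p)"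
    by (auto simp: field.field_Units[OF field_AC])
  then have "x \<otimes>\<^bsub>AC p\<^esub> (inv\<^bsub>AC p\<^esub> x) [^]\<^bsub>AC p\<^esub> Q = (x \<otimes>\<^bsub>AC p\<^esub> inv\<^bsub>AC p\<^esub> x) [^]\<^bsub>AC p\<^esub> Q"
    using AC.pow_mult_distrib[OF AC.m_comm] by (metis AC.Units_inv_closed)
  then have "inv\<^bsub>AC p\<^esub> x = (inv\<^bsub>AC p\<^esub> x) [^]\<^bsub>AC p\<^esub> Q"
    using x by (intro AC.comm_inv_char) simp_all
  then show "inv\<^bsub>AC p\<^esub> x \<in> {x \<in> carrier (AC p). x [^]\<^bsub>AC p\<^esub> Q = x}" using x by simp
qed

lemma exists_finite_subfield:
  assumes "primepow Q"
  shows "\<exists>(K :: uring set) e. finite_subfield K e \<and> card K = Q"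
proof -
  obtain p n where p: "Factorial_Ring.prime p" "0 < n" "Q = p ^ n"
    using assms by (auto simp: primepow_def)
  have Q: "1 < Q" using primepow_gt_Suc_0[OF assms] by simp
  let ?S = "{x \<in> carrier (AC p). x [^]\<^bsub>AC p\<^esub> Q = x}"
  have "Q = p * p ^ (n - 1)" using p(2,3) by (cases n) auto
  then have "[Q] \<cdot>\<^bsub>AC p\<^esub> \<one>\<^bsub>AC p\<^esub> = [(p ^ (n - 1))] \<cdot>\<^bsub>AC p\<^esub> ([p] \<cdot>\<^bsub>AC p\<^esub> \<one>\<^bsub>AC p\<^esub>)"
    by (simp add: AC.add.nat_pow_pow)
  then have "[Q] \<cdot>\<^bsub>AC p\<^esub> \<one>\<^bsub>AC p\<^esub> = \<zero>\<^bsub>AC p\<^esub>" using AC_char[OF p(1)] by simp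
  then have card: "card ?S = Q"
    by (rule algebraically_closed.card_power_fixed_points[OF algebraically_closed_AC Q])
  then have "finite ?S" using Q by (intro card_ge_0_finite) simp
  then have "finite_subfield (incl p ` ?S) (incl p \<one>\<^bsub>AC p\<^esub>)"
    by (rule finite_subfield_incl[OF subfield_frobenius_fixed[OF p(1,3)]])
  moreover have "card (incl p ` ?S) = Q"
    using card inj_on_subset[OF inj_on_incl] by (subst card_image) auto
  ultimately show ?thesis by blast
qed

section \<open>The main theorem\<close>

theorem exists_theta_free_bipartite_graphs:
  fixes k g h :: nat
  assumes k: "2 \<le> k" and gh: "(k - 1) * g \<le> k * h" "(k - 1) * h \<le> k * g"
  shows "\<exists>s0 q0 :: nat. \<forall>s\<ge>s0. \<forall>q\<ge>q0. primepow q \<longrightarrow> (\<exists>(G :: nat ugraph) M N.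
    bipartite_with_parts G M N \<and> card M = q ^ ((2 * k - 1) * h) \<and> card N = q ^ ((2 * k - 1) * g) \<and>
    free_of G (theta_graph s (2 * k - 1)) \<and> q ^ (k * (g + h)) \<le> card (edges G))"
proof -
  define r r' where "r = k * h - (k - 1) * g" and "r' = k * g - (k - 1) * h"
  obtain k' where k': "k = Suc k'" using k by (cases k) auto
  have dims: "r + (k - 1) * (r + r') = (2 * k - 1) * h" "r' + (k - 1) * (r + r') = (2 * k - 1) * g"
    "r + r' + (k - 1) * (r + r') = k * (g + h)"
    using gh by (auto simp: r_def r'_def k' algebra_simps)
  show ?thesis
  proof (rule exI[of _ "Suc (tower.max_walks k r r')"],
    rule exI[of _ "tower.min_field_size k r r'"], intro allI impI)
    fix s Q :: nat
    assume s: "Suc (tower.max_walks k r r') \<le> s" and Q: "tower.min_field_size k r r' \<le> Q" and "primepow Q"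
    obtain K :: "uring set" and e where K: "finite_subfield K e" "card K = Q"
      using exists_finite_subfield[OF \<open>primepow Q\<close>] by blast
    interpret finite_subfield K e by (rule K(1))
    interpret tower K e k r r' by unfold_locales (rule k)
    show "\<exists>(G :: nat ugraph) M N. bipartite_with_parts G M N \<and>
      card M = Q ^ ((2 * k - 1) * h) \<and> card N = Q ^ ((2 * k - 1) * g) \<and>
      free_of G (theta_graph s (2 * k - 1)) \<and> Q ^ (k * (g + h)) \<le> card (edges G)"
      using exists_theta_free_graph[of s] s Q
      unfolding K(2) t_def L_def dims by (auto simp: Suc_le_eq)
  qed
qed

lemma least_length_multiple:
  fixes k l :: nat and \<alpha> :: real
  assumes k: "2 \<le> k" and \<alpha>: "\<alpha> \<in> \<rat>"
    and l: "l = (LEAST m. m > 0 \<and> real m / (2 * real k - 1) \<in> \<int> \<and> \<alpha> * real m / (2 * real k - 1) \<in> \<int>)"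
  shows "real l / (2 * real k - 1) \<in> \<int>" "\<alpha> * real l / (2 * real k - 1) \<in> \<int>"
proof -
  let ?admissible = "\<lambda>m::nat. m > 0 \<and> real m / (2 * real k - 1) \<in> \<int> \<and> \<alpha> * real m / (2 * real k - 1) \<in> \<int>"
  obtain a b :: int where ab: "b > 0" "\<alpha> = of_int a / of_int b" using \<alpha> by (auto elim: Rats_cases')
  have "real ((2 * k - 1) * nat b) = (2 * real k - 1) * of_int b"
    using k ab(1) by (simp add: of_nat_diff)
  then have "?admissible ((2 * k - 1) * nat b)" using k ab by (simp add: zero_less_mult_iff)
  then have "?admissible l" unfolding l by (rule LeastI)
  then show "real l / (2 * real k - 1) \<in> \<int>" "\<alpha> * real l / (2 * real k - 1) \<in> \<int>" by auto
qed

lemma length_factors: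
  fixes k l :: nat and \<alpha> :: real
  assumes k: "2 \<le> k" and \<alpha>: "(real k - 1) / real k \<le> \<alpha>" "\<alpha> \<le> 1"
    and l: "real l / (2 * real k - 1) \<in> \<int>" "\<alpha> * real l / (2 * real k - 1) \<in> \<int>"
  obtains g h :: nat where "l = (2 * k - 1) * g" "\<alpha> * real l = real ((2 * k - 1) * h)"
    "(k - 1) * g \<le> k * h" "(k - 1) * h \<le> k * g"
proof -
  have c: "real (2 * k - 1) = 2 * real k - 1" "0 < 2 * real k - 1" using k by (auto simp: of_nat_diff)
  have \<alpha>k: "real k - 1 \<le> \<alpha> * real k" using k \<alpha>(1) by (simp add: field_simps)
  have "0 \<le> (real k - 1) / real k" using k by simp
  then have \<alpha>0: "0 \<le> \<alpha>" using \<alpha>(1) by (rule order.trans)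
  have nat: "\<exists>n::nat. x = real n" if "x \<in> \<int>" "0 \<le> x" for x
    using that by (metis Ints_cases of_int_0_le_iff of_nat_nat)
  obtain g h :: nat where g: "real l / (2 * real k - 1) = real g"
    and h: "\<alpha> * real l / (2 * real k - 1) = real h"
    using nat[OF l(1)] nat[OF l(2)] \<alpha>0 c by auto
  have "real l = real ((2 * k - 1) * g)" and lh: "\<alpha> * real l = real ((2 * k - 1) * h)"
    using g h c by (simp_all add: field_simps)
  then have lg: "l = (2 * k - 1) * g" using of_nat_eq_iff by blast
  have \<alpha>g: "\<alpha> * real g = real h" using g h by (metis times_divide_eq_right)
  have "real h \<le> real g" using mult_right_mono[OF \<alpha>(2), of "real g"] \<alpha>g by simp
  then have "(k - 1) * h \<le> k * g" by (intro mult_le_mono) auto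
  moreover have "(k - 1) * g \<le> k * h"
  proof -
    have "(real k - 1) * real g \<le> (\<alpha> * real g) * real k"
      using mult_right_mono[OF \<alpha>k, of "real g"] by (simp add: mult_ac)
    then have "real ((k - 1) * g) \<le> real (k * h)" using k by (simp add: \<alpha>g of_nat_diff mult_ac)
    then show ?thesis by linarith
  qed
  ultimately show thesis by (intro that[OF lg lh])
qed

lemma power_powr_ratio:
  assumes "0 < q" "0 < c"
  shows "(real q ^ (c * n)) powr (real m / real c) = real q ^ (m * n)"
proof -
  have "(real q ^ (c * n)) powr (real m / real c) = real q powr (real (c * n) * (real m / real c))"
    using assms(1) by (simp add: powr_powr flip: powr_realpow)
  also have "real (c * n) * (real m / real c) = real (m * n)" using assms(2) by simp
  also have "real q powr real (m * n) = real q ^ (m * n)" using assms(1) by (intro powr_realpow) simp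
  finally show ?thesis .
qed

lemma half_powr_mult_le:
  assumes "0 < q" "0 < c" "q ^ (k * (g + h)) \<le> n"
  shows "1 / 2 * real (q ^ (c * h)) powr (real k / real c) * real (q ^ (c * g)) powr (real k / real c)
    \<le> real n"
proof -
  have "1 / 2 * real (q ^ (c * h)) powr (real k / real c) * real (q ^ (c * g)) powr (real k / real c)
      = real (q ^ (k * (g + h))) / 2"
    using power_powr_ratio[OF assms(1,2)] by (simp add: power_add distrib_left)
  also have "\<dots> \<le> real (q ^ (k * (g + h)))" by simp
  also have "\<dots> \<le> real n" using assms(3) by (rule of_nat_mono)
  finally show ?thesis .
qed

theorem theorem5p6:
  fixes k l :: nat and \<alpha> :: real
  assumes "k \<ge> 2"
    and "\<alpha> \<in> \<rat>"
    and "\<alpha> \<in> {(real k - 1) / real k .. 1}"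
    and "l = (LEAST m. m > 0 \<and> real m / (2 * real k - 1) \<in> \<int>
                       \<and> \<alpha> * real m / (2 * real k - 1) \<in> \<int>)"
  shows "\<exists>s0 q0 :: nat. \<forall>s\<ge>s0. \<forall>q\<ge>q0. primepow q \<longrightarrow>
    (\<exists>(G :: nat ugraph) M N.
       bipartite_with_parts G M N \<and>
       real (card M) = real q powr (\<alpha> * real l) \<and>
       card N = q ^ l \<and>
       free_of G (theta_graph s (2 * k - 1)) \<and>
       real (card (edges G)) \<ge> 1 / 2 * real (card M) powr (real k / (2 * real k - 1))
                                    * real (card N) powr (real k / (2 * real k - 1)))"
proof -
  let ?c = "2 * k - 1"
  have c: "0 < ?c" "2 * real k - 1 = real ?c" using assms(1) by (simp_all add: of_nat_diff)
  have "(real k - 1) / real k \<le> \<alpha>" "\<alpha> \<le> 1" using assms(3) by simp_all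
  from length_factors[OF assms(1) this least_length_multiple[OF assms(1,2,4)]]
  obtain g h where l: "l = ?c * g" "\<alpha> * real l = real (?c * h)"
    and gh: "(k - 1) * g \<le> k * h" "(k - 1) * h \<le> k * g" .
  obtain s0 q0 where graphs: "\<forall>s\<ge>s0. \<forall>q\<ge>q0. primepow q \<longrightarrow>
      (\<exists>(G :: nat ugraph) M N. bipartite_with_parts G M N \<and>
        card M = q ^ (?c * h) \<and> card N = q ^ (?c * g) \<and>
        free_of G (theta_graph s ?c) \<and> q ^ (k * (g + h)) \<le> card (edges G))"
    using exists_theta_free_bipartite_graphs[OF assms(1) gh] by blast
  show ?thesis
  proof (rule exI[of _ s0], rule exI[of _ q0], intro allI impI, goal_cases)
    case (1 s q)
    with graphs obtain G :: "nat ugraph" and M N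
      where G: "bipartite_with_parts G M N" "free_of G (theta_graph s ?c)"
      and card: "card M = q ^ (?c * h)" "card N = q ^ (?c * g)" "q ^ (k * (g + h)) \<le> card (edges G)"
      by blast
    have q: "0 < q" using 1(3) by (rule primepow_gt_0_nat)
    then have "real (card M) = real q powr (\<alpha> * real l)"
      unfolding l(2) card(1) by (simp only: powr_realpow of_nat_power of_nat_0_less_iff)
    with G card(2) half_powr_mult_le[OF q c(1) card(3)]
    show ?case
      unfolding c(2) l(1) card(1,2)[symmetric] by blast
  qed
qed

end
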